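(* For every integer $k\ge4$ there exist $a,b\ge0$ with $$\mathrm{SNR}=\frac{(a-b)^2}{k(a+(k-1)b)}<1$$ such that detection is information-theoretically solvable in $\mathrm{SBM}(n,k,a,b)$, i.e. there exists an algorithm (with no constraint on its running time) that solves detection in $\mathrm{SBM}(n,k,a,b)$.
   Context: $\mathrm{SBM}(n,k,a,b)$: each vertex $v\in[n]$ is independently assigned a uniform community $\sigma_v\in[k]$; then for every $v\ne v'$ an edge is placed independently with probability $a/n$ if $\sigma_v=\sigma_{v'}$ and $b/n$ otherwise; $G$ is the resulting graph. Write $\Omega_i=\{v:\sigma_v=i\}$. A (possibly randomized) algorithm that takes the graph $G$ and outputs a partition of its vertices into two sets $S,S^c$ solves detection in $\mathrm{SBM}(n,k,a,b)$ if there exists $\epsilon>0$ such that, with probability $1-o(1)$ as $n\to\infty$, there exist $i,j\in[k]$ with $|\Omega_i\cap S|/|\Omega_i|-|\Omega_j\cap S|/|\Omega_j|>\epsilon$. *)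

theory Defs
  imports "HOL-Probability.Probability"
begin

text \<open>A simple graph is a pair of a vertex set and a set of two-element sets of vertices.\<close>

type_synonym graph = "nat set \<times> nat set set"

definition vertex_pairs :: "nat \<Rightarrow> nat set set" where
  "vertex_pairs n = {e. e \<subseteq> {1..n} \<and> card e = 2}"

definition community_pmf :: "nat \<Rightarrow> nat \<Rightarrow> (nat \<Rightarrow> nat) pmf" where
  "community_pmf n k = Pi_pmf {1..n} 0 (\<lambda>_. pmf_of_set {1..k})"

text \<open>The library truncates the parameter of \<open>bernoulli_pmf\<close> to the unit interval, so the
  edge probabilities are $\min(1, a/n)$ and $\min(1, b/n)$; this matters only for finitely many $n$.\<close>

definition edge_prob :: "nat \<Rightarrow> real \<Rightarrow> real \<Rightarrow> (nat \<Rightarrow> nat) \<Rightarrow> nat set \<Rightarrow> real" where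
  "edge_prob n a b \<sigma> e = (if \<forall>u\<in>e. \<forall>v\<in>e. \<sigma> u = \<sigma> v then a / real n else b / real n)"

definition edges_pmf :: "nat \<Rightarrow> real \<Rightarrow> real \<Rightarrow> (nat \<Rightarrow> nat) \<Rightarrow> nat set set pmf" where
  "edges_pmf n a b \<sigma> =
     map_pmf (\<lambda>X. {e \<in> vertex_pairs n. X e})
       (Pi_pmf (vertex_pairs n) False (\<lambda>e. bernoulli_pmf (edge_prob n a b \<sigma> e)))"

text \<open>The joint law of the hidden community assignment and the observed graph.\<close>

definition SBM :: "nat \<Rightarrow> nat \<Rightarrow> real \<Rightarrow> real \<Rightarrow> ((nat \<Rightarrow> nat) \<times> graph) pmf" where
  "SBM n k a b =
     bind_pmf (community_pmf n k) (\<lambda>\<sigma>.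
       map_pmf (\<lambda>E. (\<sigma>, ({1..n}, E))) (edges_pmf n a b \<sigma>))"

definition community :: "nat \<Rightarrow> (nat \<Rightarrow> nat) \<Rightarrow> nat \<Rightarrow> nat set" where
  "community n \<sigma> i = {v \<in> {1..n}. \<sigma> v = i}"

definition SNR :: "nat \<Rightarrow> real \<Rightarrow> real \<Rightarrow> real" where
  "SNR k a b = (a - b)\<^sup>2 / (real k * (a + (real k - 1) * b))"

text \<open>A randomized algorithm without computational constraints is a map from graphs to
  distributions over vertex subsets \<open>S\<close>; the output partition is \<open>S\<close> and its complement.\<close>

definition partition_algorithm :: "(graph \<Rightarrow> nat set pmf) \<Rightarrow> bool" where
  "partition_algorithm A \<longleftrightarrow> (\<forall>V E. finite V \<longrightarrow> set_pmf (A (V, E)) \<subseteq> Pow V)"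

text \<open>The algorithm sees the graph only, and its internal randomness is independent of the
  community assignment given the graph.\<close>

definition SBM_run ::
  "(graph \<Rightarrow> nat set pmf) \<Rightarrow> nat \<Rightarrow> nat \<Rightarrow> real \<Rightarrow> real \<Rightarrow> ((nat \<Rightarrow> nat) \<times> nat set) pmf" where
  "SBM_run A n k a b = bind_pmf (SBM n k a b) (\<lambda>(\<sigma>, G). map_pmf (\<lambda>S. (\<sigma>, S)) (A G))"

text \<open>An empty community contributes the ratio $0/0 = 0$; for fixed $k$ all communities are
  nonempty with probability $1 - o(1)$, so this convention does not affect the notion below.\<close>

definition separates :: "nat \<Rightarrow> nat \<Rightarrow> real \<Rightarrow> (nat \<Rightarrow> nat) \<Rightarrow> nat set \<Rightarrow> bool" where
  "separates n k \<epsilon> \<sigma> S \<longleftrightarrow>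
     (\<exists>i\<in>{1..k}. \<exists>j\<in>{1..k}.
        real (card (community n \<sigma> i \<inter> S)) / real (card (community n \<sigma> i))
        - real (card (community n \<sigma> j \<inter> S)) / real (card (community n \<sigma> j)) > \<epsilon>)"

definition solves_detection ::
  "(graph \<Rightarrow> nat set pmf) \<Rightarrow> nat \<Rightarrow> real \<Rightarrow> real \<Rightarrow> bool" where
  "solves_detection A k a b \<longleftrightarrow>
     (\<exists>\<epsilon>>0. (\<lambda>n. measure_pmf.prob (SBM_run A n k a b) {(\<sigma>, S). separates n k \<epsilon> \<sigma> S})
        \<longlonglongrightarrow> 1)"

end

theory Submission
  imports Defs
begin

text \<open>
  Take $a = 0$ and $b = k(k-1)/(1+\<eta>)$ with a small $\<eta> > 0$, so that the SNR is $1/(1+\<eta>)$ and the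
  communities are a hidden proper colouring. The algorithm draws a uniformly random proper
  $k$-colouring $\<tau>$ of $G$ and outputs the union $S$ of its first $\lfloor k/2 \rfloor$ colour classes.
  It fails only if $\<tau>$ is bad, i.e. $S$ occupies nearly the same fraction of every community.

  A first-moment bound over the pair of colourings, with the number of edges fixed by an exponential
  tilt, shows that there are at most $e^{(B + o(1)) n}$ bad colourings. The overlap matrix of a bad
  colouring splits every row in proportions that do not depend on the row; this constraint makes the
  uniform overlap essentially optimal right up to the Kesten-Stigum threshold.
  For $k \ge 5$ this gives $B < 0$, and no bad colouring exists (only colourings with
  $|S| \approx \lfloor k/2 \rfloor n / k$ are sampled, and the hidden one is among them).

  For $k = 4$ the bound $B \approx 2 \ln 2 - \frac{9}{2} \ln \frac{4}{3} \approx 0.0917$ is positive, but the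
  total number of proper colourings is larger. Call a pair $(v, c)$ free if $v$ has no
  neighbour of colour $c$; recolouring along an independent set of the conflict graph on the free
  pairs gives a proper colouring, and a graph with $x$ vertices and $y$ edges has at least
  $2^x (3/4)^y$ independent sets. Here $x \approx 3 e^{-3} n$ and $y \approx 12 e^{-6} n$ by Chebyshev's
  inequality, so that there are at least $e^{0.0949 n}$ proper colourings.
\<close>

section \<open>Finite probability\<close>

text \<open>The tilt is needed because the plain expectation is dominated by graphs with too few
  edges: at the threshold and the uniform overlap its rate is \<open>ln k - (k-1)^2/(2*k)\<close>,
  still about 0.009 for \<open>k = 5\<close>, while with the typical number of edges it is
  \<open>ln k - (k-1)^2/2 * ln (k/(k-1))\<close>, about -0.18. Without the row constraint no
  negative rate is possible, since the hidden colouring itself would be counted. For a row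
  \<open>p\<close> of the overlap matrix put \<open>y = k * p c\<close>. Entropy and energy together
  contribute \<open>y^2/2 - y * ln y\<close>, up to a factor and a linear term. Its second
  derivative \<open>1 - 1/y\<close> vanishes at the uniform row \<open>y = 1\<close>, which is how
  the Kesten-Stigum threshold shows up; beyond it the function is convex, so that rows with one
  dominant entry are the danger. Taking about half of the colours for \<open>S\<close> caps every
  entry near 1/2, the best cap that a split into two groups can give. The colour names of \<tau> and
  \<sigma> are unrelated, but \<open>separates\<close> only compares fractions of \<open>S\<close>
  and needs no matching of names.\<close>

abbreviation pr :: "'a pmf \<Rightarrow> 'a set \<Rightarrow> real" where
  "pr p \<equiv> measure_pmf.prob p"

abbreviation expect :: "'a pmf \<Rightarrow> ('a \<Rightarrow> real) \<Rightarrow> real" where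
  "expect p \<equiv> measure_pmf.expectation p"

lemma integral_pmf_finite:
  fixes f :: "'a \<Rightarrow> real"
  assumes "finite (set_pmf p)"
  shows "expect p f = (\<Sum>x\<in>set_pmf p. pmf p x * f x)"
  using integral_measure_pmf[of "set_pmf p" p f] assms by (simp add: mult.commute)

lemma prob_eq_expectation_of_bool:
  "pr p {x. P x} = expect p (\<lambda>x. of_bool (P x))"
proof -
  have "(\<lambda>x. of_bool (P x) :: real) = indicator {x. P x}"
    by (auto simp: indicator_def)
  then show ?thesis by simp
qed

lemma pmf_markov:
  fixes f :: "'a \<Rightarrow> real"
  assumes fin: "finite (set_pmf p)" and nn: "\<And>x. x \<in> set_pmf p \<Longrightarrow> 0 \<le> f x" and c: "c > 0"
  shows "pr p {x. c \<le> f x} \<le> expect p f / c"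
proof -
  have "pr p {x. c \<le> f x} * c = (\<Sum>x\<in>set_pmf p. pmf p x * (of_bool (c \<le> f x) * c))"
    by (simp add: prob_eq_expectation_of_bool integral_pmf_finite[OF fin] sum_distrib_right mult.assoc)
  also have "\<dots> \<le> (\<Sum>x\<in>set_pmf p. pmf p x * f x)"
    using nn by (intro sum_mono mult_left_mono) auto
  finally show ?thesis using c by (simp add: integral_pmf_finite[OF fin] field_simps)
qed

text \<open>Chebyshev's inequality: the sum over all ordered pairs, the diagonal included, is the
  second moment of the count, so \<open>V\<close> bounds the variance. It serves both for edge
  patterns and for community sizes.\<close>

lemma prob_count_deviation:
  fixes p :: "'a pmf" and P :: "'j \<Rightarrow> 'a \<Rightarrow> bool" and J :: "'j set"
  defines "\<mu> \<equiv> (\<Sum>i\<in>J. pr p {x. P i x})"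
  assumes finJ: "finite J" and fin: "finite (set_pmf p)" and t: "t > 0"
    and pairs: "(\<Sum>i\<in>J. \<Sum>j\<in>J. pr p {x. P i x \<and> P j x}) \<le> \<mu>\<^sup>2 + V"
  shows "pr p {x. t \<le> \<bar>real (card {j\<in>J. P j x}) - \<mu>\<bar>} \<le> V / t\<^sup>2"
proof -
  define X where "X = (\<lambda>x. real (card {j\<in>J. P j x}))"
  have X: "X x = (\<Sum>j\<in>J. of_bool (P j x))" for x
    using finJ by (simp add: X_def Collect_conj_eq)
  have int: "integrable (measure_pmf p) f" for f :: "'a \<Rightarrow> real"
    using fin by (rule integrable_measure_pmf_finite)
  have E1: "expect p X = \<mu>"
    unfolding X \<mu>_def by (simp add: int prob_eq_expectation_of_bool)
  have "expect p (\<lambda>x. (X x)\<^sup>2)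
      = expect p (\<lambda>x. \<Sum>i\<in>J. \<Sum>j\<in>J. of_bool (P i x \<and> P j x))"
    unfolding X power2_eq_square by (simp only: sum_product of_bool_conj)
  also have "\<dots> = (\<Sum>i\<in>J. \<Sum>j\<in>J. pr p {x. P i x \<and> P j x})"
    by (simp add: int prob_eq_expectation_of_bool del: of_bool_conj)
  finally have E2: "expect p (\<lambda>x. (X x)\<^sup>2) \<le> \<mu>\<^sup>2 + V"
    using pairs by simp
  have "expect p (\<lambda>x. (X x - \<mu>)\<^sup>2)
      = expect p (\<lambda>x. (X x)\<^sup>2 - 2 * \<mu> * X x + \<mu>\<^sup>2)"
    by (simp add: power2_diff algebra_simps)
  also have "\<dots> = expect p (\<lambda>x. (X x)\<^sup>2) - 2 * \<mu> * expect p X + \<mu>\<^sup>2"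
    by (simp add: int)
  also have "\<dots> \<le> V"
    using E1 E2 by (simp add: power2_eq_square)
  finally have var: "expect p (\<lambda>x. (X x - \<mu>)\<^sup>2) \<le> V" .
  have "{x. t \<le> \<bar>X x - \<mu>\<bar>} = {x. t\<^sup>2 \<le> (X x - \<mu>)\<^sup>2}"
    using t by (auto simp: abs_le_square_iff[symmetric])
  then have "pr p {x. t \<le> \<bar>X x - \<mu>\<bar>}
      \<le> expect p (\<lambda>x. (X x - \<mu>)\<^sup>2) / t\<^sup>2"
    using pmf_markov[OF fin, of "\<lambda>x. (X x - \<mu>)\<^sup>2" "t\<^sup>2"] t by simp
  also have "\<dots> \<le> V / t\<^sup>2"
    using var by (intro divide_right_mono) auto
  finally show ?thesis by (simp add: X_def)
qed

lemma prob_mono_support: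
  assumes "\<And>x. x \<in> set_pmf p \<Longrightarrow> x \<in> A \<Longrightarrow> x \<in> B"
  shows "pr p A \<le> pr p B"
  using assms by (intro measure_pmf.finite_measure_mono_AE) (auto intro: AE_pmfI)

lemma prob_bind_ge:
  assumes fin: "finite (set_pmf p)" and G: "pr p G \<ge> 1 - r"
    and B: "\<And>x. x \<in> set_pmf p \<Longrightarrow> x \<in> G \<Longrightarrow> pr (f x) B \<ge> 1 - s"
    and nn: "0 \<le> r" "0 \<le> s"
  shows "pr (bind_pmf p f) B \<ge> 1 - (r + s)"
\<comment> \<open>The factor \<open>1 - s\<close> must be nonnegative for the product bound; for
  \<open>s > 1\<close> the claimed lower bound is not positive.\<close>
proof (cases "s \<le> 1")
  case True
  have "pr M B = pmf (map_pmf (\<lambda>y. y \<in> B) M) True" for M :: "'b pmf"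
    by (simp add: pmf_map vimage_def)
  then have "pr (bind_pmf p f) B = expect p (\<lambda>x. pr (f x) B)"
    by (simp add: map_bind_pmf pmf_bind)
  also have "\<dots> = (\<Sum>x\<in>set_pmf p. pmf p x * pr (f x) B)"
    by (rule integral_pmf_finite[OF fin])
  also have "\<dots> \<ge> (\<Sum>x\<in>set_pmf p. pmf p x * (of_bool (x \<in> G) * (1 - s)))"
    using B by (intro sum_mono mult_left_mono) auto
  also have "(\<Sum>x\<in>set_pmf p. pmf p x * (of_bool (x \<in> G) * (1 - s))) = pr p G * (1 - s)"
    using prob_eq_expectation_of_bool[of p "\<lambda>x. x \<in> G"]
    by (simp add: integral_pmf_finite[OF fin] sum_distrib_right mult.assoc)
  finally have "pr p G * (1 - s) \<le> pr (bind_pmf p f) B" .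
  moreover have "(1 - r) * (1 - s) \<le> pr p G * (1 - s)"
    using G True by (intro mult_right_mono) auto
  moreover have "1 - (r + s) \<le> (1 - r) * (1 - s)" using nn by (simp add: algebra_simps)
  ultimately show ?thesis by linarith
next
  case False
  then have "1 - (r + s) \<le> 0" using nn by simp
  then show ?thesis by (meson measure_nonneg order_trans)
qed

section \<open>The planted graph\<close>

text \<open>The exact negation of the test in \<open>edge_prob\<close>. It is polymorphic because it
  is also applied to the joint colouring by (\<sigma>, \<tau>) and to a constant colouring.\<close>

definition bichr :: "('v \<Rightarrow> 'c) \<Rightarrow> 'v set \<Rightarrow> bool" where
  "bichr \<sigma> e \<longleftrightarrow> \<not> (\<forall>u\<in>e. \<forall>v\<in>e. \<sigma> u = \<sigma> v)"

lemma bichr_pair [simp]: "bichr \<sigma> {u, v} \<longleftrightarrow> \<sigma> u \<noteq> \<sigma> v"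
  by (auto simp: bichr_def)

lemma finite_vertex_pairs [simp]: "finite (vertex_pairs n)"
  by (rule finite_subset[of _ "Pow {1..n}"]) (auto simp: vertex_pairs_def)

lemma pair_in_vertex_pairs: "{u, v} \<in> vertex_pairs n \<longleftrightarrow> u \<in> {1..n} \<and> v \<in> {1..n} \<and> u \<noteq> v"
  by (cases "u = v") (simp_all add: vertex_pairs_def)

definition cross_pairs :: "nat \<Rightarrow> (nat \<Rightarrow> nat) \<Rightarrow> nat set set" where
  "cross_pairs n \<sigma> = {e \<in> vertex_pairs n. bichr \<sigma> e}"

lemma finite_cross_pairs [simp]: "finite (cross_pairs n \<sigma>)"
  by (simp add: cross_pairs_def)

lemma edge_prob_planted: "edge_prob n 0 b \<sigma> e = (if bichr \<sigma> e then b / real n else 0)"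
proof -
  have "(if Q then 0 / real n else c) = (if \<not> Q then c else 0)" for Q and c :: real by simp
  then show ?thesis unfolding edge_prob_def bichr_def .
qed

lemma finite_set_edges_pmf [simp]: "finite (set_pmf (edges_pmf n a b \<sigma>))"
proof (rule finite_subset)
  show "set_pmf (edges_pmf n a b \<sigma>) \<subseteq> Pow (vertex_pairs n)"
    unfolding edges_pmf_def set_map_pmf by blast
qed simp

lemma set_edges_pmf_planted:
  assumes "E \<in> set_pmf (edges_pmf n 0 b \<sigma>)"
  shows "E \<subseteq> cross_pairs n \<sigma>"
proof -
  have "bichr \<sigma> e" if "X \<in> set_pmf (Pi_pmf (vertex_pairs n) False (\<lambda>e. bernoulli_pmf (edge_prob n 0 b \<sigma> e)))"
      "e \<in> vertex_pairs n" "X e" for X e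
  proof (rule ccontr)
    assume "\<not> bichr \<sigma> e"
    then have "edge_prob n 0 b \<sigma> e = 0" by (simp add: edge_prob_planted)
    then have "True \<notin> set_pmf (bernoulli_pmf (edge_prob n 0 b \<sigma> e))"
      by (simp add: set_pmf_iff)
    moreover have "X e \<in> set_pmf (bernoulli_pmf (edge_prob n 0 b \<sigma> e))"
      using that(1,2) by (simp add: set_Pi_pmf PiE_dflt_def)
    ultimately show False using that(3) by simp
  qed
  then show ?thesis using assms by (auto simp: edges_pmf_def cross_pairs_def)
qed

lemma prob_edges_pattern:
  assumes "P \<subseteq> cross_pairs n \<sigma>" "A \<subseteq> cross_pairs n \<sigma>" "P \<inter> A = {}"
    and b: "0 \<le> b" "b \<le> real n"
  shows "pr (edges_pmf n 0 b \<sigma>) {E. P \<subseteq> E \<and> A \<inter> E = {}}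
    = (b / real n) ^ card P * (1 - b / real n) ^ card A"
proof -
  let ?p = "b / real n"
  have p01: "0 \<le> ?p" "?p \<le> 1" using b by (auto simp: divide_le_eq_1)
  define B where "B e = (if e \<in> P then {True} else if e \<in> A then {False} else UNIV)" for e :: "nat set"
  have "(\<lambda>X. {e \<in> vertex_pairs n. X e}) -` {E. P \<subseteq> E \<and> A \<inter> E = {}} = Pi (vertex_pairs n) B"
    using assms(1-3) by (auto simp: B_def Pi_def cross_pairs_def split: if_splits)
  then have "pr (edges_pmf n 0 b \<sigma>) {E. P \<subseteq> E \<and> A \<inter> E = {}}
      = (\<Prod>e\<in>vertex_pairs n. pr (bernoulli_pmf (edge_prob n 0 b \<sigma> e)) (B e))"
    by (simp add: edges_pmf_def measure_Pi_pmf_Pi)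
  also have "\<dots> = (\<Prod>e\<in>vertex_pairs n. (if e \<in> P then ?p else 1) * (if e \<in> A then 1 - ?p else 1))"
    using assms(1-3) p01
    by (intro prod.cong) (auto simp: B_def edge_prob_planted cross_pairs_def measure_pmf_single)
  also have "\<dots> = (\<Prod>e\<in>vertex_pairs n. if e \<in> P then ?p else 1) * (\<Prod>e\<in>vertex_pairs n. if e \<in> A then 1 - ?p else 1)"
    by (simp add: prod.distrib)
  also have "(\<Prod>e\<in>vertex_pairs n. if e \<in> P then ?p else 1) = ?p ^ card P"
  proof -
    have "vertex_pairs n \<inter> P = P" using assms by (auto simp: cross_pairs_def)
    then show ?thesis by (simp add: prod.If_cases)
  qed
  also have "(\<Prod>e\<in>vertex_pairs n. if e \<in> A then 1 - ?p else 1) = (1 - ?p) ^ card A"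
  proof -
    have "vertex_pairs n \<inter> A = A" using assms by (auto simp: cross_pairs_def)
    then show ?thesis by (simp add: prod.If_cases)
  qed
  finally show ?thesis .
qed

section \<open>First moment of proper colourings\<close>

abbreviation vcolorings :: "nat \<Rightarrow> nat \<Rightarrow> (nat \<Rightarrow> nat) set" where
  "vcolorings n k \<equiv> PiE_dflt {1..n} 0 (\<lambda>_. {1..k})"

definition cell :: "nat \<Rightarrow> (nat \<Rightarrow> nat) \<Rightarrow> (nat \<Rightarrow> nat) \<Rightarrow> nat \<Rightarrow> nat \<Rightarrow> nat" where
  "cell n \<sigma> \<tau> i c = card (community n \<sigma> i \<inter> community n \<tau> c)"

abbreviation csize :: "nat \<Rightarrow> (nat \<Rightarrow> nat) \<Rightarrow> nat \<Rightarrow> real" where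
  "csize n \<sigma> i \<equiv> real (card (community n \<sigma> i))"

abbreviation overlap :: "nat \<Rightarrow> (nat \<Rightarrow> nat) \<Rightarrow> (nat \<Rightarrow> nat) \<Rightarrow> nat \<Rightarrow> nat \<Rightarrow> real" where
  "overlap n \<sigma> \<tau> i c \<equiv> real (cell n \<sigma> \<tau> i c) / csize n \<sigma> i"

lemma finite_community [simp]: "finite (community n \<sigma> i)"
  by (simp add: community_def)

text \<open>Twice the number of pairs inside a fibre of size \<open>m\<close> is
  \<open>m^2 - m\<close>, and the linear terms add up to \<open>n\<close>. Applied to \<sigma>,
  \<tau>, the joint colouring and the constant one, this turns the pair counts of the first moment
  into sums of squares.\<close>

lemma card_monochromatic_pairs:
  assumes C: "finite C" "f ` {1..n} \<subseteq> C"
  shows "2 * real (card {e \<in> vertex_pairs n. \<not> bichr f e})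
    = (\<Sum>c\<in>C. (real (card {v\<in>{1..n}. f v = c}))\<^sup>2) - real n"
proof -
  define F where "F c = {v\<in>{1..n}. f v = c}" for c
  have fin: "finite (F c)" for c by (simp add: F_def)
  have eq: "{e \<in> vertex_pairs n. \<not> bichr f e} = (\<Union>c\<in>C. {e. e \<subseteq> F c \<and> card e = 2})" (is "?A = ?B")
  proof (intro equalityI subsetI)
    fix e assume e: "e \<in> ?A"
    then have "card e = 2" by (simp add: vertex_pairs_def)
    then obtain u v where uv: "e = {u, v}" "u \<noteq> v"
      unfolding card_2_iff by blast
    have *: "f v = f u" "u \<in> {1..n}" "v \<in> {1..n}"
      using e unfolding uv mem_Collect_eq pair_in_vertex_pairs bichr_pair by simp_all
    then have "f u \<in> C" "e \<subseteq> F (f u)"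
      using C(2) unfolding F_def uv by blast+
    with \<open>card e = 2\<close> have "f u \<in> C" "e \<subseteq> F (f u)" "card e = 2" by simp_all
    then show "e \<in> ?B" by blast
  next
    fix e assume "e \<in> ?B"
    then obtain c where "e \<subseteq> F c" "card e = 2" by blast
    then show "e \<in> ?A" unfolding bichr_def vertex_pairs_def F_def by blast
  qed
  have "card ?A = (\<Sum>c\<in>C. card {e. e \<subseteq> F c \<and> card e = 2})"
    unfolding eq
  proof (intro card_UN_disjoint ballI impI)
    show "finite {e. e \<subseteq> F c \<and> card e = 2}" for c
      by (rule finite_subset[of _ "Pow (F c)"]) (auto simp: fin)
    show "{e. e \<subseteq> F c \<and> card e = 2} \<inter> {e. e \<subseteq> F c' \<and> card e = 2} = {}" if "c \<noteq> c'" for c c'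
    proof -
      have "F c \<inter> F c' = {}" using that by (auto simp: F_def)
      then have "card e \<noteq> 2" if "e \<subseteq> F c" "e \<subseteq> F c'" for e
        using that by (metis Int_greatest card.empty subset_empty zero_neq_numeral)
      then show ?thesis by blast
    qed
  qed (use C in auto)
  also have "\<dots> = (\<Sum>c\<in>C. card (F c) choose 2)"
    by (intro sum.cong refl n_subsets fin)
  finally have "2 * real (card ?A) = (\<Sum>c\<in>C. 2 * real (card (F c) choose 2))"
    by (simp add: sum_distrib_left)
  also have "\<dots> = (\<Sum>c\<in>C. (real (card (F c)))\<^sup>2 - real (card (F c)))"
  proof (intro sum.cong refl)
    fix c
    have "2 * (m choose 2) = m * (m - 1)" for m :: nat
    proof -
      have "even (m * (m - 1))" by (cases "even m") auto
      then show ?thesis unfolding choose_two by (rule dvd_mult_div_cancel)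
    qed
    then have "2 * real (m choose 2) = real m * real (m - 1)" for m :: nat
      by (metis of_nat_mult of_nat_numeral)
    then show "2 * real (card (F c) choose 2) = (real (card (F c)))\<^sup>2 - real (card (F c))"
      by (cases "card (F c)") (auto simp: power2_eq_square algebra_simps)
  qed
  also have "\<dots> = (\<Sum>c\<in>C. (real (card (F c)))\<^sup>2) - real (\<Sum>c\<in>C. card (F c))"
    by (simp add: sum_subtractf)
  also have "(\<Sum>c\<in>C. card (F c)) = card (\<Union>c\<in>C. F c)"
    by (intro card_UN_disjoint[symmetric]) (use C fin in \<open>auto simp: F_def\<close>)
  also have "(\<Union>c\<in>C. F c) = {1..n}" using C(2) by (auto simp: F_def)
  finally show ?thesis by (simp add: F_def)
qed

lemma vcoloringsD: "\<tau> \<in> vcolorings n k \<Longrightarrow> \<tau> ` {1..n} \<subseteq> {1..k}"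
  by (auto simp: PiE_dflt_def)

lemma finite_vcolorings [simp]: "finite (vcolorings n k)"
  by (intro finite_PiE_dflt) auto

lemma card_vertex_pairs: "2 * real (card (vertex_pairs n)) = (real n)\<^sup>2 - real n"
proof -
  have "{e \<in> vertex_pairs n. \<not> bichr (\<lambda>v. ()) e} = vertex_pairs n"
    by (simp add: bichr_def)
  then show ?thesis
    using card_monochromatic_pairs[of "{()}" "\<lambda>v. ()" n]
    by (simp add: image_subset_iff Collect_conj_eq flip: atLeastAtMost_def atLeast_def atMost_def)
qed

lemma card_cross_pairs:
  assumes "\<sigma> \<in> vcolorings n k"
  shows "2 * real (card (cross_pairs n \<sigma>))
    = (real n)\<^sup>2 - (\<Sum>i=1..k. (csize n \<sigma> i)\<^sup>2)"
proof -
  have "vertex_pairs n = cross_pairs n \<sigma> \<union> {e \<in> vertex_pairs n. \<not> bichr \<sigma> e}"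
    "cross_pairs n \<sigma> \<inter> {e \<in> vertex_pairs n. \<not> bichr \<sigma> e} = {}"
    unfolding cross_pairs_def by blast+
  then have "card (vertex_pairs n) = card (cross_pairs n \<sigma>) + card {e \<in> vertex_pairs n. \<not> bichr \<sigma> e}"
    by (metis (lifting) card_Un_disjoint finite_Un finite_vertex_pairs)
  then show ?thesis
    using card_vertex_pairs[of n] card_monochromatic_pairs[OF _ vcoloringsD[OF assms]] by (simp add: community_def)
qed

text \<open>The pairs monochromatic for \<tau> are either separated by \<sigma> or monochromatic for
  the joint colouring, whose fibres are the cells; the two terms \<open>- n\<close> cancel.\<close>

lemma card_cross_mono:
  assumes "\<sigma> \<in> vcolorings n k" "\<tau> \<in> vcolorings n k"
  shows "2 * real (card {e \<in> cross_pairs n \<sigma>. \<not> bichr \<tau> e})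
    = (\<Sum>c=1..k. (csize n \<tau> c)\<^sup>2)
      - (\<Sum>i=1..k. \<Sum>c=1..k. (real (cell n \<sigma> \<tau> i c))\<^sup>2)"
proof -
  let ?f = "\<lambda>v. (\<sigma> v, \<tau> v)"
  have sub: "?f ` {1..n} \<subseteq> {1..k} \<times> {1..k}"
    using vcoloringsD[OF assms(1)] vcoloringsD[OF assms(2)] by auto
  have fib: "{v\<in>{1..n}. ?f v = (i, c)} = community n \<sigma> i \<inter> community n \<tau> c" for i c
    by (auto simp: community_def)
  have pr: "bichr ?f e \<longleftrightarrow> bichr \<sigma> e \<or> bichr \<tau> e" for e
    unfolding bichr_def prod.inject by blast
  have "{e \<in> vertex_pairs n. \<not> bichr \<tau> e}
      = {e \<in> cross_pairs n \<sigma>. \<not> bichr \<tau> e} \<union> {e \<in> vertex_pairs n. \<not> bichr ?f e}"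
    "{e \<in> cross_pairs n \<sigma>. \<not> bichr \<tau> e} \<inter> {e \<in> vertex_pairs n. \<not> bichr ?f e} = {}"
    unfolding cross_pairs_def pr by blast+
  then have "card {e \<in> vertex_pairs n. \<not> bichr \<tau> e}
      = card {e \<in> cross_pairs n \<sigma>. \<not> bichr \<tau> e} + card {e \<in> vertex_pairs n. \<not> bichr ?f e}"
    using card_Un_disjoint[of "{e \<in> cross_pairs n \<sigma>. \<not> bichr \<tau> e}" "{e \<in> vertex_pairs n. \<not> bichr ?f e}"]
    by simp
  moreover have "2 * real (card {e \<in> vertex_pairs n. \<not> bichr ?f e})
      = (\<Sum>i=1..k. \<Sum>c=1..k. (real (cell n \<sigma> \<tau> i c))\<^sup>2) - real n"
    using card_monochromatic_pairs[OF _ sub]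
    unfolding sum.cartesian_product' fib cell_def by simp
  moreover have "2 * real (card {e \<in> vertex_pairs n. \<not> bichr \<tau> e})
      = (\<Sum>c=1..k. (csize n \<tau> c)\<^sup>2) - real n"
    using card_monochromatic_pairs[OF _ vcoloringsD[OF assms(2)]] by (simp add: community_def)
  ultimately show ?thesis by simp
qed

text \<open>The weight \<open>z ^ card E\<close> is the exponential tilt that fixes the number of edges.\<close>

lemma expectation_proper_weight:
  fixes z :: real
  assumes b: "0 \<le> b" "b \<le> real n" and z: "0 \<le> z"
  shows "expect (edges_pmf n 0 b \<sigma>) (\<lambda>E. z ^ card E * of_bool (\<forall>e\<in>E. bichr \<tau> e))
    \<le> exp (b / real n * ((z - 1) * real (card (cross_pairs n \<sigma>))
          - z * real (card {e \<in> cross_pairs n \<sigma>. \<not> bichr \<tau> e})))"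
proof -
  define D where "D = vertex_pairs n"
  have finD: "finite D" by (simp add: D_def)
  define p where "p = b / real n"
  have p: "0 \<le> p" "p \<le> 1" using b by (auto simp: p_def divide_le_eq_1)
  define f :: "nat set \<Rightarrow> bool \<Rightarrow> real"
    where "f e x = (if x then (if bichr \<tau> e then z else 0) else 1)" for e x
  have prod: "z ^ card {e\<in>D. X e} * of_bool (\<forall>e\<in>{e\<in>D. X e}. bichr \<tau> e) = (\<Prod>e\<in>D. f e (X e))" for X
  proof -
    have "(\<Prod>e\<in>D. f e (X e)) = (\<Prod>e\<in>{e\<in>D. X e}. if bichr \<tau> e then z else 0)"
      unfolding f_def using finD by (simp add: prod.inter_filter)
    also have "\<dots> = z ^ card {e\<in>D. X e} * of_bool (\<forall>e\<in>{e\<in>D. X e}. bichr \<tau> e)"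
    proof (cases "\<forall>e\<in>{e\<in>D. X e}. bichr \<tau> e")
      case True
      then show ?thesis by simp
    next
      case False
      then have "(\<Prod>e\<in>{e\<in>D. X e}. if bichr \<tau> e then z else 0) = 0"
        using finD by (intro prod_zero) auto
      with False show ?thesis by simp
    qed
    finally show ?thesis by simp
  qed
  have "expect (edges_pmf n 0 b \<sigma>) (\<lambda>E. z ^ card E * of_bool (\<forall>e\<in>E. bichr \<tau> e))
      = expect (Pi_pmf D False (\<lambda>e. bernoulli_pmf (edge_prob n 0 b \<sigma> e)))
          (\<lambda>X. \<Prod>e\<in>D. f e (X e))"
    unfolding edges_pmf_def integral_map_pmf D_def[symmetric] prod ..
  also have "\<dots> = (\<Prod>e\<in>D. expect (bernoulli_pmf (edge_prob n 0 b \<sigma> e)) (f e))"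
    using finD z by (intro expectation_prod_Pi_pmf) (auto simp: f_def intro!: integrable_measure_pmf_finite)
  also have "\<dots> = (\<Prod>e\<in>D. if bichr \<sigma> e then p * (if bichr \<tau> e then z else 0) + (1 - p) else 1)"
    using p by (intro prod.cong refl) (simp add: edge_prob_planted f_def p_def)
  \<comment> \<open>Each factor has the form \<open>1 + x\<close> and is at most
    \<open>exp x\<close>, with \<open>x = p * (z - 1)\<close> if both colourings separate the pair
    and \<open>x = - p\<close> if only \<sigma> does.\<close>
  also have "\<dots> \<le> (\<Prod>e\<in>D. exp (p * ((z - 1) * of_bool (bichr \<sigma> e) - z * of_bool (bichr \<sigma> e \<and> \<not> bichr \<tau> e))))"
  proof (intro prod_mono conjI)
    fix e
    show "0 \<le> (if bichr \<sigma> e then p * (if bichr \<tau> e then z else 0) + (1 - p) else 1)"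
      using p z by auto
    show "(if bichr \<sigma> e then p * (if bichr \<tau> e then z else 0) + (1 - p) else 1)
        \<le> exp (p * ((z - 1) * of_bool (bichr \<sigma> e) - z * of_bool (bichr \<sigma> e \<and> \<not> bichr \<tau> e)))"
      using exp_ge_add_one_self[of "p * (z - 1)"] exp_ge_add_one_self[of "- p"]
      by (auto simp: algebra_simps)
  qed
  also have "\<dots> = exp (\<Sum>e\<in>D. p * ((z - 1) * of_bool (bichr \<sigma> e) - z * of_bool (bichr \<sigma> e \<and> \<not> bichr \<tau> e)))"
    using finD by (simp add: exp_sum)
  also have "(\<Sum>e\<in>D. p * ((z - 1) * of_bool (bichr \<sigma> e) - z * of_bool (bichr \<sigma> e \<and> \<not> bichr \<tau> e)))
      = p * ((z - 1) * (\<Sum>e\<in>D. of_bool (bichr \<sigma> e)) - z * (\<Sum>e\<in>D. of_bool (bichr \<sigma> e \<and> \<not> bichr \<tau> e)))"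
    unfolding sum_distrib_left[symmetric] sum_subtractf sum_distrib_left[symmetric] ..
  also have "(\<Sum>e\<in>D. of_bool (bichr \<sigma> e) :: real) = real (card (cross_pairs n \<sigma>))"
    using finD by (simp add: cross_pairs_def D_def[symmetric] Collect_conj_eq)
  also have "(\<Sum>e\<in>D. of_bool (bichr \<sigma> e \<and> \<not> bichr \<tau> e) :: real) = real (card {e \<in> cross_pairs n \<sigma>. \<not> bichr \<tau> e})"
  proof -
    have "D \<inter> {e. bichr \<sigma> e \<and> \<not> bichr \<tau> e} = {e \<in> cross_pairs n \<sigma>. \<not> bichr \<tau> e}"
      by (auto simp: cross_pairs_def D_def)
    then show ?thesis using finD sum_of_bool_eq[of D] by (simp del: of_bool_conj)
  qed
  finally show ?thesis by (simp add: p_def)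
qed

lemma sum_prod_PiE_dflt:
  fixes q :: "'a \<Rightarrow> 'b \<Rightarrow> real"
  assumes "finite V" "\<And>v. v \<in> V \<Longrightarrow> finite (K v)"
  shows "(\<Sum>\<tau>\<in>PiE_dflt V d K. \<Prod>v\<in>V. q v (\<tau> v)) = (\<Prod>v\<in>V. \<Sum>c\<in>K v. q v c)"
proof -
  have "(\<Sum>\<tau>\<in>PiE_dflt V d K. \<Prod>v\<in>V. q v (\<tau> v)) = (\<Sum>\<tau>\<in>PiE V K. \<Prod>v\<in>V. q v (\<tau> v))"
    by (rule sum.reindex_bij_witness[of _ "\<lambda>h x. if x \<in> V then h x else d" "\<lambda>h. restrict h V"])
       (auto simp: PiE_dflt_def PiE_def extensional_def fun_eq_iff)
  also have "\<dots> = (\<Prod>v\<in>V. \<Sum>c\<in>K v. q v c)"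
    using assms by (simp add: prod_sum_PiE)
  finally show ?thesis .
qed

lemma sum_card_Int_community:
  assumes "finite I" "A \<subseteq> {1..n}"
  shows "(\<Sum>c\<in>I. card (A \<inter> community n \<tau> c)) = card {v\<in>A. \<tau> v \<in> I}"
proof -
  have fin: "finite A" using assms(2) by (rule finite_subset) simp
  have "(\<Sum>c\<in>I. card (A \<inter> community n \<tau> c)) = card (\<Union>c\<in>I. A \<inter> community n \<tau> c)"
    by (intro card_UN_disjoint[symmetric]) (use assms(1) in \<open>auto simp: community_def\<close>)
  also have "(\<Union>c\<in>I. A \<inter> community n \<tau> c) = {v\<in>A. \<tau> v \<in> I}"
    using assms(2) unfolding community_def by blast
  finally show ?thesis .
qed

lemma community_subset: "community n \<sigma> i \<subseteq> {1..n}"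
  by (auto simp: community_def)

lemma sum_cell:
  assumes "\<tau> \<in> vcolorings n k"
  shows "(\<Sum>c=1..k. cell n \<sigma> \<tau> i c) = card (community n \<sigma> i)"
proof -
  have "{v \<in> community n \<sigma> i. \<tau> v \<in> {1..k}} = community n \<sigma> i"
    using vcoloringsD[OF assms] community_subset by blast
  then show ?thesis unfolding cell_def by (simp only: sum_card_Int_community[OF _ community_subset] finite_atLeastAtMost)
qed

text \<open>For each of the polynomially many profiles \<open>cell n \<sigma> \<tau>\<close> the product on the right is the probability of
  \<open>\<tau>\<close> when every vertex of community \<open>i\<close> draws its colour from the \<open>i\<close>-th row of the profile.\<close>

lemma profile_sum_bound:
  fixes W :: "(nat \<Rightarrow> nat) \<Rightarrow> real"
  assumes \<sigma>: "\<sigma> \<in> vcolorings n k" and D: "D \<subseteq> vcolorings n k"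
    and W: "\<And>\<tau>. \<tau> \<in> D \<Longrightarrow> W \<tau> \<le> exp B * (\<Prod>(i, c)\<in>{1..k}\<times>{1..k}.
        (overlap n \<sigma> \<tau> i c) ^ cell n \<sigma> \<tau> i c)"
  shows "(\<Sum>\<tau>\<in>D. W \<tau>) \<le> real (n + 1) ^ (k * k) * exp B"
proof -
  let ?K = "{1..k} \<times> {1..k}"
  define prof where "prof \<tau> = restrict (\<lambda>(i, c). cell n \<sigma> \<tau> i c) ?K" for \<tau>
  define q where "q \<pi> v c = real (\<pi> (\<sigma> v, c)) / real (card (community n \<sigma> (\<sigma> v)))"
    for \<pi> :: "nat \<times> nat \<Rightarrow> nat" and v c
  define \<Q> where "\<Q> = prof ` vcolorings n k"
  have fin: "finite \<Q>" unfolding \<Q>_def by (intro finite_imageI finite_vcolorings)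
  have cell_le: "cell n \<sigma> \<tau> i c \<le> n" for \<tau> i c
  proof -
    have "card (community n \<sigma> i \<inter> community n \<tau> c) \<le> card {1..n}"
      by (intro card_mono) (auto simp: community_def)
    then show ?thesis by (simp add: cell_def)
  qed
  have "\<Q> \<subseteq> ?K \<rightarrow>\<^sub>E {0..n}"
    unfolding \<Q>_def prof_def by (intro image_subsetI restrict_PiE_iff[THEN iffD2] ballI) (simp add: cell_le split: prod.split)
  then have "card \<Q> \<le> card (?K \<rightarrow>\<^sub>E {0..n})"
    by (intro card_mono finite_PiE) auto
  then have card\<Q>: "card \<Q> \<le> (n + 1) ^ (k * k)"
    by (simp add: card_PiE)
  have key: "(\<Prod>(i, c)\<in>?K. (overlap n \<sigma> \<tau> i c) ^ cell n \<sigma> \<tau> i c)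
      = (\<Prod>v=1..n. q (prof \<tau>) v (\<tau> v))" if "\<tau> \<in> vcolorings n k" for \<tau>
  proof -
    define g where "g = (\<lambda>(i, c). overlap n \<sigma> \<tau> i c)"
    have sub: "(\<lambda>v. (\<sigma> v, \<tau> v)) ` {1..n} \<subseteq> ?K"
      using vcoloringsD[OF \<sigma>] vcoloringsD[OF that] by auto
    have fib: "{v \<in> {1..n}. (\<sigma> v, \<tau> v) = (i, c)} = community n \<sigma> i \<inter> community n \<tau> c" for i c
      by (auto simp: community_def)
    have "(\<Prod>v=1..n. q (prof \<tau>) v (\<tau> v)) = (\<Prod>v=1..n. g (\<sigma> v, \<tau> v))"
    proof (intro prod.cong refl)
      fix v assume "v \<in> {1..n}"
      then have "(\<sigma> v, \<tau> v) \<in> ?K" using sub by blast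
      then show "q (prof \<tau>) v (\<tau> v) = g (\<sigma> v, \<tau> v)"
        unfolding q_def prof_def g_def by (simp only: restrict_apply if_True prod.case)
    qed
    also have "\<dots> = (\<Prod>y\<in>?K. \<Prod>v\<in>{v \<in> {1..n}. (\<sigma> v, \<tau> v) = y}. g (\<sigma> v, \<tau> v))"
      by (intro prod.group[symmetric] sub) auto
    also have "\<dots> = (\<Prod>y\<in>?K. g y ^ card {v \<in> {1..n}. (\<sigma> v, \<tau> v) = y})"
      by (intro prod.cong refl) simp
    also have "\<dots> = (\<Prod>(i, c)\<in>?K. (overlap n \<sigma> \<tau> i c) ^ cell n \<sigma> \<tau> i c)"
    proof (intro prod.cong refl)
      fix y :: "nat \<times> nat"
      obtain i c where y: "y = (i, c)" by (metis surj_pair)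
      show "g y ^ card {v \<in> {1..n}. (\<sigma> v, \<tau> v) = y}
          = (case y of (i, c) \<Rightarrow> (overlap n \<sigma> \<tau> i c) ^ cell n \<sigma> \<tau> i c)"
        unfolding y fib g_def cell_def prod.case ..
    qed
    finally show ?thesis by simp
  qed
  have qnn: "q \<pi> v c \<ge> 0" for \<pi> v c by (simp add: q_def)
  have q1: "(\<Sum>c=1..k. q \<pi> v c) = 1" if \<pi>: "\<pi> \<in> \<Q>" and v: "v \<in> {1..n}" for \<pi> v
  proof -
    obtain \<tau> where \<tau>: "\<tau> \<in> vcolorings n k" "\<pi> = prof \<tau>" using \<pi> unfolding \<Q>_def by blast
    have \<sigma>v: "\<sigma> v \<in> {1..k}" using vcoloringsD[OF \<sigma>] v by blast
    have "v \<in> community n \<sigma> (\<sigma> v)" using v by (simp add: community_def)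
    then have "card (community n \<sigma> (\<sigma> v)) \<noteq> 0" by auto
    moreover have "(\<Sum>c=1..k. q \<pi> v c)
        = real (\<Sum>c=1..k. cell n \<sigma> \<tau> (\<sigma> v) c) / real (card (community n \<sigma> (\<sigma> v)))"
      using \<sigma>v by (simp add: q_def \<tau>(2) prof_def sum_divide_distrib)
    ultimately show ?thesis by (simp only: sum_cell[OF \<tau>(1)]) simp
  qed
  have "(\<Sum>\<tau>\<in>D. W \<tau>) \<le> (\<Sum>\<tau>\<in>D. exp B * (\<Sum>\<pi>\<in>\<Q>. \<Prod>v=1..n. q \<pi> v (\<tau> v)))"
  proof (intro sum_mono)
    fix \<tau> assume "\<tau> \<in> D"
    then have \<tau>: "\<tau> \<in> vcolorings n k" using D by blast
    have "W \<tau> \<le> exp B * (\<Prod>v=1..n. q (prof \<tau>) v (\<tau> v))"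
      using W[OF \<open>\<tau> \<in> D\<close>] key[OF \<tau>] by simp
    also have "(\<Prod>v=1..n. q (prof \<tau>) v (\<tau> v)) \<le> (\<Sum>\<pi>\<in>\<Q>. \<Prod>v=1..n. q \<pi> v (\<tau> v))"
      using \<tau> fin by (intro member_le_sum) (auto simp: \<Q>_def qnn intro!: prod_nonneg)
    finally show "W \<tau> \<le> exp B * (\<Sum>\<pi>\<in>\<Q>. \<Prod>v=1..n. q \<pi> v (\<tau> v))" by simp
  qed
  \<comment> \<open>Over all colourings the product weight of each profile is a probability
    distribution of total mass one, so only the number of profiles is left.\<close>
  also have "\<dots> \<le> (\<Sum>\<tau>\<in>vcolorings n k. exp B * (\<Sum>\<pi>\<in>\<Q>. \<Prod>v=1..n. q \<pi> v (\<tau> v)))"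
    using D by (intro sum_mono2) (auto simp: qnn intro!: sum_nonneg prod_nonneg mult_nonneg_nonneg)
  also have "\<dots> = exp B * (\<Sum>\<pi>\<in>\<Q>. \<Sum>\<tau>\<in>vcolorings n k. \<Prod>v=1..n. q \<pi> v (\<tau> v))"
    unfolding sum_distrib_left[symmetric] by (subst sum.swap) simp
  also have "(\<Sum>\<pi>\<in>\<Q>. \<Sum>\<tau>\<in>vcolorings n k. \<Prod>v=1..n. q \<pi> v (\<tau> v)) = real (card \<Q>)"
  proof -
    have "(\<Sum>\<tau>\<in>vcolorings n k. \<Prod>v=1..n. q \<pi> v (\<tau> v)) = 1" if "\<pi> \<in> \<Q>" for \<pi>
      using q1[OF that] by (subst sum_prod_PiE_dflt) (simp_all only: finite_atLeastAtMost prod.neutral_const cong: prod.cong)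
    then show ?thesis by (simp only: sum_constant mult_1_right cong: sum.cong)
  qed
  also have "exp B * real (card \<Q>) \<le> exp B * real (n + 1) ^ (k * k)"
    using card\<Q> by (intro mult_left_mono) (simp_all only: of_nat_power[symmetric] of_nat_le_iff exp_ge_zero)
  finally show ?thesis by (simp add: mult.commute)
qed

text \<open>The exponent of the first-moment bound for one \<open>\<tau>\<close>, for the tilt \<open>exp L\<close> and at least \<open>m\<close> edges.\<close>

definition exponent :: "nat \<Rightarrow> real \<Rightarrow> real \<Rightarrow> real \<Rightarrow> nat \<Rightarrow> (nat \<Rightarrow> nat) \<Rightarrow> (nat \<Rightarrow> nat) \<Rightarrow> real" where
  "exponent k b L m n \<sigma> \<tau> =
      (\<Sum>i=1..k. \<Sum>c=1..k. - real (cell n \<sigma> \<tau> i c) * ln (overlap n \<sigma> \<tau> i c))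
      + exp L * b / (2 * real n) * ((\<Sum>i=1..k. \<Sum>c=1..k. (real (cell n \<sigma> \<tau> i c))\<^sup>2)
          - (\<Sum>c=1..k. (csize n \<tau> c)\<^sup>2))
      + (exp L - 1) * b / (2 * real n) * ((real n)\<^sup>2 - (\<Sum>i=1..k. (csize n \<sigma> i)\<^sup>2))
      - m * L"

text \<open>A Chernoff bound: on at least \<open>m\<close> edges the indicator is at most
  \<open>exp (- m * L) * exp L ^ card E\<close>. The entropy in \<open>exponent\<close> is minus the
  logarithm of the profile product, so a bound \<open>B\<close> on the exponent is just the
  hypothesis of \<open>profile_sum_bound\<close>, and the entropy is paid for by summing over
  \<tau>.\<close>

lemma first_moment:
  fixes L b m B :: real
  assumes \<sigma>: "\<sigma> \<in> vcolorings n k" and D: "D \<subseteq> vcolorings n k"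
    and b: "0 \<le> b" "b \<le> real n" and L: "0 \<le> L"
    and B: "\<And>\<tau>. \<tau> \<in> D \<Longrightarrow> exponent k b L m n \<sigma> \<tau> \<le> B"
  shows "expect (edges_pmf n 0 b \<sigma>)
      (\<lambda>E. of_bool (m \<le> real (card E)) * real (card {\<tau>\<in>D. \<forall>e\<in>E. bichr \<tau> e}))
    \<le> real (n + 1) ^ (k * k) * exp B"
proof -
  have finD: "finite D" using D finite_subset by auto
  have int: "integrable (measure_pmf (edges_pmf n 0 b \<sigma>)) f" for f :: "_ \<Rightarrow> real"
    by (rule integrable_measure_pmf_finite) simp
  define w where "w \<tau> E = exp L ^ card E * of_bool (\<forall>e\<in>E. bichr \<tau> e)" for \<tau> :: "nat \<Rightarrow> nat" and E
  have "expect (edges_pmf n 0 b \<sigma>)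
      (\<lambda>E. of_bool (m \<le> real (card E)) * real (card {\<tau>\<in>D. \<forall>e\<in>E. bichr \<tau> e}))
    \<le> expect (edges_pmf n 0 b \<sigma>) (\<lambda>E. \<Sum>\<tau>\<in>D. exp (- m * L) * w \<tau> E)"
  proof (intro integral_mono int)
    fix E
    have "real (card {\<tau>\<in>D. \<forall>e\<in>E. bichr \<tau> e}) = (\<Sum>\<tau>\<in>D. of_bool (\<forall>e\<in>E. bichr \<tau> e))"
      using finD by (simp add: Collect_conj_eq)
    then have "of_bool (m \<le> real (card E)) * real (card {\<tau>\<in>D. \<forall>e\<in>E. bichr \<tau> e})
        = (\<Sum>\<tau>\<in>D. of_bool (m \<le> real (card E)) * of_bool (\<forall>e\<in>E. bichr \<tau> e))"
      by (simp add: sum_distrib_left)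
    also have "\<dots> \<le> (\<Sum>\<tau>\<in>D. exp (- m * L) * w \<tau> E)"
    proof (intro sum_mono)
      fix \<tau> assume "\<tau> \<in> D"
      have "(of_bool (m \<le> real (card E)) :: real) \<le> exp (- m * L) * exp L ^ card E"
      proof (cases "m \<le> real (card E)")
        case True
        then have "0 \<le> (real (card E) - m) * L" using L by simp
        then have "1 \<le> exp (- m * L + real (card E) * L)" by (simp add: algebra_simps)
        then show ?thesis using True by (simp only: exp_add exp_of_nat_mult) simp
      qed simp
      then show "of_bool (m \<le> real (card E)) * of_bool (\<forall>e\<in>E. bichr \<tau> e) \<le> exp (- m * L) * w \<tau> E"
        unfolding w_def mult.assoc[symmetric] by (intro mult_right_mono) auto
    qed
    finally show "of_bool (m \<le> real (card E)) * real (card {\<tau>\<in>D. \<forall>e\<in>E. bichr \<tau> e})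
        \<le> (\<Sum>\<tau>\<in>D. exp (- m * L) * w \<tau> E)" .
  qed
  also have "\<dots> = (\<Sum>\<tau>\<in>D. exp (- m * L) * expect (edges_pmf n 0 b \<sigma>) (w \<tau>))"
    by (simp add: int)
  also have "\<dots> \<le> real (n + 1) ^ (k * k) * exp B"
  proof (rule profile_sum_bound[OF \<sigma> D])
    fix \<tau> assume "\<tau> \<in> D"
    then have \<tau>: "\<tau> \<in> vcolorings n k" using D by blast
    let ?N = "\<lambda>i. csize n \<sigma> i" and ?n = "\<lambda>i c. real (cell n \<sigma> \<tau> i c)"
    have "expect (edges_pmf n 0 b \<sigma>) (w \<tau>)
        \<le> exp (b / real n * ((exp L - 1) * real (card (cross_pairs n \<sigma>))
          - exp L * real (card {e \<in> cross_pairs n \<sigma>. \<not> bichr \<tau> e})))"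
      unfolding w_def by (rule expectation_proper_weight) (use b in auto)
    then have "exp (- m * L) * expect (edges_pmf n 0 b \<sigma>) (w \<tau>)
        \<le> exp (- m * L) * exp (b / real n * ((exp L - 1) * real (card (cross_pairs n \<sigma>))
          - exp L * real (card {e \<in> cross_pairs n \<sigma>. \<not> bichr \<tau> e})))"
      by (intro mult_left_mono) auto
    also have "\<dots> = exp (- m * L + b / real n * ((exp L - 1) * real (card (cross_pairs n \<sigma>))
          - exp L * real (card {e \<in> cross_pairs n \<sigma>. \<not> bichr \<tau> e})))"
      by (rule exp_add[symmetric])
    also have "\<dots> \<le> exp (B + (\<Sum>i=1..k. \<Sum>c=1..k. ?n i c * ln (?n i c / ?N i)))"
    proof -
      have a: "real (card (cross_pairs n \<sigma>)) = ((real n)\<^sup>2 - (\<Sum>i=1..k. (?N i)\<^sup>2)) / 2"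
        using card_cross_pairs[OF \<sigma>] by simp
      have c: "real (card {e \<in> cross_pairs n \<sigma>. \<not> bichr \<tau> e})
          = ((\<Sum>c=1..k. (csize n \<tau> c)\<^sup>2) - (\<Sum>i=1..k. \<Sum>c=1..k. (?n i c)\<^sup>2)) / 2"
        using card_cross_mono[OF \<sigma> \<tau>] by simp
      have eq: "b / real n * ((exp L - 1) * (X / 2) - exp L * ((Y - Z) / 2))
          = exp L * b / (2 * real n) * (Z - Y) + (exp L - 1) * b / (2 * real n) * X" for X Y Z
        by (cases "n = 0") (simp_all add: field_simps)
      show ?thesis
        unfolding a c eq using B[OF \<open>\<tau> \<in> D\<close>] by (simp add: exponent_def sum_negf)
    qed
    also have "\<dots> = exp B * (\<Prod>i=1..k. \<Prod>c=1..k. exp (?n i c * ln (?n i c / ?N i)))"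
      by (simp add: exp_add exp_sum)
    also have "(\<Prod>i=1..k. \<Prod>c=1..k. exp (?n i c * ln (?n i c / ?N i)))
        = (\<Prod>i=1..k. \<Prod>c=1..k. (?n i c / ?N i) ^ cell n \<sigma> \<tau> i c)"
    proof (intro prod.cong refl)
      fix i c
      show "exp (?n i c * ln (?n i c / ?N i)) = (?n i c / ?N i) ^ cell n \<sigma> \<tau> i c"
      \<comment> \<open>For an empty cell both sides equal one: the logarithm is multiplied by 0,
        and the power has exponent 0.\<close>
      proof (cases "cell n \<sigma> \<tau> i c = 0")
        case False
        have "cell n \<sigma> \<tau> i c \<le> card (community n \<sigma> i)"
          unfolding cell_def by (intro card_mono) auto
        with False have "?n i c / ?N i > 0" by simp
        then show ?thesis by (simp add: exp_of_nat_mult)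
      qed simp
    qed
    finally show "exp (- m * L) * expect (edges_pmf n 0 b \<sigma>) (w \<tau>)
      \<le> exp B * (\<Prod>(i, c)\<in>{1..k}\<times>{1..k}. (?n i c / ?N i) ^ cell n \<sigma> \<tau> i c)"
      by (simp add: prod.cartesian_product)
  qed
  finally show ?thesis .
qed

section \<open>Concentration of local patterns\<close>

text \<open>A pattern is the presence of the edges \<open>P j\<close> together with the absence of the edges \<open>A j\<close>. Patterns that are
  not near share at most four absent edges and are therefore almost independent.\<close>

lemma pattern_concentration:
  fixes b t C\<^sub>0 C\<^sub>1 :: real and P A :: "'j \<Rightarrow> nat set set" and J :: "'j set"
  defines "p n \<equiv> b / real n"
  assumes b: "0 \<le> b" "8 * b \<le> real n" and n: "n > 0" and finJ: "finite J" and t: "t > 0"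
    and pat: "\<And>j. j \<in> J \<Longrightarrow> P j \<subseteq> cross_pairs n \<sigma> \<and> A j \<subseteq> cross_pairs n \<sigma> \<and> P j \<inter> A j = {}"
    and far: "\<And>i j. i \<in> J \<Longrightarrow> j \<in> J \<Longrightarrow> \<not> near i j \<Longrightarrow> P i \<inter> P j = {} \<and> card (A i \<inter> A j) \<le> 4"
    and near: "(\<Sum>i\<in>J. \<Sum>j\<in>{j\<in>J. near i j}.
        pr (edges_pmf n 0 b \<sigma>) {E. P i \<union> P j \<subseteq> E}) \<le> C\<^sub>1 * real n"
    and \<mu>: "\<mu> = (\<Sum>j\<in>J. p n ^ card (P j) * (1 - p n) ^ card (A j))" "\<mu> \<le> C\<^sub>0 * real n"
  shows "pr (edges_pmf n 0 b \<sigma>)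
      {E. t * real n \<le> \<bar>real (card {j\<in>J. P j \<subseteq> E \<and> A j \<inter> E = {}}) - \<mu>\<bar>}
    \<le> (8 * b * C\<^sub>0\<^sup>2 + C\<^sub>1) / t\<^sup>2 / real n"
proof -
  let ?pr = "pr (edges_pmf n 0 b \<sigma>)"
  define q where "q = p n"
  define m where "m j = q ^ card (P j) * (1 - q) ^ card (A j)" for j
  have q: "0 \<le> q" "q \<le> 1/8" using b n by (auto simp: q_def p_def field_simps)
  have bn: "b \<le> real n" using b by simp
  have pr: "?pr {E. P j \<subseteq> E \<and> A j \<inter> E = {}} = m j" if "j \<in> J" for j
    using prob_edges_pattern[of "P j" n \<sigma> "A j" b] pat[OF that] b(1) bn by (simp add: m_def q_def p_def)
  have m0: "m j \<ge> 0" for j using q by (simp add: m_def)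
  have \<mu>m: "\<mu> = (\<Sum>j\<in>J. m j)" using \<mu>(1) by (simp add: m_def q_def)
  have fincross: "finite X" if "X \<subseteq> cross_pairs n \<sigma>" for X using that by (rule finite_subset) simp
  \<comment> \<open>Four shared absent edges raise the joint probability by at most a factor
    \<open>1 + 8 * q\<close>; here \<open>8 * b \<le> real n\<close> is decisive.\<close>
  have inv: "1 \<le> (1 + 8 * q) * (1 - q) ^ 4"
  proof -
    have "1 + 4 * (- q) \<le> (1 + (- q)) ^ 4"
      using Bernoulli_inequality[of "- q" 4] q by simp
    then have "(1 + 8 * q) * (1 - 4 * q) \<le> (1 + 8 * q) * (1 - q) ^ 4"
      using q by (intro mult_left_mono) auto
    moreover have "0 \<le> 4 * q * (1 - 8 * q)" using q by (intro mult_nonneg_nonneg) auto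
    then have "1 \<le> (1 + 8 * q) * (1 - 4 * q)" by (simp add: algebra_simps)
    ultimately show ?thesis by linarith
  qed
  have far': "?pr {E. (P i \<subseteq> E \<and> A i \<inter> E = {}) \<and> (P j \<subseteq> E \<and> A j \<inter> E = {})} \<le> (1 + 8 * q) * (m i * m j)"
    if ij: "i \<in> J" "j \<in> J" "\<not> near i j" for i j
  \<comment> \<open>If one pattern requires an edge that the other forbids, they exclude each
    other.\<close>
  proof (cases "(P i \<union> P j) \<inter> (A i \<union> A j) = {}")
    case True
    have eq: "{E. (P i \<subseteq> E \<and> A i \<inter> E = {}) \<and> (P j \<subseteq> E \<and> A j \<inter> E = {})}
        = {E. P i \<union> P j \<subseteq> E \<and> (A i \<union> A j) \<inter> E = {}}" by blast
    have 1: "?pr {E. P i \<union> P j \<subseteq> E \<and> (A i \<union> A j) \<inter> E = {}}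
        = q ^ card (P i \<union> P j) * (1 - q) ^ card (A i \<union> A j)"
      using prob_edges_pattern[of "P i \<union> P j" n \<sigma> "A i \<union> A j" b] pat[OF ij(1)] pat[OF ij(2)] b(1) bn True
      by (simp add: q_def p_def)
    have 2: "card (P i \<union> P j) = card (P i) + card (P j)"
      using far[OF ij] pat[OF ij(1)] pat[OF ij(2)] by (intro card_Un_disjoint fincross) auto
    have "(1 - q) ^ 4 \<le> (1 - q) ^ card (A i \<inter> A j)"
      using q far[OF ij] by (intro power_decreasing) auto
    then have "(1 + 8 * q) * (1 - q) ^ 4 \<le> (1 + 8 * q) * (1 - q) ^ card (A i \<inter> A j)"
      using q by (intro mult_left_mono) auto
    with inv have "1 \<le> (1 + 8 * q) * (1 - q) ^ card (A i \<inter> A j)" by linarith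
    then have "(1 - q) ^ card (A i \<union> A j) * 1
        \<le> (1 - q) ^ card (A i \<union> A j) * ((1 + 8 * q) * (1 - q) ^ card (A i \<inter> A j))"
      by (rule mult_left_mono) (use q in auto)
    also have "\<dots> = (1 + 8 * q) * (1 - q) ^ (card (A i \<union> A j) + card (A i \<inter> A j))"
      by (simp add: power_add)
    also have "card (A i \<union> A j) + card (A i \<inter> A j) = card (A i) + card (A j)"
      using pat[OF ij(1)] pat[OF ij(2)] by (intro card_Un_Int[symmetric] fincross) auto
    finally have "(1 - q) ^ card (A i \<union> A j) \<le> (1 + 8 * q) * (1 - q) ^ (card (A i) + card (A j))" by simp
    then have "q ^ card (P i \<union> P j) * (1 - q) ^ card (A i \<union> A j)
        \<le> q ^ card (P i \<union> P j) * ((1 + 8 * q) * (1 - q) ^ (card (A i) + card (A j)))"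
      by (rule mult_left_mono) (use q in auto)
    also have "\<dots> = (1 + 8 * q) * (m i * m j)"
      unfolding 2 m_def power_add by (simp only: mult_ac)
    finally show ?thesis unfolding eq 1 .
  next
    case False
    then have "{E. (P i \<subseteq> E \<and> A i \<inter> E = {}) \<and> (P j \<subseteq> E \<and> A j \<inter> E = {})} = {}" by blast
    then have "?pr {E. (P i \<subseteq> E \<and> A i \<inter> E = {}) \<and> (P j \<subseteq> E \<and> A j \<inter> E = {})} = 0"
      by (simp only: measure_empty)
    moreover have "0 \<le> (1 + 8 * q) * (m i * m j)"
      using q m0[of i] m0[of j] by (intro mult_nonneg_nonneg) auto
    ultimately show ?thesis by linarith
  qed
  let ?Q = "\<lambda>j E. P j \<subseteq> E \<and> A j \<inter> E = {}"
  have "(\<Sum>i\<in>J. \<Sum>j\<in>J. ?pr {E. ?Q i E \<and> ?Q j E})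
      \<le> (\<Sum>i\<in>J. (\<Sum>j\<in>{j\<in>J. near i j}. ?pr {E. P i \<union> P j \<subseteq> E}) + (\<Sum>j\<in>J. (1 + 8 * q) * (m i * m j)))"
  proof (intro sum_mono)
    fix i assume i: "i \<in> J"
    have "(\<Sum>j\<in>J. ?pr {E. ?Q i E \<and> ?Q j E})
        = (\<Sum>j\<in>{j\<in>J. near i j}. ?pr {E. ?Q i E \<and> ?Q j E}) + (\<Sum>j\<in>{j\<in>J. \<not> near i j}. ?pr {E. ?Q i E \<and> ?Q j E})"
    proof -
      have "J = {j\<in>J. near i j} \<union> {j\<in>J. \<not> near i j}" by blast
      moreover have "{j\<in>J. near i j} \<inter> {j\<in>J. \<not> near i j} = {}" by blast
      ultimately show ?thesis
        using sum.union_disjoint[of "{j\<in>J. near i j}" "{j\<in>J. \<not> near i j}" "\<lambda>j. ?pr {E. ?Q i E \<and> ?Q j E}"] finJ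
        by simp
    qed
    also have "\<dots> \<le> (\<Sum>j\<in>{j\<in>J. near i j}. ?pr {E. P i \<union> P j \<subseteq> E}) + (\<Sum>j\<in>{j\<in>J. \<not> near i j}. (1 + 8 * q) * (m i * m j))"
      using i by (intro add_mono sum_mono far' measure_pmf.finite_measure_mono) auto
    also have "(\<Sum>j\<in>{j\<in>J. \<not> near i j}. (1 + 8 * q) * (m i * m j)) \<le> (\<Sum>j\<in>J. (1 + 8 * q) * (m i * m j))"
      using finJ q m0 by (intro sum_mono2) auto
    finally show "(\<Sum>j\<in>J. ?pr {E. ?Q i E \<and> ?Q j E})
      \<le> (\<Sum>j\<in>{j\<in>J. near i j}. ?pr {E. P i \<union> P j \<subseteq> E}) + (\<Sum>j\<in>J. (1 + 8 * q) * (m i * m j))" by simp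
  qed
  also have "\<dots> \<le> C\<^sub>1 * real n + (1 + 8 * q) * \<mu>\<^sup>2"
  proof -
    have "(\<Sum>i\<in>J. \<Sum>j\<in>J. (1 + 8 * q) * (m i * m j)) = (1 + 8 * q) * \<mu>\<^sup>2"
      unfolding \<mu>m power2_eq_square sum_product by (simp only: sum_distrib_left)
    then show ?thesis using near by (simp only: sum.distrib)
  qed
  \<comment> \<open>As \<mu> is of order \<open>n\<close> and \<open>q\<close> of order
    \<open>1 / n\<close>, the excess \<open>8 * q * \<mu>^2\<close> is only linear in
    \<open>n\<close>. Chebyshev's inequality at scale \<open>t * n\<close> then leaves an error of
    order \<open>1 / n\<close>.\<close>
  also have "\<dots> \<le> \<mu>\<^sup>2 + (8 * b * C\<^sub>0\<^sup>2 + C\<^sub>1) * real n"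
  proof -
    have "\<mu> \<ge> 0" using m0 by (simp add: \<mu>m sum_nonneg)
    then have "\<mu>\<^sup>2 \<le> (C\<^sub>0 * real n)\<^sup>2" using \<mu>(2) by (intro power_mono)
    then have "8 * q * \<mu>\<^sup>2 \<le> 8 * q * (C\<^sub>0 * real n)\<^sup>2" using q by (intro mult_left_mono) auto
    also have "\<dots> = 8 * b * C\<^sub>0\<^sup>2 * real n" using n by (simp add: q_def p_def power2_eq_square)
    finally show ?thesis by (simp add: algebra_simps)
  qed
  finally have pairs: "(\<Sum>i\<in>J. \<Sum>j\<in>J. ?pr {E. ?Q i E \<and> ?Q j E}) \<le> \<mu>\<^sup>2 + (8 * b * C\<^sub>0\<^sup>2 + C\<^sub>1) * real n" .
  have \<mu>pr: "(\<Sum>j\<in>J. ?pr {E. ?Q j E}) = \<mu>" using pr by (simp add: \<mu>m)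
  have "?pr {E. t * real n \<le> \<bar>real (card {j\<in>J. ?Q j E}) - (\<Sum>j\<in>J. ?pr {E. ?Q j E})\<bar>}
      \<le> (8 * b * C\<^sub>0\<^sup>2 + C\<^sub>1) * real n / (t * real n)\<^sup>2"
    by (rule prob_count_deviation) (use finJ t n pairs \<mu>pr in auto)
  also have "\<dots> = (8 * b * C\<^sub>0\<^sup>2 + C\<^sub>1) / t\<^sup>2 / real n"
    using n by (simp add: power2_eq_square)
  finally show ?thesis using \<mu>pr by simp
qed

lemma card_cross_pairs_le: "2 * real (card (cross_pairs n \<sigma>)) \<le> (real n)\<^sup>2"
proof -
  have "card (cross_pairs n \<sigma>) \<le> card (vertex_pairs n)"
    by (intro card_mono) (auto simp: cross_pairs_def)
  then show ?thesis using card_vertex_pairs[of n] by linarith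
qed

text \<open>The patterns are the single cross pairs with no absent edge, and two of them are near
  only if they are equal.\<close>

lemma edge_count_concentration:
  assumes b: "0 \<le> b" "8 * b \<le> real n" and n: "n > 0" and t: "t > 0"
  shows "pr (edges_pmf n 0 b \<sigma>)
      {E. t * real n \<le> \<bar>real (card E) - b / real n * real (card (cross_pairs n \<sigma>))\<bar>}
    \<le> (8 * b * b\<^sup>2 + b) / t\<^sup>2 / real n"
proof -
  let ?M = "edges_pmf n 0 b \<sigma>" and ?J = "cross_pairs n \<sigma>"
  have bn: "b \<le> real n" using b by simp
  have small: "b / real n * real (card ?J) \<le> b * real n"
  proof -
    have "real (card ?J) \<le> (real n)\<^sup>2"
      using card_cross_pairs_le[of n \<sigma>] of_nat_0_le_iff[of "card ?J", where 'a = real] by linarith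
    then have "b / real n * real (card ?J) \<le> b / real n * (real n)\<^sup>2"
      using b by (intro mult_left_mono) auto
    then show ?thesis using n by (simp add: power2_eq_square)
  qed
  have "pr ?M {E. t * real n \<le> \<bar>real (card {j\<in>?J. {j} \<subseteq> E \<and> {} \<inter> E = {}}) - b / real n * real (card ?J)\<bar>}
      \<le> (8 * b * b\<^sup>2 + b) / t\<^sup>2 / real n"
  proof (rule pattern_concentration[where near = "(=)"])
    have "pr ?M {E. {i} \<subseteq> E} = b / real n" if "i \<in> ?J" for i
      using prob_edges_pattern[of "{i}" n \<sigma> "{}" b] that b(1) bn by simp
    moreover have "{j \<in> ?J. i = j} = {i}" if "i \<in> ?J" for i using that by auto
    ultimately have "(\<Sum>i\<in>?J. \<Sum>j\<in>{j\<in>?J. i = j}. pr ?M {E. {i} \<union> {j} \<subseteq> E})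
        = (\<Sum>i\<in>?J. b / real n)" by (intro sum.cong) auto
    then show "(\<Sum>i\<in>?J. \<Sum>j\<in>{j\<in>?J. i = j}. pr ?M {E. {i} \<union> {j} \<subseteq> E}) \<le> b * real n"
      using small by (simp add: mult.commute)
  qed (use b n t small in \<open>auto simp: mult.commute\<close>)
  moreover have "pr ?M {E. t * real n \<le> \<bar>real (card E) - b / real n * real (card ?J)\<bar>}
      \<le> pr ?M {E. t * real n \<le> \<bar>real (card {j\<in>?J. {j} \<subseteq> E \<and> {} \<inter> E = {}}) - b / real n * real (card ?J)\<bar>}"
  proof (rule prob_mono_support)
    fix E assume E: "E \<in> set_pmf ?M" "E \<in> {E. t * real n \<le> \<bar>real (card E) - b / real n * real (card ?J)\<bar>}"
    have "{j\<in>?J. {j} \<subseteq> E \<and> {} \<inter> E = {}} = E" using set_edges_pmf_planted[OF E(1)] by blast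
    then show "E \<in> {E. t * real n \<le> \<bar>real (card {j\<in>?J. {j} \<subseteq> E \<and> {} \<inter> E = {}}) - b / real n * real (card ?J)\<bar>}"
      using E(2) by simp
  qed
  ultimately show ?thesis by (rule order_trans[rotated])
qed

section \<open>Free pairs and their conflicts as edge patterns\<close>

definition star :: "nat \<Rightarrow> (nat \<Rightarrow> nat) \<Rightarrow> nat \<Rightarrow> nat \<Rightarrow> nat set set" where
  "star n \<sigma> v c = (\<lambda>w. {v, w}) ` community n \<sigma> c"

lemma card_star [simp]: "card (star n \<sigma> v c) = card (community n \<sigma> c)"
  unfolding star_def by (intro card_image inj_onI) (auto simp: doubleton_eq_iff)

lemma finite_star [simp]: "finite (star n \<sigma> v c)"
  by (simp add: star_def)

lemma star_cross: "v \<in> {1..n} \<Longrightarrow> c \<noteq> \<sigma> v \<Longrightarrow> star n \<sigma> v c \<subseteq> cross_pairs n \<sigma>"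
  unfolding star_def cross_pairs_def community_def
  by (auto simp: pair_in_vertex_pairs simp del: atLeastAtMost_iff)

lemma in_star: "e \<in> star n \<sigma> v c \<Longrightarrow> \<exists>w. e = {v, w}"
  by (auto simp: star_def)

lemma star_disjoint: "c \<noteq> c' \<Longrightarrow> c \<noteq> \<sigma> v \<Longrightarrow> c' \<noteq> \<sigma> v \<Longrightarrow> star n \<sigma> v c \<inter> star n \<sigma> v c' = {}"
  unfolding star_def community_def by (auto simp: doubleton_eq_iff)

text \<open>Two near edge patterns have joint probability \<open>q\<close> if they use the same edge
  and \<open>q^2\<close> if the edges merely meet. Splitting the case distinction into a sum allows
  the two kinds to be counted separately.\<close>

lemma if_split_bound:
  fixes x q r :: real
  assumes "A \<Longrightarrow> B" C "x \<le> (if A then q else r)" "0 \<le> q" "0 \<le> r"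
  shows "x \<le> (if B then q else 0) + (if C then r else 0)"
  using assms by (cases A) auto

lemma doubleton_meet: "e = {a, x} \<Longrightarrow> e = {a', y} \<Longrightarrow> a \<noteq> a' \<Longrightarrow> e = {a, a'}"
  by auto

text \<open>With \<open>c \<noteq> \<sigma> v\<close> every use of a slot is a genuine change, so
  the set of used slots can be read off from the new colouring.\<close>

definition free_slots :: "nat \<Rightarrow> nat \<Rightarrow> (nat \<Rightarrow> nat) \<Rightarrow> nat set set \<Rightarrow> (nat \<times> nat) set" where
  "free_slots n k \<sigma> E = {(v, c). v \<in> {1..n} \<and> c \<in> {1..k} \<and> c \<noteq> \<sigma> v \<and> star n \<sigma> v c \<inter> E = {}}"

text \<open>This and \<open>edge_slots\<close> are the two kinds of conflict: two new colours for
  one vertex, or one new colour for two adjacent vertices. The order conditions list each conflict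
  once.\<close>

definition double_slots :: "nat \<Rightarrow> nat \<Rightarrow> (nat \<Rightarrow> nat) \<Rightarrow> nat set set \<Rightarrow> (nat \<times> nat \<times> nat) set" where
  "double_slots n k \<sigma> E = {(v, c, c'). c < c' \<and> (v, c) \<in> free_slots n k \<sigma> E \<and> (v, c') \<in> free_slots n k \<sigma> E}"

definition edge_slots :: "nat \<Rightarrow> nat \<Rightarrow> (nat \<Rightarrow> nat) \<Rightarrow> nat set set \<Rightarrow> (nat \<times> nat \<times> nat) set" where
  "edge_slots n k \<sigma> E = {(v, w, c). v < w \<and> {v, w} \<in> E \<and> (v, c) \<in> free_slots n k \<sigma> E \<and> (w, c) \<in> free_slots n k \<sigma> E}"

text \<open>The three index sets do not depend on the graph: means are sums over them, and the
  random sets of slots select the indices whose pattern occurs.\<close>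

definition slot_indices :: "nat \<Rightarrow> nat \<Rightarrow> (nat \<Rightarrow> nat) \<Rightarrow> (nat \<times> nat) set" where
  "slot_indices n k \<sigma> = {(v, c). v \<in> {1..n} \<and> c \<in> {1..k} \<and> c \<noteq> \<sigma> v}"

definition double_indices :: "nat \<Rightarrow> nat \<Rightarrow> (nat \<Rightarrow> nat) \<Rightarrow> (nat \<times> nat \<times> nat) set" where
  "double_indices n k \<sigma> = {(v, c, c'). v \<in> {1..n} \<and> c \<in> {1..k} \<and> c' \<in> {1..k} \<and> c < c' \<and> c \<noteq> \<sigma> v \<and> c' \<noteq> \<sigma> v}"

definition edge_indices :: "nat \<Rightarrow> nat \<Rightarrow> (nat \<Rightarrow> nat) \<Rightarrow> (nat \<times> nat \<times> nat) set" where
  "edge_indices n k \<sigma> = {(v, w, c). v \<in> {1..n} \<and> w \<in> {1..n} \<and> v < w \<and> \<sigma> v \<noteq> \<sigma> w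
     \<and> c \<in> {1..k} \<and> c \<noteq> \<sigma> v \<and> c \<noteq> \<sigma> w}"

text \<open>All absent edges of \<open>j\<close> contain the vertex \<open>fst j\<close>, so
  patterns at different vertices share at most the pair joining these vertices. Near means the same
  vertex, which leaves at most \<open>d\<close> choices.\<close>

lemma absent_star_concentration:
  fixes J :: "(nat \<times> 'c) set" and A :: "nat \<times> 'c \<Rightarrow> nat set set"
  assumes b: "0 \<le> b" "8 * b \<le> real n" and n: "n > 0" and t: "t > 0"
    and D: "finite D" "card D \<le> d" and J: "J \<subseteq> {1..n} \<times> D"
    and A: "\<And>j. j \<in> J \<Longrightarrow> A j \<subseteq> cross_pairs n \<sigma>" and at: "\<And>j e. e \<in> A j \<Longrightarrow> \<exists>w. e = {fst j, w}"
  shows "pr (edges_pmf n 0 b \<sigma>) {E. t * real n \<le> \<bar>real (card {j\<in>J. A j \<inter> E = {}}) - (\<Sum>j\<in>J. (1 - b / real n) ^ card (A j))\<bar>}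
    \<le> (8 * b * (real d)\<^sup>2 + (real d)\<^sup>2) / t\<^sup>2 / real n"
proof -
  let ?M = "edges_pmf n 0 b \<sigma>"
  define \<mu> where "\<mu> = (\<Sum>j\<in>J. (1 - b / real n) ^ card (A j))"
  have finJ: "finite J" using finite_subset[OF J] D(1) by simp
  have "card J \<le> card ({1..n} \<times> D)" using J D(1) by (intro card_mono) auto
  also have "\<dots> \<le> n * d" using D(2) by (simp add: card_cartesian_product)
  finally have "real (card J) \<le> real (n * d)" by (simp only: of_nat_le_iff)
  then have cardJ: "real (card J) \<le> real d * real n" by (simp add: mult.commute)
  have q: "0 \<le> 1 - b / real n" "1 - b / real n \<le> 1" using b n by (auto simp: field_simps)
  have "pr ?M {E. t * real n \<le> \<bar>real (card {j\<in>J. {} \<subseteq> E \<and> A j \<inter> E = {}}) - \<mu>\<bar>}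
    \<le> (8 * b * (real d)\<^sup>2 + (real d)\<^sup>2) / t\<^sup>2 / real n"
  proof (rule pattern_concentration[where near = "\<lambda>i j. fst i = fst j"])
    show "{} \<subseteq> cross_pairs n \<sigma> \<and> A j \<subseteq> cross_pairs n \<sigma> \<and> {} \<inter> A j = {}" if "j \<in> J" for j
      using A[OF that] by simp
    show "{} \<inter> {} = {} \<and> card (A i \<inter> A j) \<le> 4" if "i \<in> J" "j \<in> J" "fst i \<noteq> fst j" for i j
    proof -
      have "A i \<inter> A j \<subseteq> {{fst i, fst j}}"
      proof
        fix e assume "e \<in> A i \<inter> A j"
        then obtain w w' where "e = {fst i, w}" "e = {fst j, w'}" using at by (metis IntE)
        then show "e \<in> {{fst i, fst j}}" using that(3) by (auto simp: doubleton_eq_iff)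
      qed
      then have "card (A i \<inter> A j) \<le> card {{fst i, fst j}}" by (intro card_mono) auto
      then show ?thesis by simp
    qed
    have "(\<Sum>i\<in>J. \<Sum>j\<in>{j\<in>J. fst i = fst j}. pr ?M {E. {} \<union> {} \<subseteq> E})
        \<le> (\<Sum>i\<in>J. real d)"
    proof (intro sum_mono)
      fix i
      have "card {j\<in>J. fst i = fst j} \<le> card ({fst i} \<times> D)"
        using J D(1) by (intro card_mono) auto
      then have "card {j\<in>J. fst i = fst j} \<le> d" using D(2) by (simp add: card_cartesian_product)
      then show "(\<Sum>j\<in>{j\<in>J. fst i = fst j}. pr ?M {E. {} \<union> {} \<subseteq> E}) \<le> real d"
        by simp
    qed
    also have "\<dots> \<le> (real d)\<^sup>2 * real n"
      using cardJ mult_right_mono[of "real (card J)" "real d * real n" "real d"] by (simp add: power2_eq_square algebra_simps)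
    finally show "(\<Sum>i\<in>J. \<Sum>j\<in>{j\<in>J. fst i = fst j}. pr ?M {E. {} \<union> {} \<subseteq> E}) \<le> (real d)\<^sup>2 * real n" .
    have "\<mu> \<le> (\<Sum>j\<in>J. 1)"
      unfolding \<mu>_def using q by (intro sum_mono) (auto intro!: power_le_one)
    then show "\<mu> \<le> real d * real n" using cardJ by simp
  qed (use b n t finJ in \<open>auto simp: \<mu>_def\<close>)
  then show ?thesis by (simp add: \<mu>_def)
qed

lemma free_slots_concentration:
  assumes b: "0 \<le> b" "8 * b \<le> real n" and n: "n > 0" and t: "t > 0"
  shows "pr (edges_pmf n 0 b \<sigma>) {E. t * real n \<le> \<bar>real (card (free_slots n k \<sigma> E))
      - (\<Sum>(v, c)\<in>slot_indices n k \<sigma>. (1 - b / real n) ^ card (community n \<sigma> c))\<bar>}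
    \<le> (8 * b * (real k)\<^sup>2 + (real k)\<^sup>2) / t\<^sup>2 / real n"
proof -
  define J where "J = slot_indices n k \<sigma>"
  define A where "A = (\<lambda>(v, c). star n \<sigma> v c)"
  have "pr (edges_pmf n 0 b \<sigma>) {E. t * real n \<le> \<bar>real (card {j\<in>J. A j \<inter> E = {}}) - (\<Sum>j\<in>J. (1 - b / real n) ^ card (A j))\<bar>}
    \<le> (8 * b * (real k)\<^sup>2 + (real k)\<^sup>2) / t\<^sup>2 / real n"
  proof (rule absent_star_concentration[OF b n t, where D = "{1..k}"])
    show "A j \<subseteq> cross_pairs n \<sigma>" if "j \<in> J" for j
    proof -
      obtain v c where j: "j = (v, c)" by (cases j)
      show ?thesis using that star_cross[of v n c \<sigma>] unfolding j J_def A_def slot_indices_def by simp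
    qed
    show "\<exists>w. e = {fst j, w}" if "e \<in> A j" for e j
      using that in_star by (simp add: A_def case_prod_beta)
  qed (auto simp: J_def slot_indices_def)
  moreover have "{j\<in>J. A j \<inter> E = {}} = free_slots n k \<sigma> E" for E
    by (auto simp: J_def slot_indices_def A_def free_slots_def)
  moreover have "(\<Sum>j\<in>J. (1 - b / real n) ^ card (A j)) = (\<Sum>(v, c)\<in>J. (1 - b / real n) ^ card (community n \<sigma> c))"
    by (intro sum.cong) (auto simp: A_def)
  ultimately show ?thesis by (simp add: J_def)
qed

lemma double_slots_concentration:
  assumes b: "0 \<le> b" "8 * b \<le> real n" and n: "n > 0" and t: "t > 0"
  shows "pr (edges_pmf n 0 b \<sigma>) {E. t * real n \<le> \<bar>real (card (double_slots n k \<sigma> E))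
      - (\<Sum>(v, c, c')\<in>double_indices n k \<sigma>. (1 - b / real n) ^ (card (community n \<sigma> c) + card (community n \<sigma> c')))\<bar>}
    \<le> (8 * b * (real (k * k))\<^sup>2 + (real (k * k))\<^sup>2) / t\<^sup>2 / real n"
proof -
  define J where "J = double_indices n k \<sigma>"
  define A where "A = (\<lambda>(v, c, c'). star n \<sigma> v c \<union> star n \<sigma> v c')"
  have "pr (edges_pmf n 0 b \<sigma>) {E. t * real n \<le> \<bar>real (card {j\<in>J. A j \<inter> E = {}}) - (\<Sum>j\<in>J. (1 - b / real n) ^ card (A j))\<bar>}
    \<le> (8 * b * (real (k * k))\<^sup>2 + (real (k * k))\<^sup>2) / t\<^sup>2 / real n"
  proof (rule absent_star_concentration[OF b n t, where D = "{1..k} \<times> {1..k}"])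
    show "A j \<subseteq> cross_pairs n \<sigma>" if "j \<in> J" for j
    proof -
      obtain v c c' where j: "j = (v, c, c')" by (cases j)
      show ?thesis using that star_cross[of v n c \<sigma>] star_cross[of v n c' \<sigma>]
        unfolding j J_def A_def double_indices_def by simp
    qed
    show "\<exists>w. e = {fst j, w}" if "e \<in> A j" for e j
    proof -
      have "e \<in> star n \<sigma> (fst j) (fst (snd j)) \<union> star n \<sigma> (fst j) (snd (snd j))"
        using that by (simp add: A_def case_prod_beta)
      then show ?thesis using in_star by (metis UnE)
    qed
  qed (auto simp: J_def double_indices_def)
  moreover have "{j\<in>J. A j \<inter> E = {}} = double_slots n k \<sigma> E" for E
    by (auto simp: J_def double_indices_def A_def double_slots_def free_slots_def)
  moreover have "(\<Sum>j\<in>J. (1 - b / real n) ^ card (A j))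
      = (\<Sum>(v, c, c')\<in>J. (1 - b / real n) ^ (card (community n \<sigma> c) + card (community n \<sigma> c')))"
    by (intro sum.cong refl) (auto simp: A_def J_def double_indices_def card_Un_disjoint star_disjoint)
  ultimately show ?thesis by (simp add: J_def)
qed

text \<open>A pattern is an edge together with a star at each end, so patterns on disjoint edges
  share at most the four pairs between their ends. Among the near ones at most \<open>k\<close> use
  the same edge, with probability \<open>q\<close>, and at most \<open>4 * n * k\<close> meet it,
  with probability \<open>q^2\<close>; over at most \<open>n^2 * k\<close> patterns this adds up to
  order \<open>n\<close>.\<close>

lemma edge_slots_concentration:
  assumes b: "0 \<le> b" "8 * b \<le> real n" and n: "n > 0" and t: "t > 0"
  shows "pr (edges_pmf n 0 b \<sigma>) {E. t * real n \<le> \<bar>real (card (edge_slots n k \<sigma> E))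
      - (\<Sum>(v, w, c)\<in>edge_indices n k \<sigma>.
          b / real n * (1 - b / real n) ^ (2 * card (community n \<sigma> c)))\<bar>}
    \<le> (8 * b * (b * real k)\<^sup>2 + (real k)\<^sup>2 * (b + 4 * b\<^sup>2)) / t\<^sup>2 / real n"
proof -
  let ?M = "edges_pmf n 0 b \<sigma>"
  define q where "q = b / real n"
  have bn: "b \<le> real n" using b by simp
  have q: "0 \<le> q" "q \<le> 1" using b n by (auto simp: q_def field_simps)
  define J where "J = edge_indices n k \<sigma>"
  define P where "P = (\<lambda>(v, w, c :: nat). {{v, w :: nat}})"
  define A where "A = (\<lambda>(v, w, c). star n \<sigma> v c \<union> star n \<sigma> w c)"
  define ends where "ends = (\<lambda>(v, w, c :: nat). {v, w :: nat})"
  define near where "near i j \<longleftrightarrow> ends i \<inter> ends j \<noteq> {}" for i j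
  have Jsub: "J \<subseteq> {1..n} \<times> {1..n} \<times> {1..k}" by (auto simp: J_def edge_indices_def)
  then have finJ: "finite J" by (rule finite_subset) auto
  have "card J \<le> card ({1..n} \<times> {1..n} \<times> {1..k})" using Jsub by (intro card_mono) auto
  then have cardJ: "real (card J) \<le> real n * (real n * real k)"
    by (simp flip: of_nat_mult)
  have cardA: "card (star n \<sigma> v c \<union> star n \<sigma> w c) = 2 * card (community n \<sigma> c)"
    if "v \<noteq> w" "c \<noteq> \<sigma> v" "c \<noteq> \<sigma> w" for v w c
  proof -
    have "star n \<sigma> v c \<inter> star n \<sigma> w c = {}"
      using that unfolding star_def community_def by (auto simp: doubleton_eq_iff)
    then show ?thesis by (simp add: card_Un_disjoint)
  qed
  define \<mu> where "\<mu> = (\<Sum>(v, w, c)\<in>J. b / real n * (1 - b / real n) ^ (2 * card (community n \<sigma> c)))"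
  have Pcross: "P j \<subseteq> cross_pairs n \<sigma>" if "j \<in> J" for j
    using that unfolding P_def J_def edge_indices_def cross_pairs_def
    by (cases j) (simp add: pair_in_vertex_pairs)
  have prP: "pr ?M {E. P i \<union> P j \<subseteq> E} \<le> (if ends i = ends j then q else q\<^sup>2)"
    if ij: "i \<in> J" "j \<in> J" for i j
  proof -
    have 1: "pr ?M {E. P i \<union> P j \<subseteq> E} = q ^ card (P i \<union> P j)"
      using prob_edges_pattern[of "P i \<union> P j" n \<sigma> "{}" b] Pcross[OF ij(1)] Pcross[OF ij(2)] b(1) bn
      by (simp add: q_def)
    have 2: "P i \<union> P j = {ends i, ends j}" by (auto simp: P_def ends_def split: prod.splits)
    show ?thesis
      unfolding 1 unfolding 2 by (cases "ends i = ends j") (simp_all add: power2_eq_square)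
  qed
  have "pr ?M {E. t * real n \<le> \<bar>real (card {j\<in>J. P j \<subseteq> E \<and> A j \<inter> E = {}}) - \<mu>\<bar>}
    \<le> (8 * b * (b * real k)\<^sup>2 + (real k)\<^sup>2 * (b + 4 * b\<^sup>2)) / t\<^sup>2 / real n"
  proof (rule pattern_concentration[where near = near])
    show "P j \<subseteq> cross_pairs n \<sigma> \<and> A j \<subseteq> cross_pairs n \<sigma> \<and> P j \<inter> A j = {}" if "j \<in> J" for j
    proof (intro conjI)
      obtain v w c where j: "j = (v, w, c)" by (cases j) auto
      have h: "v \<in> {1..n}" "w \<in> {1..n}" "v < w" "\<sigma> v \<noteq> \<sigma> w" "c \<noteq> \<sigma> v" "c \<noteq> \<sigma> w"
        using that by (auto simp: j J_def edge_indices_def)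
      show "P j \<subseteq> cross_pairs n \<sigma>" using that by (rule Pcross)
      show "A j \<subseteq> cross_pairs n \<sigma>" using h star_cross[of v n c \<sigma>] star_cross[of w n c \<sigma>] by (simp add: A_def j)
      have "{v, w} \<notin> star n \<sigma> v c" "{v, w} \<notin> star n \<sigma> w c"
        using h(5,6) unfolding star_def community_def by (auto simp: doubleton_eq_iff)
      then show "P j \<inter> A j = {}" by (simp add: P_def A_def j)
    qed
    show "P i \<inter> P j = {} \<and> card (A i \<inter> A j) \<le> 4" if "i \<in> J" "j \<in> J" "\<not> near i j" for i j
    proof -
      obtain v w c where i: "i = (v, w, c)" by (cases i) auto
      obtain v' w' c' where j: "j = (v', w', c')" by (cases j) auto
      have ne: "v \<noteq> v'" "v \<noteq> w'" "w \<noteq> v'" "w \<noteq> w'" using that(3) by (auto simp: near_def ends_def i j)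
      have "A i \<inter> A j \<subseteq> {{v, v'}, {v, w'}, {w, v'}, {w, w'}}"
      proof
        fix e assume "e \<in> A i \<inter> A j"
        then have e: "e \<in> star n \<sigma> v c \<union> star n \<sigma> w c" "e \<in> star n \<sigma> v' c' \<union> star n \<sigma> w' c'"
          unfolding A_def i j prod.case by blast+
        have 1: "\<exists>x. e = {v, x} \<or> e = {w, x}"
          using e(1) in_star[of e n \<sigma> v c] in_star[of e n \<sigma> w c] by blast
        have 2: "\<exists>y. e = {v', y} \<or> e = {w', y}"
          using e(2) in_star[of e n \<sigma> v' c'] in_star[of e n \<sigma> w' c'] by blast
        obtain x where x: "e = {v, x} \<or> e = {w, x}" using 1 by (rule exE)
        obtain y where "e = {v', y} \<or> e = {w', y}" using 2 by (rule exE)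
        with x have "e = {v, v'} \<or> e = {v, w'} \<or> e = {w, v'} \<or> e = {w, w'}"
          using doubleton_meet[of e v x v' y] doubleton_meet[of e v x w' y]
            doubleton_meet[of e w x v' y] doubleton_meet[of e w x w' y] ne by argo
        then show "e \<in> {{v, v'}, {v, w'}, {w, v'}, {w, w'}}" unfolding insert_iff empty_iff simp_thms .
      qed
      then have "card (A i \<inter> A j) \<le> card {{v, v'}, {v, w'}, {w, v'}, {w, w'}}" by (intro card_mono) auto
      also have "\<dots> \<le> 4"
        using card_length[of "[{v, v'}, {v, w'}, {w, v'}, {w, w'}]"] by simp
      finally show ?thesis using ne by (auto simp: P_def i j doubleton_eq_iff)
    qed
    have "(\<Sum>i\<in>J. \<Sum>j\<in>{j\<in>J. near i j}. pr ?M {E. P i \<union> P j \<subseteq> E})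
        \<le> (\<Sum>i\<in>J. real k * (q + 4 * real n * q\<^sup>2))"
    proof (intro sum_mono)
      fix i assume i: "i \<in> J"
      obtain v w c where i': "i = (v, w, c)" by (cases i) auto
      let ?S = "{v} \<times> {w} \<times> {1..k}"
      let ?T = "({v} \<times> {1..n} \<times> {1..k} \<union> {w} \<times> {1..n} \<times> {1..k}) \<union> ({1..n} \<times> {v} \<times> {1..k} \<union> {1..n} \<times> {w} \<times> {1..k})"
      have "(\<Sum>j\<in>{j\<in>J. near i j}. pr ?M {E. P i \<union> P j \<subseteq> E})
          \<le> (\<Sum>j\<in>{j\<in>J. near i j}. (if j \<in> ?S then q else 0) + (if j \<in> ?T then q\<^sup>2 else 0))"
      proof (intro sum_mono)
        fix j assume "j \<in> {j\<in>J. near i j}"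
        then have j: "j \<in> J" "near i j" by auto
        obtain v' w' c' where j': "j = (v', w', c')" by (cases j) auto
        have h: "v < w" "v' < w'" "v' \<in> {1..n}" "w' \<in> {1..n}" "c' \<in> {1..k}"
          using i j(1) unfolding i' j' J_def edge_indices_def by simp_all
        have "j \<in> ?S" if "ends i = ends j"
        proof -
          have "{v, w} = {v', w'}" using that by (simp add: ends_def i' j')
          then have "v' = v \<and> w' = w" using h(1,2) by (metis doubleton_eq_iff less_asym)
          then show ?thesis using h(5) by (simp add: j')
        qed
        moreover have "j \<in> ?T"
        proof -
          have "v' = v \<or> v' = w \<or> w' = v \<or> w' = w"
            using j(2) unfolding near_def ends_def i' j' by blast
          then show ?thesis using h(3-5) unfolding j' by blast
        qed
        ultimately show "pr ?M {E. P i \<union> P j \<subseteq> E} \<le> (if j \<in> ?S then q else 0) + (if j \<in> ?T then q\<^sup>2 else 0)"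
          using prP[OF i j(1)] q(1) zero_le_power2[of q] by (rule if_split_bound)
      qed
      also have "\<dots> = (\<Sum>j\<in>{j\<in>J. near i j} \<inter> ?S. q) + (\<Sum>j\<in>{j\<in>J. near i j} \<inter> ?T. q\<^sup>2)"
      proof -
        have "finite {j\<in>J. near i j}" using finJ by simp
        then show ?thesis by (simp only: sum.distrib sum.inter_restrict)
      qed
      also have "\<dots> \<le> real k * q + real (4 * (n * k)) * q\<^sup>2"
      proof -
        have "card ({j\<in>J. near i j} \<inter> ?S) \<le> card ?S" by (intro card_mono) auto
        then have 1: "card ({j\<in>J. near i j} \<inter> ?S) \<le> k" by (simp add: card_cartesian_product)
        have "card ({j\<in>J. near i j} \<inter> ?T) \<le> card ?T" by (intro card_mono) auto
        also have "\<dots> \<le> (card ({v} \<times> {1..n} \<times> {1..k}) + card ({w} \<times> {1..n} \<times> {1..k}))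
            + (card ({1..n} \<times> {v} \<times> {1..k}) + card ({1..n} \<times> {w} \<times> {1..k}))"
          by (intro order_trans[OF card_Un_le] add_mono card_Un_le)
        finally have 2: "card ({j\<in>J. near i j} \<inter> ?T) \<le> 4 * (n * k)" by (simp add: card_cartesian_product)
        show ?thesis
          unfolding sum_constant
          by (intro add_mono mult_right_mono) (use 1 2 q in \<open>simp_all only: of_nat_le_iff zero_le_power2\<close>)
      qed
      also have "\<dots> = real k * (q + 4 * real n * q\<^sup>2)" by (simp add: algebra_simps)
      finally show "(\<Sum>j\<in>{j\<in>J. near i j}. pr ?M {E. P i \<union> P j \<subseteq> E}) \<le> real k * (q + 4 * real n * q\<^sup>2)" .
    qed
    also have "\<dots> = real (card J) * (real k * (q + 4 * real n * q\<^sup>2))" by simp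
    also have "\<dots> \<le> (real n * (real n * real k)) * (real k * (q + 4 * real n * q\<^sup>2))"
      using cardJ q by (intro mult_right_mono) auto
    also have "\<dots> = (real k)\<^sup>2 * (b + 4 * b\<^sup>2) * real n"
      using n by (simp add: q_def power2_eq_square field_simps)
    finally show "(\<Sum>i\<in>J. \<Sum>j\<in>{j\<in>J. near i j}. pr ?M {E. P i \<union> P j \<subseteq> E}) \<le> (real k)\<^sup>2 * (b + 4 * b\<^sup>2) * real n" .
    show "\<mu> = (\<Sum>j\<in>J. (b / real n) ^ card (P j) * (1 - b / real n) ^ card (A j))"
      unfolding \<mu>_def by (intro sum.cong refl) (auto simp: P_def A_def J_def edge_indices_def cardA)
    have "\<mu> \<le> (\<Sum>j\<in>J. b / real n)"
    proof (unfold \<mu>_def, intro sum_mono)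
      fix j :: "nat \<times> nat \<times> nat"
      obtain v w c where j: "j = (v, w, c)" by (cases j)
      have "q * (1 - q) ^ (2 * card (community n \<sigma> c)) \<le> q * 1"
        using q by (intro mult_left_mono power_le_one) auto
      then show "(case j of (v, w, c) \<Rightarrow> b / real n * (1 - b / real n) ^ (2 * card (community n \<sigma> c))) \<le> b / real n"
        by (simp add: j q_def)
    qed
    also have "\<dots> \<le> (real n * (real n * real k)) * (b / real n)"
      using mult_right_mono[OF cardJ, of q] q by (simp add: q_def)
    finally show "\<mu> \<le> b * real k * real n" using n by (simp add: mult_ac)
  qed (use b n t finJ in auto)
  moreover have "pr ?M {E. t * real n \<le> \<bar>real (card (edge_slots n k \<sigma> E)) - \<mu>\<bar>}
      \<le> pr ?M {E. t * real n \<le> \<bar>real (card {j\<in>J. P j \<subseteq> E \<and> A j \<inter> E = {}}) - \<mu>\<bar>}"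
  proof (rule prob_mono_support)
    fix E assume E: "E \<in> set_pmf ?M" "E \<in> {E. t * real n \<le> \<bar>real (card (edge_slots n k \<sigma> E)) - \<mu>\<bar>}"
    \<comment> \<open>In the planted graph every edge is a cross pair, so the condition
      \<open>\<sigma> v \<noteq> \<sigma> w\<close> of \<open>edge_indices\<close> comes for free.
      This is why the comparison is restricted to the support.\<close>
    have cr: "\<sigma> v \<noteq> \<sigma> w" if "{v, w} \<in> E" for v w
      using that set_edges_pmf_planted[OF E(1)] unfolding cross_pairs_def
      by (metis (mono_tags, lifting) bichr_pair mem_Collect_eq subsetD)
    have "(v, w, c) \<in> {j\<in>J. P j \<subseteq> E \<and> A j \<inter> E = {}} \<longleftrightarrow> (v, w, c) \<in> edge_slots n k \<sigma> E" for v w c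
      unfolding J_def edge_indices_def P_def A_def edge_slots_def free_slots_def mem_Collect_eq prod.case
        insert_subset Int_Un_distrib2 Un_empty eqTrueI[OF empty_subsetI] simp_thms
      using cr[of v w] by argo
    then have "{j\<in>J. P j \<subseteq> E \<and> A j \<inter> E = {}} = edge_slots n k \<sigma> E"
      by (intro set_eqI) (simp only: split_paired_all)
    then show "E \<in> {E. t * real n \<le> \<bar>real (card {j\<in>J. P j \<subseteq> E \<and> A j \<inter> E = {}}) - \<mu>\<bar>}"
      using E(2) by simp
  qed
  ultimately show ?thesis by (simp add: \<mu>_def J_def)
qed

section \<open>Recolouring free pairs\<close>

text \<open>Adding an edge destroys at most a quarter of the independent sets: each destroyed set comes with the
  three sets obtained by removing one or both ends of the edge.\<close>

lemma card_independent_sets_ge: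
  fixes J :: "'a set" and K :: "('a \<times> 'a) set"
  assumes J: "finite J" and K: "finite K" "\<And>x y. (x, y) \<in> K \<Longrightarrow> x \<noteq> y"
  shows "2 ^ card J * (3 / 4 :: real) ^ card K
    \<le> real (card {I. I \<subseteq> J \<and> (\<forall>(x, y)\<in>K. \<not> (x \<in> I \<and> y \<in> I))})"
  using K
proof (induction K rule: finite_induct)
  case empty
  have "{I. I \<subseteq> J \<and> (\<forall>(x, y)\<in>{}. \<not> (x \<in> I \<and> y \<in> I))} = Pow J" by auto
  then show ?case using J by (simp add: card_Pow)
next
  case (insert e K)
  obtain x y where e: "e = (x, y)" by (cases e)
  then have xy: "x \<noteq> y" using insert.prems by simp
  define S where "S = {I. I \<subseteq> J \<and> (\<forall>(x, y)\<in>K. \<not> (x \<in> I \<and> y \<in> I))}"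
  define B where "B = {I\<in>S. x \<in> I \<and> y \<in> I}"
  have finS: "finite S" by (rule finite_subset[of _ "Pow J"]) (auto simp: S_def J)
  have finB: "finite B" using finS by (simp add: B_def)
  have down: "I - X \<in> S" if "I \<in> S" for I X using that unfolding S_def by blast
  \<comment> \<open>Each \<open>g X\<close> with \<open>X \<subseteq> {x, y}\<close> is a copy of
    \<open>B\<close> inside \<open>S\<close>, \<open>g {}\<close> being \<open>B\<close> itself;
    they are disjoint because the trace of a member on \<open>{x, y}\<close> determines
    \<open>X\<close>.\<close>
  define g where "g X = (\<lambda>I. I - X) ` B" for X
  have sub: "g X \<subseteq> S" for X using down unfolding g_def B_def by blast
  have cardg: "card (g X) = card B" if "X \<subseteq> {x, y}" for X
    unfolding g_def
  proof (intro card_image inj_onI)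
    fix I I' assume "I \<in> B" "I' \<in> B" "I - X = I' - X"
    moreover have "X \<subseteq> I" "X \<subseteq> I'" using \<open>I \<in> B\<close> \<open>I' \<in> B\<close> that by (auto simp: B_def)
    ultimately show "I = I'" by blast
  qed
  have finG: "finite (g X)" for X using finB by (simp add: g_def)
  have mem: "I \<inter> {x, y} = {x, y} - X" if "I \<in> g X" for I X
    using that unfolding g_def B_def by blast
  have disj: "g X \<inter> g Y = {}" if "X \<subseteq> {x, y}" "Y \<subseteq> {x, y}" "X \<noteq> Y" for X Y
  proof -
    have "{x, y} - X \<noteq> {x, y} - Y" using that by blast
    moreover have "{x, y} - X = {x, y} - Y" if "I \<in> g X" "I \<in> g Y" for I
      using mem[OF that(1)] mem[OF that(2)] by simp
    ultimately show ?thesis by blast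
  qed
  have "4 * card B = (\<Sum>X\<in>Pow {x, y}. card (g X))"
    using xy by (simp add: cardg card_Pow)
  also have "\<dots> = card (\<Union>X\<in>Pow {x, y}. g X)"
    by (intro card_UN_disjoint[symmetric] ballI impI) (auto simp: finG disj)
  also have "\<dots> \<le> card S"
    using finS sub by (intro card_mono) auto
  finally have 4: "4 * real (card B) \<le> real (card S)" by linarith
  have "{I. I \<subseteq> J \<and> (\<forall>(x, y)\<in>insert e K. \<not> (x \<in> I \<and> y \<in> I))} = S - B"
    unfolding S_def B_def e by blast
  moreover have "card (S - B) = card S - card B" using finB by (intro card_Diff_subset) (auto simp: B_def)
  moreover have "card B \<le> card S" using finS by (intro card_mono) (auto simp: B_def)
  ultimately have "real (card {I. I \<subseteq> J \<and> (\<forall>(x, y)\<in>insert e K. \<not> (x \<in> I \<and> y \<in> I))}) = real (card S) - real (card B)"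
    by (simp only: of_nat_diff)
  moreover have "2 ^ card J * (3 / 4 :: real) ^ card K \<le> real (card S)"
    unfolding S_def by (rule insert.IH) (use insert.prems in blast)
  ultimately show ?case using 4 insert.hyps by simp
qed

lemma finite_free_slots [simp]: "finite (free_slots n k \<sigma> E)"
  by (rule finite_subset[of _ "{1..n} \<times> {1..k}"]) (auto simp: free_slots_def)

lemma finite_double_slots [simp]: "finite (double_slots n k \<sigma> E)"
  by (rule finite_subset[of _ "{1..n} \<times> {1..k} \<times> {1..k}"]) (auto simp: double_slots_def free_slots_def)

lemma finite_edge_slots [simp]: "finite (edge_slots n k \<sigma> E)"
  by (rule finite_subset[of _ "{1..n} \<times> {1..n} \<times> {1..k}"]) (auto simp: edge_slots_def free_slots_def)

definition proper_colorings :: "nat \<Rightarrow> nat \<Rightarrow> nat set set \<Rightarrow> (nat \<Rightarrow> nat) set" where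
  "proper_colorings n k E = {\<tau> \<in> vcolorings n k. \<forall>e\<in>E. bichr \<tau> e}"

lemma finite_proper_colorings [simp]: "finite (proper_colorings n k E)"
  unfolding proper_colorings_def by (rule finite_subset[OF _ finite_vcolorings]) blast

text \<open>All slots of an independent set can be used at once. Double slots leave at most one new
  colour per vertex, edge slots keep adjacent vertices from receiving the same new colour, and
  freeness rules out a clash with a neighbour that keeps its colour. The map \<open>slots\<close>
  reads the independent set off from the new colouring, so different sets give different
  colourings.\<close>

lemma card_proper_colorings_ge:
  assumes \<sigma>: "\<sigma> \<in> vcolorings n k" and E: "E \<subseteq> cross_pairs n \<sigma>"
  shows "2 ^ card (free_slots n k \<sigma> E)
      * (3 / 4 :: real) ^ (card (double_slots n k \<sigma> E) + card (edge_slots n k \<sigma> E))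
    \<le> real (card (proper_colorings n k E))"
proof -
  let ?J = "free_slots n k \<sigma> E"
  define K where "K = (\<lambda>(v, c, c'). ((v, c), (v, c'))) ` double_slots n k \<sigma> E
      \<union> (\<lambda>(v, w, c). ((v, c), (w, c))) ` edge_slots n k \<sigma> E"
  define Ind where "Ind = {I. I \<subseteq> ?J \<and> (\<forall>(x, y)\<in>K. \<not> (x \<in> I \<and> y \<in> I))}"
  have K1: "((v, c), (v, c')) \<in> K" if "(v, c) \<in> ?J" "(v, c') \<in> ?J" "c < c'" for v c c'
  proof -
    have "(v, c, c') \<in> double_slots n k \<sigma> E" using that by (simp add: double_slots_def)
    then show ?thesis unfolding K_def by force
  qed
  have K2: "((v, c), (w, c)) \<in> K" if "(v, c) \<in> ?J" "(w, c) \<in> ?J" "v < w" "{v, w} \<in> E" for v w c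
  proof -
    have "(v, w, c) \<in> edge_slots n k \<sigma> E" using that by (simp add: edge_slots_def)
    then show ?thesis unfolding K_def by force
  qed
  have finK: "finite K" by (simp add: K_def)
  have Kne: "x \<noteq> y" if "(x, y) \<in> K" for x y
    using that by (auto simp: K_def double_slots_def edge_slots_def)
  have "card K \<le> card (double_slots n k \<sigma> E) + card (edge_slots n k \<sigma> E)"
    unfolding K_def by (intro order_trans[OF card_Un_le] add_mono card_image_le) simp_all
  then have "(3 / 4 :: real) ^ (card (double_slots n k \<sigma> E) + card (edge_slots n k \<sigma> E)) \<le> (3 / 4) ^ card K"
    by (intro power_decreasing) auto
  then have "2 ^ card ?J * (3 / 4 :: real) ^ (card (double_slots n k \<sigma> E) + card (edge_slots n k \<sigma> E))
      \<le> 2 ^ card ?J * (3 / 4) ^ card K" by (intro mult_left_mono) auto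
  also have "\<dots> \<le> real (card Ind)"
    unfolding Ind_def by (intro card_independent_sets_ge finK Kne) simp_all
  also have "card Ind \<le> card (proper_colorings n k E)"
  proof -
    define slots where "slots \<tau> = {(v, c). v \<in> {1..n} \<and> c = \<tau> v \<and> \<tau> v \<noteq> \<sigma> v}" for \<tau> :: "nat \<Rightarrow> nat"
    have "Ind \<subseteq> slots ` proper_colorings n k E"
    proof
      fix I assume "I \<in> Ind"
      then have IJ: "I \<subseteq> ?J" and IK: "\<And>x y. (x, y) \<in> K \<Longrightarrow> \<not> (x \<in> I \<and> y \<in> I)"
        by (auto simp: Ind_def)
      have uniq: "c = c'" if "(v, c) \<in> I" "(v, c') \<in> I" for v c c'
      proof (rule ccontr)
        assume "c \<noteq> c'"
        then consider "c < c'" | "c' < c" by linarith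
        then show False
        proof cases
          case 1
          then show False using K1[of v c c'] IK that IJ by blast
        next
          case 2
          then show False using K1[of v c' c] IK that IJ by blast
        qed
      qed
      define \<tau> where "\<tau> v = (if \<exists>c. (v, c) \<in> I then THE c. (v, c) \<in> I else \<sigma> v)" for v
      have \<tau>I: "\<tau> v = c" if "(v, c) \<in> I" for v c
        unfolding \<tau>_def using that uniq by (auto intro!: the_equality)
      have \<tau>\<sigma>: "\<tau> v = \<sigma> v" if "\<not> (\<exists>c. (v, c) \<in> I)" for v
        using that by (simp add: \<tau>_def)
      have free: "v \<in> {1..n}" "c \<in> {1..k}" "c \<noteq> \<sigma> v" "\<And>w. w \<in> {1..n} \<Longrightarrow> \<sigma> w = c \<Longrightarrow> {v, w} \<notin> E"
        if "(v, c) \<in> I" for v c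
      proof -
        have J: "(v, c) \<in> ?J" using that IJ by blast
        then show "v \<in> {1..n}" "c \<in> {1..k}" "c \<noteq> \<sigma> v" by (simp_all add: free_slots_def)
        have "star n \<sigma> v c \<inter> E = {}" using J by (simp add: free_slots_def)
        moreover have "{v, w} \<in> star n \<sigma> v c" if "w \<in> {1..n}" "\<sigma> w = c" for w
          using that unfolding star_def community_def by blast
        ultimately show "\<And>w. w \<in> {1..n} \<Longrightarrow> \<sigma> w = c \<Longrightarrow> {v, w} \<notin> E" by blast
      qed
      have "\<tau> \<in> vcolorings n k"
        unfolding PiE_dflt_def
      proof (intro CollectI allI conjI impI)
        fix v assume v: "v \<in> {1..n}"
        then have "\<sigma> v \<in> {1..k}" using vcoloringsD[OF \<sigma>] by blast
        then show "\<tau> v \<in> {1..k}"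
          using \<tau>I free(2) \<tau>\<sigma> by (cases "\<exists>c. (v, c) \<in> I") (metis, metis)
      next
        fix v assume "v \<notin> {1..n}"
        then have "\<not> (\<exists>c. (v, c) \<in> I)" using free(1) by blast
        moreover have "\<sigma> v = 0" using \<sigma> \<open>v \<notin> {1..n}\<close> unfolding PiE_dflt_def by blast
        ultimately show "\<tau> v = 0" using \<tau>\<sigma> by simp
      qed
      moreover have "bichr \<tau> e" if "e \<in> E" for e
      proof -
        have "e \<in> cross_pairs n \<sigma>" using that E by blast
        then have "card e = 2" and sub: "e \<subseteq> {1..n}" and bi: "bichr \<sigma> e"
          by (simp_all add: cross_pairs_def vertex_pairs_def)
        from \<open>card e = 2\<close> obtain u v where uv: "e = {u, v}" "u \<noteq> v" unfolding card_2_iff by blast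
        have ne: "\<sigma> u \<noteq> \<sigma> v" using bi by (simp add: uv)
        have V: "u \<in> {1..n}" "v \<in> {1..n}" using sub by (auto simp: uv)
        have eE: "{u, v} \<in> E" "{v, u} \<in> E" using that by (simp_all add: uv insert_commute)
        \<comment> \<open>If the neighbour \<open>y\<close> is recoloured too, an equal new colour
          would be a conflict, listed with the smaller vertex first; otherwise \<open>y\<close>
          keeps its old colour and freeness of \<open>(x, c)\<close> applies.\<close>
        have moved: "\<tau> y \<noteq> c" if c: "(x, c) \<in> I" and y: "y \<in> {1..n}" "x \<noteq> y" "{x, y} \<in> E" "{y, x} \<in> E" for x y c
        proof (cases "\<exists>d. (y, d) \<in> I")
          case True
          then obtain d where d: "(y, d) \<in> I" by blast
          from y(2) consider "x < y" | "y < x" by linarith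
          then have "d \<noteq> c"
          proof cases
            case 1
            then show ?thesis using K2[of x c y] c d y IK IJ by blast
          next
            case 2
            then show ?thesis using K2[of y c x] c d y IK IJ by blast
          qed
          then show ?thesis using \<tau>I[OF d] by simp
        next
          case False
          then show ?thesis using \<tau>\<sigma>[OF False] free(4)[OF c y(1)] y(3) by metis
        qed
        have "\<tau> u \<noteq> \<tau> v"
        proof (cases "\<exists>c. (u, c) \<in> I")
          case True
          then obtain c where c: "(u, c) \<in> I" by blast
          show ?thesis using moved[OF c V(2) uv(2) eE] \<tau>I[OF c] by simp
        next
          case u: False
          show ?thesis
          proof (cases "\<exists>c. (v, c) \<in> I")
            case True
            then obtain c where c: "(v, c) \<in> I" by blast
            show ?thesis using moved[OF c V(1) uv(2)[symmetric] eE(2,1)] \<tau>I[OF c] by simp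
          next
            case False
            then show ?thesis using \<tau>\<sigma>[OF False] \<tau>\<sigma>[OF u] ne by simp
          qed
        qed
        then show ?thesis by (simp add: uv)
      qed
      ultimately have "\<tau> \<in> proper_colorings n k E" by (simp add: proper_colorings_def)
      moreover have "slots \<tau> = I"
      proof (intro set_eqI)
        fix x :: "nat \<times> nat"
        obtain v c where x: "x = (v, c)" by (cases x)
        have "(v, c) \<in> slots \<tau> \<longleftrightarrow> (v, c) \<in> I"
        proof
          assume "(v, c) \<in> slots \<tau>"
          then have h: "c = \<tau> v" "\<tau> v \<noteq> \<sigma> v" by (simp_all add: slots_def)
          then obtain d where "(v, d) \<in> I" using \<tau>\<sigma> by blast
          then show "(v, c) \<in> I" using \<tau>I h by metis
        next
          assume h: "(v, c) \<in> I"
          then show "(v, c) \<in> slots \<tau>"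
            using free(1,3)[OF h] \<tau>I[OF h] by (simp add: slots_def)
        qed
        then show "x \<in> slots \<tau> \<longleftrightarrow> x \<in> I" by (simp add: x)
      qed
      ultimately show "I \<in> slots ` proper_colorings n k E" by blast
    qed
    then show ?thesis by (rule surj_card_le[rotated]) simp
  qed
  finally show ?thesis by simp
qed

section \<open>Balanced communities and mean numbers of slots\<close>

text \<open>Upper bounds suffice: the sizes add up to \<open>n\<close>, so lower bounds follow in
  \<open>balanced_lower\<close>.\<close>

definition balanced :: "real \<Rightarrow> nat \<Rightarrow> nat \<Rightarrow> (nat \<Rightarrow> nat) \<Rightarrow> bool" where
  "balanced \<eta> n k \<sigma> \<longleftrightarrow> \<sigma> \<in> vcolorings n k \<and>
     (\<forall>i\<in>{1..k}. csize n \<sigma> i \<le> (1 + \<eta>) * real n / real k)"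

lemma sum_community:
  assumes "\<sigma> \<in> vcolorings n k"
  shows "(\<Sum>i=1..k. card (community n \<sigma> i)) = n"
proof -
  have "{v \<in> {1..n}. \<sigma> v \<in> {1..k}} = {1..n}" using vcoloringsD[OF assms] by blast
  moreover have "{1..n} \<inter> community n \<sigma> i = community n \<sigma> i" for i using community_subset by blast
  ultimately show ?thesis using sum_card_Int_community[of "{1..k}" "{1..n}" n \<sigma>] by simp
qed

lemma balanced_lower:
  assumes bal: "balanced \<eta> n k \<sigma>" and i: "i \<in> {1..k}"
  shows "(1 - (real k - 1) * \<eta>) * real n / real k \<le> csize n \<sigma> i"
proof -
  let ?N = "\<lambda>i. csize n \<sigma> i"
  have k: "k > 0" using i by simp
  have "real n = (\<Sum>i=1..k. ?N i)"
    using sum_community[of \<sigma> n k] bal unfolding balanced_def by (metis of_nat_sum)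
  also have "\<dots> = ?N i + (\<Sum>j\<in>{1..k} - {i}. ?N j)"
    using i by (intro sum.remove) auto
  also have "(\<Sum>j\<in>{1..k} - {i}. ?N j) \<le> (\<Sum>j\<in>{1..k} - {i}. (1 + \<eta>) * real n / real k)"
    using bal unfolding balanced_def by (intro sum_mono) blast
  also have "\<dots> = (real k - 1) * ((1 + \<eta>) * real n / real k)"
  proof -
    have "card ({1..k} - {i}) = k - 1" using i by simp
    then show ?thesis using k by (simp add: of_nat_diff)
  qed
  finally have "real n \<le> ?N i + (real k - 1) * ((1 + \<eta>) * real n / real k)" by simp
  moreover have "real n - (real k - 1) * ((1 + \<eta>) * real n / real k) = (1 - (real k - 1) * \<eta>) * real n / real k"
    using k by (simp add: field_simps)
  ultimately show ?thesis by linarith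
qed

text \<open>Cauchy-Schwarz. Read for \<tau> instead of \<sigma> it is a lower bound on the squared
  class sizes of the second colouring.\<close>

lemma card_cross_pairs_le':
  assumes "\<sigma> \<in> vcolorings n k" "k > 0"
  shows "2 * real (card (cross_pairs n \<sigma>)) \<le> (1 - 1 / real k) * (real n)\<^sup>2"
proof -
  have "(real n)\<^sup>2 \<le> real k * (\<Sum>i=1..k. (csize n \<sigma> i)\<^sup>2)"
    using sum_squared_le_sum_of_squares[of "\<lambda>i. csize n \<sigma> i" "{1..k}"] sum_community[OF assms(1)]
    by (simp add: mult.commute flip: of_nat_sum)
  then have "(real n)\<^sup>2 / real k \<le> (\<Sum>i=1..k. (csize n \<sigma> i)\<^sup>2)"
    using assms(2) by (simp add: field_simps)
  then show ?thesis using card_cross_pairs[OF assms(1)] by (simp add: algebra_simps)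
qed

lemma card_color_triples:
  assumes "\<sigma> \<in> vcolorings n 4"
  shows "card (double_indices n 4 \<sigma>) \<le> 3 * n"
proof -
  define F where "F v = {(c, c'). c \<in> {1..4} \<and> c' \<in> {1..4} \<and> c < c' \<and> c \<noteq> \<sigma> v \<and> c' \<noteq> \<sigma> v}" for v
  have F: "finite (F v) \<and> card (F v) \<le> 3" if "v \<in> {1..n}" for v
  proof -
    have s: "\<sigma> v \<in> {1..4}" using vcoloringsD[OF assms] that by blast
    define G where "G = {1, 2, 3, 4} - {\<sigma> v}"
    have four: "{1..4::nat} = {1, 2, 3, 4}" by auto
    have fG: "finite G" by (simp add: G_def)
    have cG: "card G = 3" using s unfolding four by (auto simp: G_def)
    have sub: "(\<lambda>(c, c'). {c, c'}) ` F v \<subseteq> {X. X \<subseteq> G \<and> card X = 2}"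
      unfolding F_def G_def four by auto
    have inj: "inj_on (\<lambda>(c, c'). {c, c'}) (F v)"
      unfolding F_def by (auto simp: inj_on_def doubleton_eq_iff)
    have fX: "finite {X. X \<subseteq> G \<and> card X = 2}" using fG by simp
    have "card (F v) \<le> card {X. X \<subseteq> G \<and> card X = 2}"
      by (rule card_inj_on_le[OF inj sub fX])
    also have "\<dots> = 3 choose 2" using n_subsets[OF fG, of 2] cG by simp
    also have "\<dots> = 3" by (simp add: choose_two)
    finally have "card (F v) \<le> 3" .
    moreover have "finite (F v)" using inj_on_finite[OF inj sub fX] .
    ultimately show ?thesis by simp
  qed
  have "double_indices n 4 \<sigma> = Sigma {1..n} F"
    unfolding F_def double_indices_def by blast
  moreover have "card (Sigma {1..n} F) = (\<Sum>v=1..n. card (F v))"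
    using F by (intro card_SigmaI) auto
  moreover have "(\<Sum>v=1..n. card (F v)) \<le> (\<Sum>v=1..n. 3)"
    using F by (intro sum_mono) blast
  ultimately show ?thesis by simp
qed

lemma card_edge_triples:
  assumes "\<sigma> \<in> vcolorings n 4"
  shows "card (edge_indices n 4 \<sigma>)
    \<le> 2 * card (cross_pairs n \<sigma>)"
proof -
  define Q where "Q = {(v, w). v \<in> {1..n} \<and> w \<in> {1..n} \<and> v < w \<and> \<sigma> v \<noteq> \<sigma> w}"
  define F where "F = (\<lambda>(v, w). {1..4} - {\<sigma> v, \<sigma> w})"
  have Qsub: "(\<lambda>(v, w). {v, w}) ` Q \<subseteq> cross_pairs n \<sigma>"
  proof
    fix e assume "e \<in> (\<lambda>(v, w). {v, w}) ` Q"
    then obtain v w where "e = {v, w}" "(v, w) \<in> Q" by auto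
    then show "e \<in> cross_pairs n \<sigma>"
      by (simp add: cross_pairs_def pair_in_vertex_pairs Q_def)
  qed
  have inj: "inj_on (\<lambda>(v, w). {v, w}) Q"
    unfolding Q_def by (auto simp: inj_on_def doubleton_eq_iff)
  have finQ: "finite Q" using inj_on_finite[OF inj Qsub] by simp
  have cQ: "card Q \<le> card (cross_pairs n \<sigma>)" using card_inj_on_le[OF inj Qsub] by simp
  have F: "card (F x) = 2" if xQ: "x \<in> Q" for x
  proof -
    obtain v w where x: "x = (v, w)" by (cases x)
    have h: "v \<in> {1..n}" "w \<in> {1..n}" "\<sigma> v \<noteq> \<sigma> w" using xQ by (simp_all add: x Q_def)
    then have s: "{\<sigma> v, \<sigma> w} \<subseteq> {1..4}" using vcoloringsD[OF assms] by blast
    have "card ({1..4} - {\<sigma> v, \<sigma> w}) = card {1..4::nat} - card {\<sigma> v, \<sigma> w}"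
      using s by (intro card_Diff_subset) auto
    also have "\<dots> = 2" using h by simp
    finally show ?thesis by (simp add: F_def x)
  qed
  have "edge_indices n 4 \<sigma>
      = (\<lambda>((v, w), c). (v, w, c)) ` Sigma Q F"
    unfolding Q_def F_def edge_indices_def by (auto simp: image_iff)
  moreover have "card ((\<lambda>((v, w), c). (v, w, c)) ` Sigma Q F) \<le> card (Sigma Q F)"
    using finQ by (intro card_image_le finite_SigmaI) (auto simp: F_def)
  moreover have "card (Sigma Q F) = (\<Sum>x\<in>Q. card (F x))"
    using finQ by (intro card_SigmaI) (auto simp: F_def)
  ultimately show ?thesis using F cQ by simp
qed

lemma prob_ge_complement:
  assumes "\<And>x. x \<in> set_pmf p \<Longrightarrow> x \<notin> G \<Longrightarrow> x \<in> B"
  shows "pr p G \<ge> 1 - pr p B"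
proof -
  have "1 = pr p (set_pmf p)" by (simp add: measure_pmf.prob_eq_1 AE_measure_pmf)
  also have "\<dots> \<le> pr p (G \<union> B)"
    using assms by (intro measure_pmf.finite_measure_mono) auto
  also have "\<dots> \<le> pr p G + pr p B"
    by (intro measure_Un_le) auto
  finally show ?thesis by simp
qed

lemma prob_Un3_le:
  "pr p (A \<union> B \<union> C) \<le> pr p A + pr p B + pr p C"
  using measure_Un_le[of "A \<union> B" "measure_pmf p" C] measure_Un_le[of A "measure_pmf p" B] by simp

text \<open>Every vertex has three other colours, each with at most
  \<open>(1 + \<eta>) * n / 4\<close> vertices, and \<open>b * (1 + \<eta>) = 12\<close> gives
  exactly the exponent 3. The correction \<open>72 / n\<close> bounds \<open>6 * q\<close>, the
  effect of the quadratic term of \<open>ln (1 - q)\<close>; \<open>n \<ge> 96\<close> keeps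
  \<open>q \<le> 1/2\<close>.\<close>

lemma free_slots_mean:
  assumes \<eta>: "0 < \<eta>" "\<eta> < 1/3" and bal: "balanced \<eta> n 4 \<sigma>" and n: "real n \<ge> 96"
  defines "b \<equiv> 12 / (1 + \<eta>)"
  shows "(\<Sum>(v, c)\<in>slot_indices n 4 \<sigma>. (1 - b / real n) ^ card (community n \<sigma> c))
    \<ge> 3 * exp (- 3 - 72 / real n) * real n"
proof -
  have b: "0 \<le> b" "b \<le> 12" "b * (1 + \<eta>) = 12" using \<eta> by (auto simp: b_def field_simps)
  define q where "q = b / real n"
  have q: "0 \<le> q" "q \<le> 1/2" using b n by (auto simp: q_def field_simps)
  have qn: "q * real n = b" using n by (simp add: q_def)
  have \<sigma>: "\<sigma> \<in> vcolorings n 4" using bal by (simp add: balanced_def)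
  have each: "exp (- 3 - 72 / real n) \<le> (1 - q) ^ card (community n \<sigma> c)" if c: "c \<in> {1..4}" for c
  proof -
    define N where "N = card (community n \<sigma> c)"
    have "- q - 2 * q\<^sup>2 \<le> ln (1 - q)" using q by (rule ln_one_minus_pos_lower_bound)
    then have "exp (- (q + 2 * q\<^sup>2)) \<le> exp (ln (1 - q))" by simp
    then have 1: "exp (- (q + 2 * q\<^sup>2)) \<le> 1 - q" using q by simp
    have N: "real N \<le> (1 + \<eta>) * real n / 4" using bal c unfolding balanced_def N_def by simp
    have "(q + 2 * q\<^sup>2) * real N \<le> (q + 2 * q\<^sup>2) * ((1 + \<eta>) * real n / 4)"
      using N q by (intro mult_left_mono) auto
    also have "\<dots> = (q * real n) * (1 + \<eta>) / 4 * (1 + 2 * q)" by (simp add: power2_eq_square algebra_simps)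
    also have "\<dots> = 3 * (1 + 2 * q)" using b(3) by (simp add: qn)
    also have "\<dots> \<le> 3 + 72 / real n" using b n by (simp add: q_def field_simps)
    finally have "exp (- 3 - 72 / real n) \<le> exp (real N * (- (q + 2 * q\<^sup>2)))"
      by (simp add: algebra_simps)
    also have "\<dots> = exp (- (q + 2 * q\<^sup>2)) ^ N" by (rule exp_of_nat_mult)
    also have "\<dots> \<le> (1 - q) ^ N" using 1 by (intro power_mono) auto
    finally show ?thesis by (simp add: N_def)
  qed
  define J where "J = slot_indices n 4 \<sigma>"
  have "J = Sigma {1..n} (\<lambda>v. {1..4} - {\<sigma> v})" unfolding J_def slot_indices_def by blast
  then have "card J = (\<Sum>v=1..n. card ({1..4} - {\<sigma> v}))" by simp
  also have "\<dots> = (\<Sum>v=1..n. 3)"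
  proof (intro sum.cong refl)
    fix v assume "v \<in> {1..n}"
    then have "\<sigma> v \<in> {1..4}" using vcoloringsD[OF \<sigma>] by blast
    then show "card ({1..4} - {\<sigma> v}) = 3" by simp
  qed
  finally have cJ: "card J = 3 * n" by simp
  have "3 * exp (- 3 - 72 / real n) * real n = (\<Sum>j\<in>J. exp (- 3 - 72 / real n))" by (simp add: cJ)
  also have "\<dots> \<le> (\<Sum>(v, c)\<in>J. (1 - q) ^ card (community n \<sigma> c))"
    unfolding J_def slot_indices_def using each by (intro sum_mono) auto
  finally show ?thesis by (simp add: J_def q_def)
qed

text \<open>By \<open>balanced_lower\<close> two classes together have at least
  \<open>(1 - 3 * \<eta>) * n / 2\<close> vertices. The classes may coincide: a double slot misses
  two classes from one vertex, an edge slot one class from two vertices.\<close>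

lemma slot_power_le:
  assumes \<eta>: "0 < \<eta>" "\<eta> < 1/3" and bal: "balanced \<eta> n 4 \<sigma>" and n: "real n \<ge> 96"
    and c: "c \<in> {1..4}" "c' \<in> {1..4}"
  defines "b \<equiv> 12 / (1 + \<eta>)"
  shows "(1 - b / real n) ^ (card (community n \<sigma> c) + card (community n \<sigma> c'))
    \<le> exp (- 6 * (1 - 3 * \<eta>) / (1 + \<eta>))"
proof -
  have b: "0 \<le> b" "b \<le> 12" using \<eta> by (auto simp: b_def field_simps)
  define q where "q = b / real n"
  have q: "0 \<le> q" "q \<le> 1/2" using b n by (auto simp: q_def field_simps)
  define N where "N = card (community n \<sigma> c) + card (community n \<sigma> c')"
  have "(1 - 3 * \<eta>) * real n / 2 \<le> real N"
    using balanced_lower[OF bal c(1)] balanced_lower[OF bal c(2)] by (simp add: N_def field_simps)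
  then have "q * ((1 - 3 * \<eta>) * real n / 2) \<le> q * real N" using q by (intro mult_left_mono) auto
  moreover have "q * ((1 - 3 * \<eta>) * real n / 2) = 6 * (1 - 3 * \<eta>) / (1 + \<eta>)"
  proof -
    have "q * real n = b" using n by (simp add: q_def)
    then have "q * ((1 - 3 * \<eta>) * real n / 2) = b * (1 - 3 * \<eta>) / 2" by (simp add: mult_ac)
    moreover have "12 / x * y / 2 = 6 * y / x" for x y :: real by simp
    ultimately show ?thesis unfolding b_def by (simp only:)
  qed
  ultimately have *: "6 * (1 - 3 * \<eta>) / (1 + \<eta>) \<le> q * real N" by (simp only:)
  have "1 - q \<le> exp (- q)" using exp_ge_add_one_self[of "- q"] by simp
  then have "(1 - q) ^ N \<le> exp (- q) ^ N" using q by (intro power_mono) auto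
  also have "\<dots> = exp (- (q * real N))" by (simp add: mult.commute flip: exp_of_nat_mult)
  also have "\<dots> \<le> exp (- (6 * (1 - 3 * \<eta>) / (1 + \<eta>)))" using * by simp
  also have "- (6 * (1 - 3 * \<eta>) / (1 + \<eta>)) = - 6 * (1 - 3 * \<eta>) / (1 + \<eta>)"
    by (simp only: minus_divide_left mult_minus_left)
  finally show ?thesis unfolding N_def q_def .
qed

lemma double_slots_mean:
  assumes \<eta>: "0 < \<eta>" "\<eta> < 1/3" and bal: "balanced \<eta> n 4 \<sigma>" and n: "real n \<ge> 96"
  defines "b \<equiv> 12 / (1 + \<eta>)"
  shows "(\<Sum>(v, c, c')\<in>double_indices n 4 \<sigma>.
          (1 - b / real n) ^ (card (community n \<sigma> c) + card (community n \<sigma> c')))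
    \<le> 3 * exp (- 6 * (1 - 3 * \<eta>) / (1 + \<eta>)) * real n"
proof -
  define J where "J = double_indices n 4 \<sigma>"
  have \<sigma>: "\<sigma> \<in> vcolorings n 4" using bal by (simp add: balanced_def)
  have cJ: "card J \<le> 3 * n" unfolding J_def by (rule card_color_triples[OF \<sigma>])
  have "(\<Sum>(v, c, c')\<in>J. (1 - b / real n) ^ (card (community n \<sigma> c) + card (community n \<sigma> c')))
      \<le> (\<Sum>j\<in>J. exp (- 6 * (1 - 3 * \<eta>) / (1 + \<eta>)))"
    unfolding J_def double_indices_def b_def using slot_power_le[OF \<eta> bal n] by (intro sum_mono) auto
  also have "\<dots> = real (card J) * exp (- 6 * (1 - 3 * \<eta>) / (1 + \<eta>))" by simp
  also have "\<dots> \<le> real (3 * n) * exp (- 6 * (1 - 3 * \<eta>) / (1 + \<eta>))"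
    using cJ by (intro mult_right_mono) (simp_all only: of_nat_le_iff exp_ge_zero)
  finally show ?thesis by (simp add: J_def mult_ac)
qed

lemma edge_slots_mean:
  assumes \<eta>: "0 < \<eta>" "\<eta> < 1/3" and bal: "balanced \<eta> n 4 \<sigma>" and n: "real n \<ge> 96"
  defines "b \<equiv> 12 / (1 + \<eta>)"
  shows "(\<Sum>(v, w, c)\<in>edge_indices n 4 \<sigma>.
          b / real n * (1 - b / real n) ^ (2 * card (community n \<sigma> c)))
    \<le> 9 * exp (- 6 * (1 - 3 * \<eta>) / (1 + \<eta>)) * real n"
proof -
  define J where "J = edge_indices n 4 \<sigma>"
  define X where "X = exp (- 6 * (1 - 3 * \<eta>) / (1 + \<eta>))"
  have b: "0 \<le> b" "b \<le> 12" using \<eta> by (auto simp: b_def field_simps)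
  have \<sigma>: "\<sigma> \<in> vcolorings n 4" using bal by (simp add: balanced_def)
  have "real (card J) \<le> 2 * real (card (cross_pairs n \<sigma>))"
    using card_edge_triples[OF \<sigma>] unfolding J_def by linarith
  also have "\<dots> \<le> 3/4 * (real n)\<^sup>2" using card_cross_pairs_le'[OF \<sigma>] by simp
  finally have cJ: "real (card J) \<le> 3/4 * (real n)\<^sup>2" .
  have "(\<Sum>(v, w, c)\<in>J. b / real n * (1 - b / real n) ^ (2 * card (community n \<sigma> c)))
      \<le> (\<Sum>j\<in>J. b / real n * X)"
  proof (intro sum_mono)
    fix j assume jJ: "j \<in> J"
    obtain v w c where j: "j = (v, w, c)" by (cases j)
    have c: "c \<in> {1..4}" using jJ by (simp add: j J_def edge_indices_def)
    have "(1 - b / real n) ^ (2 * card (community n \<sigma> c)) \<le> X"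
      using slot_power_le[OF \<eta> bal n c c] by (simp add: X_def b_def mult_2)
    then have "b / real n * (1 - b / real n) ^ (2 * card (community n \<sigma> c)) \<le> b / real n * X"
      using b by (intro mult_left_mono) auto
    then show "(case j of (v, w, c) \<Rightarrow> b / real n * (1 - b / real n) ^ (2 * card (community n \<sigma> c))) \<le> b / real n * X"
      by (simp only: j prod.case)
  qed
  also have "\<dots> = real (card J) * (b / real n * X)" by simp
  also have "\<dots> \<le> 3/4 * (real n)\<^sup>2 * (b / real n * X)"
    using cJ b by (intro mult_right_mono) (auto simp: X_def)
  also have "\<dots> = 3/4 * b * (X * real n)" using n by (simp add: power2_eq_square)
  \<comment> \<open>The factor 9 is \<open>3/4 * 12\<close>: at most \<open>3/8 * n^2\<close> cross
    pairs, two remaining colours each, and edge probability at most \<open>12 / n\<close>.\<close>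
  also have "\<dots> \<le> 3/4 * 12 * (X * real n)"
    using b by (intro mult_right_mono mult_left_mono) (auto simp: X_def)
  finally show ?thesis by (simp add: J_def X_def mult_ac)
qed

text \<open>The rate of \<open>2 ^ x * (3/4) ^ y\<close>. The 12 adds 3 from double slots and 9 from
  edge slots. In \<open>x\<close> one \<eta> pays for the limit of the mean and one for the
  deviation; in \<open>y\<close> there is one \<eta> for the deviation of each kind of
  conflict.\<close>

definition planted_entropy :: "real \<Rightarrow> real" where
  "planted_entropy \<eta> = ln 2 * (3 * exp (- 3) - 2 * \<eta>)
     - ln (4 / 3) * (12 * exp (- 6 * (1 - 3 * \<eta>) / (1 + \<eta>)) + 2 * \<eta>)"

lemma many_proper_colorings:
  assumes \<eta>: "0 < \<eta>" "\<eta> < 1/3"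
  defines "b \<equiv> 12 / (1 + \<eta>)"
  shows "\<exists>C. \<forall>\<^sub>F n in sequentially. \<forall>\<sigma>. balanced \<eta> n 4 \<sigma> \<longrightarrow>
    pr (edges_pmf n 0 b \<sigma>)
      {E. exp (planted_entropy \<eta> * real n) \<le> real (card (proper_colorings n 4 E))} \<ge> 1 - C / real n"
proof -
  have b: "0 \<le> b" "b \<le> 12" using \<eta> by (auto simp: b_def field_simps)
  define X where "X = exp (- 6 * (1 - 3 * \<eta>) / (1 + \<eta>))"
  define C1 where "C1 = (8 * b * (real 4)\<^sup>2 + (real 4)\<^sup>2) / \<eta>\<^sup>2"
  define C2 where "C2 = (8 * b * (real (4 * 4))\<^sup>2 + (real (4 * 4))\<^sup>2) / \<eta>\<^sup>2"
  define C3 where "C3 = (8 * b * (b * real 4)\<^sup>2 + (real 4)\<^sup>2 * (b + 4 * b\<^sup>2)) / \<eta>\<^sup>2"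
  have "(\<lambda>n. 3 * exp (- 3 - 72 / real n)) \<longlonglongrightarrow> 3 * exp (- 3 - 0)"
    by (intro tendsto_intros lim_const_over_n)
  then have ev: "\<forall>\<^sub>F n in sequentially. 3 * exp (- 3 - 72 / real n) > 3 * exp (- 3) - \<eta>"
    by (rule order_tendstoD) (use \<eta> in simp)
  have "\<forall>\<^sub>F n in sequentially. \<forall>\<sigma>. balanced \<eta> n 4 \<sigma> \<longrightarrow>
    pr (edges_pmf n 0 b \<sigma>)
      {E. exp (planted_entropy \<eta> * real n) \<le> real (card (proper_colorings n 4 E))} \<ge> 1 - (C1 + C2 + C3) / real n"
    using ev eventually_ge_at_top[of 96]
  proof eventually_elim
    case (elim n)
    show ?case
    proof (intro allI impI)
      fix \<sigma> assume bal: "balanced \<eta> n 4 \<sigma>"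
      then have \<sigma>: "\<sigma> \<in> vcolorings n 4" by (simp add: balanced_def)
      have n: "real n \<ge> 96" "n > 0" "8 * b \<le> real n" using elim b by auto
      let ?M = "edges_pmf n 0 b \<sigma>"
      define \<mu>1 where "\<mu>1 = (\<Sum>(v, c)\<in>slot_indices n 4 \<sigma>. (1 - b / real n) ^ card (community n \<sigma> c))"
      define \<mu>2 where "\<mu>2 = (\<Sum>(v, c, c')\<in>double_indices n 4 \<sigma>.
          (1 - b / real n) ^ (card (community n \<sigma> c) + card (community n \<sigma> c')))"
      define \<mu>3 where "\<mu>3 = (\<Sum>(v, w, c)\<in>edge_indices n 4 \<sigma>.
          b / real n * (1 - b / real n) ^ (2 * card (community n \<sigma> c)))"
      define B1 where "B1 = {E. \<eta> * real n \<le> \<bar>real (card (free_slots n 4 \<sigma> E)) - \<mu>1\<bar>}"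
      define B2 where "B2 = {E. \<eta> * real n \<le> \<bar>real (card (double_slots n 4 \<sigma> E)) - \<mu>2\<bar>}"
      define B3 where "B3 = {E. \<eta> * real n \<le> \<bar>real (card (edge_slots n 4 \<sigma> E)) - \<mu>3\<bar>}"
      have p1: "pr ?M B1 \<le> C1 / real n"
        unfolding B1_def \<mu>1_def C1_def by (rule free_slots_concentration[OF b(1) n(3,2) \<eta>(1)])
      have p2: "pr ?M B2 \<le> C2 / real n"
        unfolding B2_def \<mu>2_def C2_def by (rule double_slots_concentration[OF b(1) n(3,2) \<eta>(1)])
      have p3: "pr ?M B3 \<le> C3 / real n"
        unfolding B3_def \<mu>3_def C3_def by (rule edge_slots_concentration[OF b(1) n(3,2) \<eta>(1)])
      have m1: "(3 * exp (- 3) - \<eta>) * real n \<le> \<mu>1"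
      proof -
        have "(3 * exp (- 3) - \<eta>) * real n \<le> 3 * exp (- 3 - 72 / real n) * real n"
          using elim(1) by (intro mult_right_mono) auto
        also have "\<dots> \<le> \<mu>1"
          unfolding \<mu>1_def b_def by (rule free_slots_mean[OF \<eta> bal n(1)])
        finally show ?thesis .
      qed
      have m2: "\<mu>2 \<le> 3 * X * real n"
        unfolding \<mu>2_def b_def X_def by (rule double_slots_mean[OF \<eta> bal n(1)])
      have m3: "\<mu>3 \<le> 9 * X * real n"
        unfolding \<mu>3_def b_def X_def by (rule edge_slots_mean[OF \<eta> bal n(1)])
      have good: "exp (planted_entropy \<eta> * real n) \<le> real (card (proper_colorings n 4 E))"
        if E: "E \<in> set_pmf ?M" "E \<notin> B1" "E \<notin> B2" "E \<notin> B3" for E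
      proof -
        define x where "x = card (free_slots n 4 \<sigma> E)"
        define y where "y = card (double_slots n 4 \<sigma> E) + card (edge_slots n 4 \<sigma> E)"
        have x: "(3 * exp (- 3) - 2 * \<eta>) * real n \<le> real x"
        proof -
          have "\<mu>1 - \<eta> * real n \<le> real x" using E(2) unfolding B1_def x_def by simp
          then show ?thesis using m1 by (simp add: algebra_simps)
        qed
        have y: "real y \<le> (12 * X + 2 * \<eta>) * real n"
        proof -
          have "real (card (double_slots n 4 \<sigma> E)) \<le> \<mu>2 + \<eta> * real n" using E(3) unfolding B2_def by simp
          moreover have "real (card (edge_slots n 4 \<sigma> E)) \<le> \<mu>3 + \<eta> * real n" using E(4) unfolding B3_def by simp
          ultimately show ?thesis using m2 m3 by (simp add: y_def algebra_simps)
        qed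
        have l34: "ln (3 / 4 :: real) = - ln (4 / 3)" by (simp add: ln_div)
        have "ln 2 * ((3 * exp (- 3) - 2 * \<eta>) * real n) \<le> ln 2 * real x"
          using x by (intro mult_left_mono) auto
        moreover have "ln (4/3) * real y \<le> ln (4/3) * ((12 * X + 2 * \<eta>) * real n)"
          using y by (intro mult_left_mono) auto
        ultimately have "planted_entropy \<eta> * real n \<le> real x * ln 2 + real y * ln (3 / 4)"
          unfolding l34 planted_entropy_def X_def[symmetric] by (simp add: algebra_simps)
        then have "exp (planted_entropy \<eta> * real n) \<le> exp (real x * ln 2 + real y * ln (3 / 4))" by simp
        also have "\<dots> = 2 ^ x * (3 / 4) ^ y" by (simp add: exp_add exp_of_nat_mult)
        also have "\<dots> \<le> real (card (proper_colorings n 4 E))"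
          unfolding x_def y_def by (rule card_proper_colorings_ge[OF \<sigma> set_edges_pmf_planted[OF E(1)]])
        finally show ?thesis .
      qed
      have "1 - (C1 + C2 + C3) / real n \<le> 1 - pr ?M (B1 \<union> B2 \<union> B3)"
        using prob_Un3_le[of ?M B1 B2 B3] p1 p2 p3 by (simp add: add_divide_distrib)
      also have "\<dots> \<le> pr ?M {E. exp (planted_entropy \<eta> * real n) \<le> real (card (proper_colorings n 4 E))}"
        using good by (intro prob_ge_complement) auto
      finally show "1 - (C1 + C2 + C3) / real n
          \<le> pr ?M {E. exp (planted_entropy \<eta> * real n) \<le> real (card (proper_colorings n 4 E))}" .
    qed
  qed
  then show ?thesis by blast
qed

section \<open>Entropy inequalities\<close>

text \<open>The first two terms of the series of \<open>2 * artanh s\<close>; the derivative of the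
  remainder is \<open>2 * x^4 / (1 - x^2)\<close>. It yields both the quartic entropy bound and the
  numerical bounds on logarithms.\<close>

lemma artanh_lower:
  fixes s :: real
  assumes "0 \<le> s" "s < 1"
  shows "2 * s + 2/3 * s ^ 3 \<le> ln (1 + s) - ln (1 - s)"
proof -
  define g where "g = (\<lambda>s::real. ln (1 + s) - ln (1 - s) - 2 * s - 2/3 * s ^ 3)"
  have "g 0 \<le> g s"
  proof (rule DERIV_nonneg_imp_nondecreasing[OF assms(1)])
    fix x assume x: "0 \<le> x" "x \<le> s"
    then have x1: "x < 1" using assms by simp
    have "(g has_real_derivative 1 / (1 + x) + 1 / (1 - x) - 2 - 2 * x ^ 2) (at x)"
      unfolding g_def using x x1 by (auto intro!: derivative_eq_intros simp: power2_eq_square)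
    moreover have "1 / (1 + x) + 1 / (1 - x) - 2 - 2 * x ^ 2 = 2 * x ^ 4 / ((1 + x) * (1 - x))"
    proof -
      have "1 / (1 + x) + 1 / (1 - x) = 2 / ((1 + x) * (1 - x))"
        using x x1 by (simp add: add_frac_eq)
      moreover have "2 + 2 * x ^ 2 = (2 - 2 * x ^ 4) / ((1 + x) * (1 - x))"
        using x x1 by (simp add: eq_divide_eq) (simp add: power2_eq_square power4_eq_xxxx algebra_simps)
      ultimately show ?thesis by (simp add: diff_divide_distrib)
    qed
    moreover have "2 * x ^ 4 / ((1 + x) * (1 - x)) \<ge> 0" using x x1 by simp
    ultimately show "\<exists>y. (g has_real_derivative y) (at x) \<and> 0 \<le> y" by metis
  qed
  then show ?thesis by (simp add: g_def)
qed

text \<open>Integrates \<open>artanh_lower\<close>. Pinsker's bound is the term \<open>s^2\<close>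
  alone; the quartic term is what \<open>half_row_bound\<close> needs.\<close>

lemma binary_entropy_aux:
  fixes s :: real
  assumes "\<bar>s\<bar> \<le> 1"
  shows "s ^ 2 + s ^ 4 / 6 \<le> (1 + s) * ln (1 + s) + (1 - s) * ln (1 - s)"
proof -
  have pos: "s ^ 2 + s ^ 4 / 6 \<le> (1 + s) * ln (1 + s) + (1 - s) * ln (1 - s)"
    if "0 \<le> s" "s < 1" for s :: real
  proof -
    define g where "g = (\<lambda>s::real. (1 + s) * ln (1 + s) + (1 - s) * ln (1 - s) - s ^ 2 - s ^ 4 / 6)"
    have "g 0 \<le> g s"
    proof (rule DERIV_nonneg_imp_nondecreasing[OF that(1)])
      fix x assume x: "0 \<le> x" "x \<le> s"
      then have x1: "x < 1" using that by simp
      have "(g has_real_derivative ln (1 + x) - ln (1 - x) - 2 * x - 2/3 * x ^ 3) (at x)"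
        unfolding g_def using x x1 by (auto intro!: derivative_eq_intros)
      moreover have "0 \<le> ln (1 + x) - ln (1 - x) - 2 * x - 2/3 * x ^ 3"
        using artanh_lower[OF x(1) x1] by simp
      ultimately show "\<exists>y. (g has_real_derivative y) (at x) \<and> 0 \<le> y" by metis
    qed
    then show ?thesis by (simp add: g_def)
  qed
  \<comment> \<open>The derivative argument does not reach \<open>s = 1\<close> or
    \<open>s = - 1\<close>. There \<open>0 * ln 0 = 0\<close>, and the claim is this
    inequality.\<close>
  have one: "7/6 \<le> 2 * ln (2::real)" using ln2_ge_two_thirds by simp
  consider "\<bar>s\<bar> = 1" | "0 \<le> s" "s < 1" | "0 \<le> - s" "- s < 1" using assms by linarith
  then show ?thesis
  proof cases
    case 1
    then have "s = 1 \<or> s = - 1" by linarith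
    then show ?thesis using one by auto
  next
    case 2
    then show ?thesis by (rule pos)
  next
    case 3
    then show ?thesis using pos[of "- s"] by simp
  qed
qed

lemma two_point_entropy:
  fixes x y \<rho> s :: real
  assumes "0 \<le> x" "0 \<le> y" and \<rho>: "x + y = \<rho>" "\<rho> > 0" and s: "s = (x - y) / \<rho>"
  shows "- x * ln x - y * ln y \<le> - \<rho> * ln \<rho> + \<rho> * ln 2 - \<rho> * (s ^ 2 / 2 + s ^ 4 / 12)"
proof -
  have "\<rho> * s = x - y" using \<rho>(2) by (simp add: s)
  then have x: "x = \<rho> / 2 * (1 + s)" and y: "y = \<rho> / 2 * (1 - s)"
    using \<rho>(1) by (simp_all add: field_simps)
  have s1: "\<bar>s\<bar> \<le> 1" using assms unfolding s by (simp add: abs_le_iff field_simps)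
  have mul: "z * ln z = \<rho> / 2 * (t * ln t + t * ln (\<rho> / 2))" if "z = \<rho> / 2 * t" "0 \<le> t" for z t
  proof (cases "t = 0")
    case False
    then have "ln z = ln (\<rho> / 2) + ln t"
      unfolding that(1) using that(2) \<rho> by (intro ln_mult_pos) auto
    then have "z * ln z = z * (ln (\<rho> / 2) + ln t)" by (simp only:)
    also have "\<dots> = \<rho> / 2 * t * (ln (\<rho> / 2) + ln t)" by (simp only: that(1))
    finally show ?thesis by (simp add: algebra_simps)
  qed (simp add: that)
  have "x * ln x + y * ln y
      = \<rho> / 2 * ((1 + s) * ln (1 + s) + (1 - s) * ln (1 - s)) + \<rho> * ln (\<rho> / 2)"
  proof -
    have "0 \<le> 1 + s" "0 \<le> 1 - s" using s1 by auto
    then show ?thesis using mul[OF x] mul[OF y] by (simp add: algebra_simps)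
  qed
  also have "\<dots> \<ge> \<rho> / 2 * (s ^ 2 + s ^ 4 / 6) + \<rho> * ln (\<rho> / 2)"
    using binary_entropy_aux[OF s1] \<rho> by (intro add_right_mono mult_left_mono) auto
  finally have "\<rho> / 2 * (s ^ 2 + s ^ 4 / 6) + \<rho> * ln (\<rho> / 2) \<le> x * ln x + y * ln y" .
  moreover have "ln (\<rho> / 2) = ln \<rho> - ln 2" using \<rho> by (simp add: ln_div)
  ultimately show ?thesis by (simp add: algebra_simps)
qed

text \<open>Let \<open>\<rho> = x + y\<close> and \<open>s = (x - y) / \<rho>\<close>. The energy
  exceeds the quadratic entropy loss by \<open>\<rho> * d * s^2\<close>, which is positive when the
  half is overweight; the quartic loss absorbs it because
  \<open>d * s^2 - s^4/12 \<le> 3 * d^2\<close>, by completing the square.\<close>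

lemma half_row_bound:
  fixes x y :: real
  assumes "0 \<le> x" "0 \<le> y" and d: "d = x + y - 1/2"
  shows "- x * ln x - y * ln y + 2 * (x ^ 2 + y ^ 2)
    \<le> - (x + y) * ln (x + y) + (x + y) * ln 2 + (x + y) ^ 2 + 3 * (x + y) * d ^ 2"
proof (cases "x + y = 0")
  case True
  then have "x = 0" "y = 0" using assms by linarith+
  then show ?thesis by simp
next
  case False
  define \<rho> where "\<rho> = x + y"
  define s where "s = (x - y) / \<rho>"
  have \<rho>: "\<rho> > 0" using False assms by (simp add: \<rho>_def)
  have ent: "- x * ln x - y * ln y \<le> - \<rho> * ln \<rho> + \<rho> * ln 2 - \<rho> * (s ^ 2 / 2 + s ^ 4 / 12)"
    by (rule two_point_entropy) (use assms \<rho> in \<open>auto simp: s_def \<rho>_def\<close>)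
  have "\<rho> * s = x - y" using \<rho> by (simp add: s_def)
  then have "x = \<rho> / 2 * (1 + s)" and "y = \<rho> / 2 * (1 - s)"
    using \<rho>_def by (simp_all add: field_simps)
  then have sq: "2 * (x ^ 2 + y ^ 2) = \<rho> ^ 2 * (1 + s ^ 2)"
    by (simp only:) (simp add: power2_eq_square field_simps)
  have "0 \<le> \<rho> * (s ^ 2 - 6 * d) ^ 2 / 12" using \<rho> by simp
  then have "\<rho> * (\<rho> * s ^ 2 - s ^ 2 / 2 - s ^ 4 / 12) \<le> \<rho> * (3 * d ^ 2)"
    unfolding d \<rho>_def[symmetric] by (simp add: power2_eq_square power4_eq_xxxx algebra_simps)
  then show ?thesis using ent sq unfolding \<rho>_def[symmetric]
    by (simp add: power2_eq_square algebra_simps)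
qed

text \<open>Given the mass of the first two colours, the quartic term of the binary entropy pays for the
  excess of the quadratic term over the Pinsker bound.\<close>

lemma four_color_row_bound:
  fixes p :: "nat \<Rightarrow> real"
  assumes nn: "\<And>c. c \<in> {1..4} \<Longrightarrow> 0 \<le> p c" and sum1: "(\<Sum>c=1..4. p c) = 1" and d: "d = p 1 + p 2 - 1/2"
  shows "(\<Sum>c=1..4. - p c * ln (p c) + 2 * p c ^ 2) \<le> ln 4 + 1/2 + 3 * d ^ 2"
proof -
  have set4: "{1..4::nat} = {1, 2, 3, 4}" by auto
  define \<rho> where "\<rho> = p 1 + p 2"
  have \<rho>': "p 3 + p 4 = 1 - \<rho>" using sum1 unfolding set4 by (simp add: \<rho>_def)
  have p: "0 \<le> p 1" "0 \<le> p 2" "0 \<le> p 3" "0 \<le> p 4" using nn by auto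
  have \<rho>01: "0 \<le> \<rho>" "0 \<le> 1 - \<rho>" using p \<rho>' by (auto simp: \<rho>_def)
  have d': "- d = p 3 + p 4 - 1/2" using \<rho>' by (simp add: d \<rho>_def)
  have A: "- p 1 * ln (p 1) - p 2 * ln (p 2) + 2 * (p 1 ^ 2 + p 2 ^ 2)
    \<le> - \<rho> * ln \<rho> + \<rho> * ln 2 + \<rho> ^ 2 + 3 * \<rho> * d ^ 2"
    using half_row_bound[OF p(1,2) d] by (simp add: \<rho>_def)
  have B: "- p 3 * ln (p 3) - p 4 * ln (p 4) + 2 * (p 3 ^ 2 + p 4 ^ 2)
    \<le> - (1 - \<rho>) * ln (1 - \<rho>) + (1 - \<rho>) * ln 2 + (1 - \<rho>) ^ 2 + 3 * (1 - \<rho>) * d ^ 2"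
    using half_row_bound[OF p(3,4) d'] by (simp add: \<rho>')
  \<comment> \<open>The split into halves is again a two-point entropy, with imbalance
    \<open>2 * d\<close>. Its loss \<open>2 * d^2\<close> cancels the gain \<open>2 * d^2\<close> in
    \<open>\<rho>^2 + (1 - \<rho>)^2\<close>, and only the \<open>3 * d^2\<close> of the halves
    remains.\<close>
  have H0: "- \<rho> * ln \<rho> - (1 - \<rho>) * ln (1 - \<rho>) \<le> ln 2 - ((2 * d) ^ 2 / 2 + (2 * d) ^ 4 / 12)"
    using two_point_entropy[of \<rho> "1 - \<rho>" 1 "2 * d"] \<rho>01 by (simp add: d \<rho>_def)
  have H: "- \<rho> * ln \<rho> - (1 - \<rho>) * ln (1 - \<rho>) \<le> ln 2 - 2 * d ^ 2"
  proof -
    have "0 \<le> (2 * d) ^ 4" "(2 * d) ^ 2 / 2 = 2 * d ^ 2" by (auto simp: power_mult_distrib)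
    with H0 show ?thesis by linarith
  qed
  have sq: "\<rho> ^ 2 + (1 - \<rho>) ^ 2 = 1/2 + 2 * d ^ 2"
    by (simp add: d \<rho>_def power2_eq_square algebra_simps)
  have l4: "ln (4::real) = 2 * ln 2" using ln_realpow[of 2 2] by simp
  have "(\<Sum>c=1..4. - p c * ln (p c) + 2 * p c ^ 2)
      = (- p 1 * ln (p 1) - p 2 * ln (p 2) + 2 * (p 1 ^ 2 + p 2 ^ 2))
      + (- p 3 * ln (p 3) - p 4 * ln (p 4) + 2 * (p 3 ^ 2 + p 4 ^ 2))"
    unfolding set4 by simp
  also have "\<dots> \<le> (- \<rho> * ln \<rho> - (1 - \<rho>) * ln (1 - \<rho>)) + ln 2 + (\<rho> ^ 2 + (1 - \<rho>) ^ 2) + 3 * d ^ 2"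
    using A B by (simp add: algebra_simps)
  also have "\<dots> \<le> ln 4 + 1/2 + 3 * d ^ 2"
    using H sq l4 by simp
  finally show ?thesis .
qed

section \<open>Numerical bounds on logarithms and on e\<close>

lemma ln_ratio_ge:
  assumes "k \<ge> 2"
  shows "2 / (2 * k - 1) \<le> ln (k / (k - 1 :: real))"
proof -
  \<comment> \<open>This \<open>s\<close> solves \<open>(1 + s) / (1 - s) = k / (k - 1)\<close>, so
    one term of the artanh series is enough.\<close>
  define s where "s = 1 / (2 * k - 1)"
  have s: "0 \<le> s" "s < 1" using assms by (auto simp: s_def)
  have "(1 + s) / (1 - s) = k / (k - 1)"
  proof -
    have "1 + s = 2 * k / (2 * k - 1)" "1 - s = 2 * (k - 1) / (2 * k - 1)"
      using assms by (auto simp: s_def field_simps)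
    then have "(1 + s) / (1 - s) = (2 * k) / (2 * (k - 1))" using assms by simp
    then show ?thesis by (simp only: mult_divide_mult_cancel_left_if) simp
  qed
  moreover have "ln ((1 + s) / (1 - s)) = ln (1 + s) - ln (1 - s)"
    using s by (intro ln_divide_pos) auto
  ultimately have "ln (1 + s) - ln (1 - s) = ln (k / (k - 1))" by simp
  moreover have "0 \<le> s ^ 3" using s by simp
  ultimately have "2 * s \<le> ln (k / (k - 1))" using artanh_lower[OF s] by linarith
  then show ?thesis by (simp add: s_def)
qed

lemma e_bounds: "(13591/5000) \<le> exp (1::real)" "exp (1::real) \<le> (27183/10000)"
proof -
  obtain t :: real where t: "\<bar>t\<bar> \<le> \<bar>1\<bar>" "exp 1 = (\<Sum>m<9. (1 ^ m) / fact m) + (exp t / fact 9) * 1 ^ 9"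
    using Maclaurin_exp_le[of "1::real" 9] by blast
  have S: "(\<Sum>m<9. (1 ^ m :: real) / fact m) = 109601 / 40320"
    by (simp add: eval_nat_numeral fact_numeral)
  have "t \<le> 1" using t(1) by simp
  then have "exp t \<le> exp 1" by simp
  also have "\<dots> \<le> (3::real)" by (rule exp_le)
  finally have "exp t / fact 9 * 1 ^ 9 \<le> 3 / 362880" by (simp add: fact_numeral)
  moreover have "0 \<le> exp t / fact 9 * (1::real) ^ 9" by simp
  ultimately have "109601 / 40320 \<le> exp (1::real)" "exp (1::real) \<le> 109601 / 40320 + 3 / 362880"
    using t(2) unfolding S by linarith+
  then show "(13591/5000) \<le> exp (1::real)" "exp (1::real) \<le> (27183/10000)" by auto
qed

text \<open>The margin is only about 0.003. With \<open>x = exp (- 3)\<close> the difference of the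
  sides is \<open>ln 2 * (3 * x - 2) + ln (4/3) * (9/2 - 12 * x^2)\<close>, so an upper bound on
  \<open>ln 2\<close>, a lower bound on \<open>ln (4/3)\<close> and bounds on \<open>x\<close> from
  both sides are required.\<close>

lemma planted_entropy_gap:
  "2 * ln 2 - 9/2 * ln (4/3) < ln 2 * (3 * exp (- 3)) - ln (4/3) * (12 * exp (- 6 :: real))"
proof -
  define x where "x = exp (- 3 :: real)"
  have e3: "exp (3::real) = exp 1 ^ 3" by (simp flip: exp_of_nat_mult)
  have "exp (3::real) \<le> (27183/10000) ^ 3" unfolding e3 by (intro power_mono e_bounds) auto
  then have "exp (3::real) \<le> (2009/100)" by (simp add: power3_eq_cube)
  then have "1 / (2009/100) \<le> 1 / exp (3::real)" by (intro divide_left_mono) auto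
  then have x1: "(497/10000) \<le> x" by (simp add: x_def exp_minus inverse_eq_divide)
  have "(13591/5000) ^ 3 \<le> exp (3::real)" unfolding e3 by (intro power_mono e_bounds) auto
  then have "20 \<le> exp (3::real)" by (simp add: power3_eq_cube)
  then have "1 / exp (3::real) \<le> 1 / 20" by (intro divide_left_mono) auto
  then have x2: "x \<le> (1/20)" by (simp add: x_def exp_minus inverse_eq_divide)
  have x6: "exp (- 6 :: real) = x ^ 2"
    by (simp add: x_def power2_eq_square flip: exp_add)
  have b: "(5753/20000) \<le> ln (4/3 :: real)"
  proof -
    have "ln ((1 + 1/7) / (1 - 1/7)) = ln (1 + 1/7) - ln (1 - 1/7 :: real)"
      by (intro ln_divide_pos) auto
    then show ?thesis using artanh_lower[of "1/7"] by (simp add: power3_eq_cube)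
  qed
  have a: "0 \<le> ln (2::real)" "ln (2::real) \<le> 25/36" using ln2_le_25_over_36 by auto
  have "x ^ 2 \<le> (1/20) ^ 2" using x1 x2 by (intro power_mono) auto
  then have "ln (4/3) * (12 * x ^ 2) \<le> ln (4/3 :: real) * (12 * (1/400))"
    using b by (intro mult_left_mono) (auto simp: power2_eq_square)
  moreover have "ln 2 * (3 * (497/10000)) \<le> ln 2 * (3 * x)"
    using x1 a by (intro mult_left_mono) auto
  ultimately show ?thesis
    using a b unfolding x6 x_def[symmetric] by linarith
qed

section \<open>Linear majorants of \<open>y ^ 2 / 2 - y * ln y\<close>\<close>

text \<open>This is \<open>ln x \<le> x - 1\<close> at \<open>x = exp c / y\<close>. Multiplied by
  \<open>y\<close> it becomes the tangent of \<open>y * ln y\<close> at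
  \<open>exp c\<close>.\<close>

lemma ln_tangent: "c + 1 - exp c / y \<le> ln y" if "y > 0" for y c :: real
proof -
  have "ln (exp c / y) \<le> exp c / y - 1" using that by (intro ln_le_minus_one) simp
  then show ?thesis using that by (simp add: ln_div)
qed

text \<open>The tangent of the logarithm at \<open>exp c\<close> reduces the claim on each of five intervals to a quadratic
  inequality; the tangent points are chosen so that only bounds on \<open>exp 1\<close> are needed.\<close>

lemma linear_bound_five:
  fixes y :: real
  assumes "0 \<le> y" "y \<le> (31/10)"
  shows "y ^ 2 / 2 - y * ln y \<le> (17/50) + (8/25) * y"
proof (cases "y = 0")
  case False
  then have y: "y > 0" using assms by simp
  have tan: "y * (c + 1) - E \<le> y * ln y" if "exp c \<le> E" for c E
  proof -
    have "y * (c + 1 - exp c / y) \<le> y * ln y" using ln_tangent[OF y] y by (intro mult_left_mono) auto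
    then show ?thesis using that y by (simp add: algebra_simps)
  qed
  have em1: "exp (- 1 :: real) \<le> (3679/10000)"
  proof -
    have "1 / exp (1::real) \<le> 1 / (13591/5000)" using e_bounds by (intro divide_left_mono) auto
    then show ?thesis by (simp add: exp_minus inverse_eq_divide)
  qed
  have E1: "exp (- (11/10) :: real) \<le> (67/200)"
  proof -
    have "(11/10) \<le> exp ((1/10)::real)" using exp_ge_add_one_self[of "(1/10)::real"] by simp
    then have "1 / exp ((1/10)::real) \<le> 1 / (11/10)" by (intro divide_left_mono) auto
    then have "exp (- (1/10) :: real) \<le> 1 / (11/10)" by (simp add: exp_minus inverse_eq_divide)
    then have "exp (- 1) * exp (- (1/10)) \<le> (3679/10000) * (1 / (11/10) :: real)"
      using em1 by (intro mult_mono) auto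
    then show ?thesis by (simp flip: exp_add)
  qed
  have E2: "exp (- (1/2) :: real) \<le> (3033/5000)"
  proof (rule power2_le_imp_le)
    have "exp (- (1/2) :: real) ^ 2 = exp (- 1)" by (simp flip: exp_of_nat_mult)
    then show "exp (- (1/2) :: real) ^ 2 \<le> (3033/5000) ^ 2" using em1 by (simp add: power2_eq_square)
  qed simp
  have E3: "exp ((1/2) :: real) \<le> (2061/1250)"
  proof (rule power2_le_imp_le)
    have "exp ((1/2) :: real) ^ 2 = exp 1" by (simp flip: exp_of_nat_mult)
    then show "exp ((1/2) :: real) ^ 2 \<le> (2061/1250) ^ 2" using e_bounds by (simp add: power2_eq_square)
  qed simp
  \<comment> \<open>The square lies below its chord, so on each interval both terms are replaced by
    linear ones.\<close>
  have quad: "y ^ 2 \<le> (l + u) * y - l * u" if "l \<le> y" "y \<le> u" for l u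
  proof -
    have "0 \<le> (y - l) * (u - y)" using that by simp
    then show ?thesis by (simp add: power2_eq_square algebra_simps)
  qed
  consider "y \<le> (21/50)" | "(21/50) \<le> y" "y \<le> (1/2)" | "(1/2) \<le> y" "y \<le> (11/10)" | "(11/10) \<le> y" "y \<le> 2" | "2 \<le> y" "y \<le> (31/10)"
    using assms by linarith
  then show ?thesis
  proof cases
    case 1
    then show ?thesis using tan[OF E1] quad[of 0 "(21/50)"] y by (simp add: algebra_simps)
  next
    case 2
    then show ?thesis using tan[OF em1] quad[of "(21/50)" "(1/2)"] by (simp add: algebra_simps)
  next
    case 3
    then show ?thesis using tan[OF E2] quad[of "(1/2)" "(11/10)"] by (simp add: algebra_simps)
  next
    case 4
    then show ?thesis using tan[OF E3] quad[of "(11/10)" 2] by (simp add: algebra_simps)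
  next
    case 5
    then show ?thesis using tan[OF e_bounds(2)] quad[of 2 "(31/10)"] by (simp add: algebra_simps)
  qed
qed simp

text \<open>The line starts at height 1/2 and meets the curve at \<open>Y\<close>. Divided by
  \<open>y\<close>, the claim says that the slope \<open>F\<close> from \<open>(0, 1/2)\<close> to
  the curve is nondecreasing, and its derivative is the square \<open>(1 - 1/y)^2 / 2\<close>. The
  intercept 1/2 is the least one for which this holds on the whole half-line; it belongs to the
  horizontal tangent at the inflection point \<open>y = 1\<close>.\<close>

lemma linear_bound_general:
  fixes y Y :: real
  assumes "0 \<le> y" "y \<le> Y"
  shows "y ^ 2 / 2 - y * ln y \<le> 1/2 + (Y / 2 - ln Y - 1 / (2 * Y)) * y"
proof (cases "y = 0")
  case False
  then have y: "0 < y" using assms by simp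
  define F where "F = (\<lambda>y::real. y / 2 - ln y - 1 / (2 * y))"
  have "F y \<le> F Y"
  proof (rule DERIV_nonneg_imp_nondecreasing[OF assms(2)])
    fix x assume x: "y \<le> x" "x \<le> Y"
    then have x0: "x > 0" using y by simp
    have "(F has_real_derivative 1/2 - 1 / x + 1 / (2 * x ^ 2)) (at x)"
      unfolding F_def using x0 by (auto intro!: derivative_eq_intros simp: field_simps power2_eq_square)
    moreover have "1/2 - 1 / x + 1 / (2 * x ^ 2) = (1 - 1 / x) ^ 2 / 2"
      using x0 by (simp add: field_simps power2_eq_square)
    ultimately show "\<exists>y. (F has_real_derivative y) (at x) \<and> 0 \<le> y" by (metis zero_le_divide_iff zero_le_numeral zero_le_power2)
  qed
  then have "F y * y \<le> F Y * y" using y by (intro mult_right_mono) auto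
  moreover have "F y * y = y ^ 2 / 2 - y * ln y - 1/2"
    using y by (simp add: F_def algebra_simps power2_eq_square)
  ultimately show ?thesis by (simp add: F_def)
qed simp

text \<open>Since the SNR is close to one, the claim has little slack for \<open>k = 5\<close>, and the general argument starts at \<open>k = 6\<close>.\<close>

lemma linear_bound_exists:
  fixes k :: nat
  assumes "k \<ge> 5"
  shows "\<exists>\<kappa> \<gamma>. (\<forall>y. 0 \<le> y \<longrightarrow> y \<le> real k / 2 + 3/5 \<longrightarrow> y ^ 2 / 2 - y * ln y \<le> \<kappa> + \<gamma> * y)
    \<and> ln (real k) + \<kappa> + \<gamma> - 1/2 < (real k - 1) ^ 2 / 2 * ln (real k / (real k - 1))"
proof (cases "k = 5")
  case True
  have "ln (5::real) = 2 * ln 2 + ln (5/4)"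
  proof -
    have "ln (4::real) = 2 * ln 2" using ln_realpow[of 2 2] by simp
    moreover have "ln (4 * (5/4)) = ln 4 + ln (5/4::real)" by (intro ln_mult_pos) auto
    ultimately show ?thesis by simp
  qed
  moreover have "2/9 \<le> ln (5/4::real)" using ln_ratio_ge[of 5] by simp
  ultimately have "ln (5::real) + (17/50) + (8/25) - 1/2 < 8 * ln (5/4)"
    using ln2_le_25_over_36 by linarith
  \<comment> \<open>The constants are rounded up from the line that passes through the curve at the
    right end \<open>31/10\<close> and touches it near \<open>2/5\<close>.\<close>
  then show ?thesis
    using True linear_bound_five by (intro exI[of _ "(17/50)"] exI[of _ "(8/25)"]) auto
next
  case False
  then have k: "real k \<ge> 6" using assms by simp
  define Y where "Y = real k / 2 + 3/5"
  define \<gamma> where "\<gamma> = Y / 2 - ln Y - 1 / (2 * Y)"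
  have Y: "Y > 0" using k by (simp add: Y_def)
  \<comment> \<open>Since \<open>Y\<close> is about \<open>k / 2\<close>, the difference of
    logarithms is about \<open>ln 2\<close>, and the left side grows like \<open>k / 4\<close>
    against \<open>k / 2\<close> on the right.\<close>
  have "ln (real k) - ln Y = ln (real k / Y)" using k Y by (simp add: ln_div)
  also have "real k / Y = 2 * (real k / (real k + 6/5))" using k by (simp add: Y_def field_simps)
  also have "ln \<dots> = ln 2 + ln (real k / (real k + 6/5))" using k by (intro ln_mult_pos) auto
  also have "ln (real k / (real k + 6/5)) \<le> real k / (real k + 6/5) - 1"
    using k by (intro ln_le_minus_one) simp
  finally have "ln (real k) - ln Y \<le> ln 2 + (real k / (real k + 6/5) - 1)" by simp
  moreover have "real k / (real k + 6/5) - 1 = - (6/5) / (real k + 6/5)" using k by (simp add: field_simps)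
  moreover have "1 / (2 * Y) = 1 / (real k + 6/5)" by (simp add: Y_def field_simps)
  moreover have "Y / 2 = real k / 4 + 3/10" by (simp add: Y_def)
  ultimately have "ln (real k) + \<gamma> \<le> real k / 4 + 3/10 + 25/36 - (6/5) / (real k + 6/5) - 1 / (real k + 6/5)"
    using ln2_le_25_over_36 unfolding \<gamma>_def by linarith
  also have "\<dots> = real k / 4 + 179/180 - (11/5) / (real k + 6/5)"
  proof -
    have "(6/5) / D + 1 / D = (11/5) / D" for D :: real by (simp add: add_divide_distrib[symmetric])
    from this[of "real k + 6/5"] show ?thesis by linarith
  qed
  also have "\<dots> < real k / 2 - 3/4"
  proof -
    have "(x / 4 + 179/180) * (x + 6/5) - 11/5 < (x / 2 - 3/4) * (x + 6/5)" if "6 \<le> x" for x :: real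
    proof -
      have "6 * x \<le> x * x" using that by (intro mult_right_mono) auto
      moreover have "(x / 2 - 3/4) * (x + 6/5) - ((x / 4 + 179/180) * (x + 6/5) - 11/5)
          = x * x / 4 - 13/9 * x + 8/75"
        by (simp add: field_simps)
      ultimately show ?thesis using that by linarith
    qed
    from this[OF k]
    have "(real k / 4 + 179/180) * (real k + 6/5) - 11/5 < (real k / 2 - 3/4) * (real k + 6/5)" .
    then show ?thesis using k by (simp add: field_simps)
  qed
  also have "\<dots> \<le> (real k - 1) ^ 2 / 2 * (2 / (2 * real k - 1))"
    using k by (simp add: field_simps power2_eq_square)
  also have "\<dots> \<le> (real k - 1) ^ 2 / 2 * ln (real k / (real k - 1))"
    using ln_ratio_ge[of "real k"] k by (intro mult_left_mono) auto
  finally have "ln (real k) + 1/2 + \<gamma> - 1/2 < (real k - 1) ^ 2 / 2 * ln (real k / (real k - 1))" by simp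
  then show ?thesis
    using linear_bound_general[of _ Y] unfolding Y_def[symmetric] \<gamma>_def by blast
qed

section \<open>Sampling a proper colouring\<close>

definition low :: "nat \<Rightarrow> nat \<Rightarrow> (nat \<Rightarrow> nat) \<Rightarrow> nat set" where
  "low s n \<tau> = {v \<in> {1..n}. \<tau> v \<le> s}"

text \<open>The window on the size of \<open>low\<close> makes the row split of a bad colouring a
  known number near \<open>s / k\<close>. For \<open>k = 4\<close>, \<open>s = 2\<close> and
  \<open>\<delta> = 1/2\<close> it is no restriction.\<close>

definition typical :: "nat \<Rightarrow> nat \<Rightarrow> real \<Rightarrow> nat \<Rightarrow> nat set set \<Rightarrow> (nat \<Rightarrow> nat) set" where
  "typical k s \<delta> n E = {\<tau> \<in> proper_colorings n k E.
     \<bar>real (card (low s n \<tau>)) - real s / real k * real n\<bar> \<le> \<delta> * real n}"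

definition sampler :: "nat \<Rightarrow> nat \<Rightarrow> real \<Rightarrow> graph \<Rightarrow> nat set pmf" where
  "sampler k s \<delta> = (\<lambda>(V, E). if V = {1..card V} \<and> typical k s \<delta> (card V) E \<noteq> {}
     then map_pmf (low s (card V)) (pmf_of_set (typical k s \<delta> (card V) E)) else return_pmf {})"

text \<open>Properness is left out, so that the set depends on \<sigma> alone and stays fixed when
  the expectation over the edges is taken.\<close>

definition bad_colorings ::
  "nat \<Rightarrow> nat \<Rightarrow> real \<Rightarrow> real \<Rightarrow> nat \<Rightarrow> (nat \<Rightarrow> nat) \<Rightarrow> (nat \<Rightarrow> nat) set" where
  "bad_colorings k s \<delta> \<epsilon> n \<sigma> = {\<tau> \<in> vcolorings n k.
     \<bar>real (card (low s n \<tau>)) - real s / real k * real n\<bar> \<le> \<delta> * real n \<and> \<not> separates n k \<epsilon> \<sigma> (low s n \<tau>)}"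

lemma finite_low [simp]: "finite (low s n \<tau>)"
  by (simp add: low_def)

lemma partition_algorithm_sampler: "partition_algorithm (sampler k s \<delta>)"
  unfolding partition_algorithm_def
proof (intro allI impI)
  fix V E
  show "set_pmf (sampler k s \<delta> (V, E)) \<subseteq> Pow V"
  proof (cases "V = {1..card V}")
    case True
    have "low s (card V) \<tau> \<subseteq> {1..card V}" for \<tau> unfolding low_def by blast
    then have "low s (card V) \<tau> \<subseteq> V" for \<tau> using True by simp
    then show ?thesis by (auto simp: sampler_def)
  qed (simp add: sampler_def)
qed

lemma finite_typical [simp]: "finite (typical k s \<delta> n E)"
  unfolding typical_def by (rule finite_subset[OF _ finite_proper_colorings]) blast

lemma sampler_success:
  assumes many: "exp (\<zeta> * real n) \<le> real (card (typical k s \<delta> n E))"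
    and few: "real (card {\<tau> \<in> bad_colorings k s \<delta> \<epsilon> n \<sigma>. \<forall>e\<in>E. bichr \<tau> e}) \<le> exp (\<beta> * real n)"
  shows "pr (map_pmf (\<lambda>S. (\<sigma>, S)) (sampler k s \<delta> ({1..n}, E))) {(\<sigma>, S). separates n k \<epsilon> \<sigma> S}
    \<ge> 1 - exp (- ((\<zeta> - \<beta>) * real n))"
proof -
  let ?T = "typical k s \<delta> n E"
  define G where "G = {\<tau>. separates n k \<epsilon> \<sigma> (low s n \<tau>)}"
  have pos: "0 < real (card ?T)" using many exp_gt_zero[of "\<zeta> * real n"] by linarith
  have ne: "?T \<noteq> {}"
  proof
    assume "?T = {}"
    then have "card ?T = 0" by (simp only: card.empty)
    then show False using pos by simp
  qed
  have "sampler k s \<delta> ({1..n}, E) = map_pmf (low s n) (pmf_of_set ?T)"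
    using ne by (simp add: sampler_def)
  then have eq: "pr (map_pmf (\<lambda>S. (\<sigma>, S)) (sampler k s \<delta> ({1..n}, E))) {(\<sigma>, S). separates n k \<epsilon> \<sigma> S}
      = pr (pmf_of_set ?T) G"
    by (simp add: G_def vimage_def)
  have pr: "pr (pmf_of_set ?T) G = real (card (?T \<inter> G)) / real (card ?T)"
    using ne by (simp add: measure_pmf_of_set)
  have "card ?T = card (?T \<inter> G) + card (?T - G)" by (rule card_Int_Diff) simp
  then have "real (card (?T \<inter> G)) = real (card ?T) - real (card (?T - G))" by simp
  then have pr': "pr (pmf_of_set ?T) G = 1 - real (card (?T - G)) / real (card ?T)"
    unfolding pr using pos ne by (simp only: diff_divide_distrib) simp
  have "real (card (?T - G)) / real (card ?T) \<le> exp (\<beta> * real n) / exp (\<zeta> * real n)"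
  proof (rule frac_le)
    have "?T - G \<subseteq> {\<tau> \<in> bad_colorings k s \<delta> \<epsilon> n \<sigma>. \<forall>e\<in>E. bichr \<tau> e}"
      unfolding typical_def G_def bad_colorings_def proper_colorings_def by blast
    moreover have "finite {\<tau> \<in> bad_colorings k s \<delta> \<epsilon> n \<sigma>. \<forall>e\<in>E. bichr \<tau> e}"
      unfolding bad_colorings_def by (rule finite_subset[OF _ finite_vcolorings]) blast
    ultimately show "real (card (?T - G)) \<le> exp (\<beta> * real n)"
      using few order_trans[OF of_nat_mono[OF card_mono]] by blast
  qed (use many in auto)
  also have "exp (\<beta> * real n) / exp (\<zeta> * real n) = exp (- ((\<zeta> - \<beta>) * real n))"
    by (simp add: algebra_simps flip: exp_diff)
  finally show ?thesis unfolding eq pr' by linarith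
qed

section \<open>Random community sizes\<close>

lemma set_community_pmf: "k > 0 \<Longrightarrow> set_pmf (community_pmf n k) = vcolorings n k"
  by (simp add: community_pmf_def set_Pi_pmf set_pmf_of_set PiE_dflt_def)

lemma prob_community_fixed:
  assumes "k > 0" "i \<in> {1..k}" "W \<subseteq> {1..n}"
  shows "pr (community_pmf n k) {\<sigma>. \<forall>v\<in>W. \<sigma> v = i} = (1 / real k) ^ card W"
proof -
  define B where "B x = (if x \<in> W then {i} else UNIV)" for x
  have "{\<sigma>. \<forall>v\<in>W. \<sigma> v = i} = Pi {1..n} B"
    using assms(3) by (fastforce simp: B_def Pi_def)
  then have "pr (community_pmf n k) {\<sigma>. \<forall>v\<in>W. \<sigma> v = i}
      = (\<Prod>x=1..n. pr (pmf_of_set {1..k}) (B x))"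
    by (simp add: community_pmf_def measure_Pi_pmf_Pi)
  also have "\<dots> = (\<Prod>x=1..n. if x \<in> W then 1 / real k else 1)"
    using assms(1,2) by (intro prod.cong) (auto simp: B_def measure_pmf_of_set)
  also have "\<dots> = (1 / real k) ^ card W"
  proof -
    have "{1..n} \<inter> W = W" using assms(3) by blast
    then show ?thesis by (simp add: prod.If_cases)
  qed
  finally show ?thesis .
qed

lemma prob_balanced:
  assumes k: "k > 0" and \<eta>: "\<eta> > 0" and n: "n > 0"
  shows "pr (community_pmf n k) {\<sigma>. balanced \<eta> n k \<sigma>} \<ge> 1 - real k ^ 3 / \<eta>\<^sup>2 / real n"
proof -
  let ?M = "community_pmf n k"
  have fin: "finite (set_pmf ?M)" using k finite_vcolorings[of n k] by (simp add: set_community_pmf)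
  define t where "t = \<eta> / real k * real n"
  have t: "t > 0" using k \<eta> n by (simp add: t_def)
  define Bi :: "nat \<Rightarrow> (nat \<Rightarrow> nat) set" where "Bi i = {\<sigma>. t \<le> \<bar>real (card {v\<in>{1..n}. \<sigma> v = i}) - real n / real k\<bar>}" for i
  have single: "pr ?M (Bi i) \<le> real k ^ 2 / \<eta>\<^sup>2 / real n" if i: "i \<in> {1..k}" for i
  proof -
    have p1: "pr ?M {\<sigma>. \<sigma> v = i} = 1 / real k" if "v \<in> {1..n}" for v
      using prob_community_fixed[OF k i, of "{v}" n] that by simp
    have p2: "pr ?M {\<sigma>. \<sigma> v = i \<and> \<sigma> w = i} \<le> (1 / real k)\<^sup>2 + of_bool (v = w)"
      if "v \<in> {1..n}" "w \<in> {1..n}" for v w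
    proof (cases "v = w")
      case False
      then show ?thesis
        using prob_community_fixed[OF k i, of "{v, w}" n] that by (simp add: power2_eq_square)
    next
      case True
      have "pr ?M {\<sigma>. \<sigma> v = i \<and> \<sigma> w = i} \<le> 1" by simp
      then show ?thesis using True by (simp add: add_increasing)
    qed
    have mu: "(\<Sum>v=1..n. pr ?M {\<sigma>. \<sigma> v = i}) = real n / real k"
      using p1 by simp
    have "(\<Sum>v=1..n. \<Sum>w=1..n. pr ?M {\<sigma>. \<sigma> v = i \<and> \<sigma> w = i})
        \<le> (\<Sum>v=1..n. \<Sum>w=1..n. (1 / real k)\<^sup>2 + of_bool (v = w))"
      by (intro sum_mono p2)
    also have "\<dots> = (\<Sum>v=1..n. real n * (1 / real k)\<^sup>2 + 1)"
    proof (intro sum.cong refl)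
      fix v assume "v \<in> {1..n}"
      then have "(\<Sum>w=1..n. of_bool (v = w) :: real) = 1"
        by (simp add: of_bool_def)
      then show "(\<Sum>w=1..n. (1 / real k)\<^sup>2 + of_bool (v = w)) = real n * (1 / real k)\<^sup>2 + 1"
        by (simp add: sum.distrib)
    qed
    also have "\<dots> = (real n / real k)\<^sup>2 + real n"
      by (simp add: power2_eq_square algebra_simps)
    finally have pairs: "(\<Sum>v=1..n. \<Sum>w=1..n. pr ?M {\<sigma>. \<sigma> v = i \<and> \<sigma> w = i})
      \<le> (real n / real k)\<^sup>2 + real n" .
    have "pr ?M {\<sigma>. t \<le> \<bar>real (card {v\<in>{1..n}. \<sigma> v = i})
        - (\<Sum>v=1..n. pr ?M {\<sigma>. \<sigma> v = i})\<bar>} \<le> real n / t\<^sup>2"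
      by (rule prob_count_deviation[OF _ fin t]) (use mu pairs in \<open>simp_all only: finite_atLeastAtMost\<close>)
    also have "real n / t\<^sup>2 = real k ^ 2 / \<eta>\<^sup>2 / real n"
      using n k \<eta> by (simp add: t_def power2_eq_square field_simps)
    finally show ?thesis unfolding Bi_def mu .
  qed
  have "pr ?M (\<Union>i\<in>{1..k}. Bi i) \<le> (\<Sum>i=1..k. pr ?M (Bi i))"
    by (intro measure_UNION_le) auto
  also have "\<dots> \<le> (\<Sum>i=1..k. real k ^ 2 / \<eta>\<^sup>2 / real n)" by (intro sum_mono single)
  also have "\<dots> = real k ^ 3 / \<eta>\<^sup>2 / real n" by (simp add: power3_eq_cube power2_eq_square)
  finally have U: "pr ?M (\<Union>i\<in>{1..k}. Bi i) \<le> real k ^ 3 / \<eta>\<^sup>2 / real n" .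
  have "pr ?M {\<sigma>. balanced \<eta> n k \<sigma>} \<ge> 1 - pr ?M (\<Union>i\<in>{1..k}. Bi i)"
  proof (rule prob_ge_complement)
    fix \<sigma> assume s: "\<sigma> \<in> set_pmf ?M" "\<sigma> \<notin> {\<sigma>. balanced \<eta> n k \<sigma>}"
    then have "\<sigma> \<in> vcolorings n k" using set_community_pmf[OF k] by blast
    then obtain i where i: "i \<in> {1..k}" "(1 + \<eta>) * real n / real k < csize n \<sigma> i"
      using s(2) unfolding balanced_def by force
    have "(1 + \<eta>) * real n / real k = real n / real k + t" using k by (simp add: t_def field_simps)
    then have "\<sigma> \<in> Bi i" using i(2) unfolding Bi_def community_def by simp
    then show "\<sigma> \<in> (\<Union>i\<in>{1..k}. Bi i)" using i(1) by blast
  qed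
  then show ?thesis using U by linarith
qed

section \<open>From counting to detection\<close>

lemma power_times_exp_tendsto_0:
  fixes g :: real
  assumes "g > 0"
  shows "(\<lambda>n. real (n + 1) ^ K * exp (- (g * real n))) \<longlonglongrightarrow> 0"
proof (rule tendsto_sandwich[of "\<lambda>_. 0"])
  have "filterlim (\<lambda>n. g * real n) at_top sequentially"
    using assms by (intro filterlim_tendsto_pos_mult_at_top[OF tendsto_const] filterlim_real_sequentially) auto
  then have "(\<lambda>n. (g * real n) ^ K / exp (g * real n)) \<longlonglongrightarrow> 0"
    by (rule filterlim_compose[OF tendsto_power_div_exp_0])
  then show "(\<lambda>n. (2 / g) ^ K * ((g * real n) ^ K / exp (g * real n))) \<longlonglongrightarrow> 0"
    by (rule tendsto_mult_right_zero)
  show "\<forall>\<^sub>F n in sequentially. real (n + 1) ^ K * exp (- (g * real n))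
      \<le> (2 / g) ^ K * ((g * real n) ^ K / exp (g * real n))"
    using eventually_ge_at_top[of 1]
  proof eventually_elim
    case (elim n)
    have "real (n + 1) ^ K \<le> (2 * real n) ^ K" using elim by (intro power_mono) auto
    also have "2 * real n = 2 / g * (g * real n)" using assms by simp
    also have "\<dots> ^ K = (2 / g) ^ K * (g * real n) ^ K" by (rule power_mult_distrib)
    finally have "real (n + 1) ^ K * exp (- (g * real n)) \<le> (2 / g) ^ K * (g * real n) ^ K * exp (- (g * real n))"
      by (intro mult_right_mono) auto
    then show ?case by (simp add: exp_minus field_simps)
  qed
qed (auto intro!: always_eventually)

lemma few_edges:
  assumes k: "k \<ge> 2" and \<eta>: "\<eta> > 0" and b: "b > 0" "8 * b \<le> real n" and n: "n > 0"
    and bal: "balanced \<eta> n k \<sigma>"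
  shows "pr (edges_pmf n 0 b \<sigma>) {E. real (card E) < b / 2 * (1 - 1 / real k - 2 * \<eta>) * real n}
    \<le> (8 * b * b\<^sup>2 + b) / (b * \<eta> / 2)\<^sup>2 / real n"
proof -
  let ?N = "\<lambda>i. csize n \<sigma> i"
  have \<sigma>: "\<sigma> \<in> vcolorings n k" using bal by (simp add: balanced_def)
  have "(\<Sum>i=1..k. (?N i)\<^sup>2) \<le> (\<Sum>i=1..k. ((1 + \<eta>) * real n / real k) * ?N i)"
    unfolding power2_eq_square using bal unfolding balanced_def by (intro sum_mono mult_right_mono) auto
  also have "\<dots> = ((1 + \<eta>) * real n / real k) * real n"
    using sum_community[OF \<sigma>] unfolding sum_distrib_left[symmetric] of_nat_sum[symmetric] by simp
  finally have "(real n)\<^sup>2 - (1 + \<eta>) / real k * (real n)\<^sup>2 \<le> 2 * real (card (cross_pairs n \<sigma>))"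
    using card_cross_pairs[OF \<sigma>] by (simp add: power2_eq_square)
  then have "b / (2 * real n) * ((real n)\<^sup>2 - (1 + \<eta>) / real k * (real n)\<^sup>2) \<le> b / (2 * real n) * (2 * real (card (cross_pairs n \<sigma>)))"
    using b by (intro mult_left_mono) auto
  then have mean: "b / 2 * (1 - (1 + \<eta>) / real k) * real n \<le> b / real n * real (card (cross_pairs n \<sigma>))"
  proof -
    have "b / (2 * real n) * ((real n)\<^sup>2 - x * (real n)\<^sup>2) = b / 2 * (1 - x) * real n" for x
      using n by (simp add: power2_eq_square field_simps)
    moreover have "b / (2 * real n) * (2 * x) = b / real n * x" for x by simp
    ultimately show ?thesis
      using \<open>b / (2 * real n) * ((real n)\<^sup>2 - (1 + \<eta>) / real k * (real n)\<^sup>2) \<le> _\<close> by (simp only:)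
  qed
  \<comment> \<open>Of the slack \<open>2 * \<eta>\<close> in the edge threshold, one \<eta> is
    reserved for the random deviation \<open>b * \<eta> / 2 * n\<close>; the other covers the loss
    \<open>\<eta> / k\<close> in the mean.\<close>
  have "\<eta> / real k \<le> \<eta> * (1/2)" using k \<eta> by (simp add: field_simps)
  then have "1 - 1 / real k - 2 * \<eta> + \<eta> \<le> 1 - (1 + \<eta>) / real k"
    using \<eta> unfolding add_divide_distrib by linarith
  then have "b / 2 * (1 - 1 / real k - 2 * \<eta> + \<eta>) * real n \<le> b / 2 * (1 - (1 + \<eta>) / real k) * real n"
    using b by (intro mult_right_mono mult_left_mono) auto
  then have gap: "b / 2 * (1 - 1 / real k - 2 * \<eta>) * real n + b * \<eta> / 2 * real n \<le> b / real n * real (card (cross_pairs n \<sigma>))"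
    using mean by (simp add: algebra_simps)
  have "pr (edges_pmf n 0 b \<sigma>) {E. real (card E) < b / 2 * (1 - 1 / real k - 2 * \<eta>) * real n}
      \<le> pr (edges_pmf n 0 b \<sigma>)
        {E. b * \<eta> / 2 * real n \<le> \<bar>real (card E) - b / real n * real (card (cross_pairs n \<sigma>))\<bar>}"
  proof (intro measure_pmf.finite_measure_mono subsetI CollectI)
    fix E :: "nat set set"
    assume "E \<in> {E. real (card E) < b / 2 * (1 - 1 / real k - 2 * \<eta>) * real n}"
    then have "real (card E) < b / 2 * (1 - 1 / real k - 2 * \<eta>) * real n" by (rule CollectD)
    then show "b * \<eta> / 2 * real n \<le> \<bar>real (card E) - b / real n * real (card (cross_pairs n \<sigma>))\<bar>"
      using gap by linarith
  qed simp
  also have "\<dots> \<le> (8 * b * b\<^sup>2 + b) / (b * \<eta> / 2)\<^sup>2 / real n"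
    by (rule edge_count_concentration) (use b n \<eta> in auto)
  finally show ?thesis .
qed

text \<open>A graph is unfavourable if it has too few edges, too few typical colourings, or more
  than \<open>exp ((B + g) * n)\<close> bad proper ones. Taking \<open>g\<close> as half the gap
  between \<zeta> and \<open>B\<close> leaves a factor \<open>exp (- g * n)\<close> twice: in
  Markov's inequality, where it beats the polynomial number of profiles, and in the chance that the
  sampler picks a bad colouring.\<close>

lemma detection_from_counting:
  fixes k s :: nat and b \<eta> \<delta> \<epsilon> \<zeta> B L C :: real
  assumes k: "k \<ge> 2" and \<eta>: "\<eta> > 0" and \<epsilon>: "\<epsilon> > 0" and b: "b > 0" and L: "L \<ge> 0" and gap: "B < \<zeta>"
    and expo: "\<forall>\<^sub>F n in sequentially. \<forall>\<sigma>. balanced \<eta> n k \<sigma> \<longrightarrow> (\<forall>\<tau>\<in>bad_colorings k s \<delta> \<epsilon> n \<sigma>.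
        exponent k b L (b / 2 * (1 - 1 / real k - 2 * \<eta>) * real n) n \<sigma> \<tau> \<le> B * real n)"
    and many: "\<forall>\<^sub>F n in sequentially. \<forall>\<sigma>. balanced \<eta> n k \<sigma> \<longrightarrow>
      pr (edges_pmf n 0 b \<sigma>) {E. exp (\<zeta> * real n) \<le> real (card (typical k s \<delta> n E))} \<ge> 1 - C / real n"
  shows "solves_detection (sampler k s \<delta>) k 0 b"
proof -
  define g where "g = (\<zeta> - B) / 2"
  have g: "g > 0" using gap by (simp add: g_def)
  define C0 where "C0 = real k ^ 3 / \<eta>\<^sup>2"
  define C1 where "C1 = (8 * b * b\<^sup>2 + b) / (b * \<eta> / 2)\<^sup>2"
  define err where "err n = C1 / real n + \<bar>C\<bar> / real n + real (n + 1) ^ (k * k) * exp (- (g * real n))" for n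
  define R where "R n = C0 / real n + (err n + exp (- (g * real n)))" for n
  let ?succ = "\<lambda>n. pr (SBM_run (sampler k s \<delta>) n k 0 b) {(\<sigma>, S). separates n k \<epsilon> \<sigma> S}"
  have C0: "C0 \<ge> 0" and C1: "C1 \<ge> 0" using b by (auto simp: C0_def C1_def)
  have "\<forall>\<^sub>F n in sequentially. 1 - R n \<le> ?succ n"
    using expo many eventually_ge_at_top[of "nat \<lceil>8 * b\<rceil> + 1"]
  proof eventually_elim
    case (elim n)
    have n: "n > 0" "8 * b \<le> real n" using elim(3) by linarith+
    have err0: "err n \<ge> 0" using C1 by (simp add: err_def)
    have run: "SBM_run (sampler k s \<delta>) n k 0 b = bind_pmf (community_pmf n k)
        (\<lambda>\<sigma>. bind_pmf (edges_pmf n 0 b \<sigma>) (\<lambda>E. map_pmf (\<lambda>S. (\<sigma>, S)) (sampler k s \<delta> ({1..n}, E))))"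
      by (simp add: SBM_run_def SBM_def bind_assoc_pmf bind_map_pmf)
    show ?case
      unfolding run R_def
    proof (rule prob_bind_ge[where G = "{\<sigma>. balanced \<eta> n k \<sigma>}"])
      show "finite (set_pmf (community_pmf n k))"
        using k finite_vcolorings[of n k] by (simp add: set_community_pmf)
      show "1 - C0 / real n \<le> pr (community_pmf n k) {\<sigma>. balanced \<eta> n k \<sigma>}"
        unfolding C0_def by (rule prob_balanced) (use k \<eta> n in auto)
      show "0 \<le> C0 / real n" "0 \<le> err n + exp (- (g * real n))" using C0 err0 by auto
      fix \<sigma> assume "\<sigma> \<in> {\<sigma>. balanced \<eta> n k \<sigma>}"
      then have bal: "balanced \<eta> n k \<sigma>" by simp
      then have \<sigma>: "\<sigma> \<in> vcolorings n k" by (simp add: balanced_def)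
      let ?M = "edges_pmf n 0 b \<sigma>" and ?D = "bad_colorings k s \<delta> \<epsilon> n \<sigma>"
      define m where "m = b / 2 * (1 - 1 / real k - 2 * \<eta>) * real n"
      define f :: "nat set set \<Rightarrow> real" where "f E = of_bool (m \<le> real (card E)) * real (card {\<tau>\<in>?D. \<forall>e\<in>E. bichr \<tau> e})" for E
      define B1 :: "nat set set set" where "B1 = {E. real (card E) < m}"
      define B2 :: "nat set set set" where "B2 = {E. \<not> exp (\<zeta> * real n) \<le> real (card (typical k s \<delta> n E))}"
      define B3 :: "nat set set set" where "B3 = {E. exp ((B + g) * real n) \<le> f E}"
      have p1: "pr ?M B1 \<le> C1 / real n"
        unfolding B1_def m_def C1_def by (rule few_edges) (use k \<eta> b n bal in auto)
      have p2: "pr ?M B2 \<le> \<bar>C\<bar> / real n"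
      proof -
        have "B2 = UNIV - {E. exp (\<zeta> * real n) \<le> real (card (typical k s \<delta> n E))}" by (auto simp: B2_def)
        then have "pr ?M B2 = 1 - pr ?M {E. exp (\<zeta> * real n) \<le> real (card (typical k s \<delta> n E))}"
          using measure_pmf.prob_compl[of "{E. exp (\<zeta> * real n) \<le> real (card (typical k s \<delta> n E))}" ?M] by simp
        also have "\<dots> \<le> C / real n" using elim(2) bal by fastforce
        also have "\<dots> \<le> \<bar>C\<bar> / real n" by (intro divide_right_mono) auto
        finally show ?thesis .
      qed
      have p3: "pr ?M B3 \<le> real (n + 1) ^ (k * k) * exp (- (g * real n))"
      proof -
        have "expect ?M f \<le> real (n + 1) ^ (k * k) * exp (B * real n)"
          unfolding f_def
        proof (rule first_moment[OF \<sigma>])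
          show "?D \<subseteq> vcolorings n k" by (auto simp: bad_colorings_def)
          fix \<tau> assume "\<tau> \<in> ?D"
          then show "exponent k b L m n \<sigma> \<tau> \<le> B * real n" using elim(1) bal unfolding m_def by blast
        qed (use b n L in auto)
        moreover have "pr ?M B3 \<le> expect ?M f / exp ((B + g) * real n)"
          unfolding B3_def by (rule pmf_markov) (auto simp: f_def)
        ultimately have "pr ?M B3 \<le> real (n + 1) ^ (k * k) * exp (B * real n) / exp ((B + g) * real n)"
          by (meson divide_right_mono exp_ge_zero order_trans)
        also have "\<dots> = real (n + 1) ^ (k * k) * exp (B * real n - (B + g) * real n)"
          by (simp add: exp_diff)
        also have "B * real n - (B + g) * real n = - (g * real n)" by (simp add: algebra_simps)
        finally show ?thesis .
      qed
      show "1 - (err n + exp (- (g * real n))) \<le> pr (bind_pmf ?M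
          (\<lambda>E. map_pmf (\<lambda>S. (\<sigma>, S)) (sampler k s \<delta> ({1..n}, E)))) {(\<sigma>, S). separates n k \<epsilon> \<sigma> S}"
      proof (rule prob_bind_ge[where G = "- (B1 \<union> B2 \<union> B3)"])
        have "1 - err n \<le> 1 - pr ?M (B1 \<union> B2 \<union> B3)"
          using prob_Un3_le[of ?M B1 B2 B3] p1 p2 p3 by (simp add: err_def)
        also have "\<dots> \<le> pr ?M (- (B1 \<union> B2 \<union> B3))"
          by (rule prob_ge_complement) blast
        finally show "1 - err n \<le> pr ?M (- (B1 \<union> B2 \<union> B3))" .
        fix E assume "E \<in> - (B1 \<union> B2 \<union> B3)"
        then have E: "\<not> real (card E) < m" "exp (\<zeta> * real n) \<le> real (card (typical k s \<delta> n E))"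
          "\<not> exp ((B + g) * real n) \<le> f E" by (auto simp: B1_def B2_def B3_def)
        have "real (card {\<tau>\<in>?D. \<forall>e\<in>E. bichr \<tau> e}) \<le> exp ((B + g) * real n)"
          using E(1,3) unfolding f_def by (simp add: not_less not_le)
        from sampler_success[OF E(2) this]
        show "1 - exp (- (g * real n)) \<le> pr (map_pmf (\<lambda>S. (\<sigma>, S)) (sampler k s \<delta> ({1..n}, E)))
          {(\<sigma>, S). separates n k \<epsilon> \<sigma> S}" by (simp add: g_def field_simps)
      qed (use err0 in auto)
    qed
  qed
  moreover have "(\<lambda>n. 1 - R n) \<longlonglongrightarrow> 1"
  proof -
    have e1: "(\<lambda>n. real (n + 1) ^ (k * k) * exp (- (g * real n))) \<longlonglongrightarrow> 0"
      by (rule power_times_exp_tendsto_0[OF g])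
    have e2: "(\<lambda>n. exp (- (g * real n))) \<longlonglongrightarrow> 0"
      using power_times_exp_tendsto_0[OF g, of 0] by (simp only: power_0 mult_1)
    have "R \<longlonglongrightarrow> 0 + ((0 + 0 + 0) + 0)"
      unfolding R_def err_def by (intro tendsto_add lim_const_over_n e1 e2)
    then have "(\<lambda>n. 1 - R n) \<longlonglongrightarrow> 1 - (0 + ((0 + 0 + 0) + 0))"
      by (rule tendsto_diff[OF tendsto_const])
    then show ?thesis by simp
  qed
  moreover have "\<forall>\<^sub>F n in sequentially. ?succ n \<le> 1" by (intro always_eventually allI measure_pmf.prob_le_1)
  ultimately have "?succ \<longlonglongrightarrow> 1"
    using tendsto_sandwich[of "\<lambda>n. 1 - R n" ?succ sequentially "\<lambda>_. 1" 1] tendsto_const by blast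
  then show ?thesis using \<epsilon> unfolding solves_detection_def by blast
qed

section \<open>Overlaps of bad colourings\<close>

definition rate :: "nat \<Rightarrow> real \<Rightarrow> real" where
  "rate k \<eta> = real k * (real k - 1) / (1 + \<eta>)"

text \<open>The part of the exponent per vertex that does not involve \<tau>: the factor
  \<open>exp L - 1\<close> collected on the cross pairs, minus \<open>L\<close> for every required
  edge.\<close>

definition offset :: "nat \<Rightarrow> real \<Rightarrow> real" where
  "offset k \<eta> = (real k - 1) / (2 * (1 + \<eta>))
     - rate k \<eta> / 2 * (1 - 1 / real k - 2 * \<eta>) * ln (real k / (real k - 1))"

lemma offset_tendsto:
  assumes "k \<ge> 2"
  shows "(offset k \<longlongrightarrow> (real k - 1) / 2 - (real k - 1) ^ 2 / 2 * ln (real k / (real k - 1))) (at_right 0)"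
proof -
  have "(offset k \<longlongrightarrow> (real k - 1) / (2 * (1 + 0))
      - (real k * (real k - 1) / (1 + 0)) / 2 * (1 - 1 / real k - 2 * 0) * ln (real k / (real k - 1))) (at_right 0)"
    unfolding offset_def rate_def by (intro tendsto_intros) auto
  moreover have "(real k * (real k - 1) / (1 + 0)) / 2 * (1 - 1 / real k - 2 * 0) = (real k - 1) ^ 2 / 2"
    using assms by (simp add: power2_eq_square field_simps)
  ultimately show ?thesis by simp
qed

text \<open>At the uniform overlap a tilt \<open>z = exp L\<close> costs
  \<open>z - 1 - z / k - ln z\<close> per edge, which is least at \<open>z = k / (k - 1)\<close>.
  With this \<open>z\<close> the product \<open>z * b\<close> is \<open>k^2 / (1 + \<eta>)\<close>,
  so a row contributes its entropy plus at most \<open>k / 2\<close> times its sum of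
  squares.\<close>

abbreviation excess :: "nat \<Rightarrow> real \<Rightarrow> nat \<Rightarrow> (nat \<Rightarrow> nat) \<Rightarrow> (nat \<Rightarrow> nat) \<Rightarrow> real" where
  "excess k \<eta> n \<equiv> exponent k (rate k \<eta>) (ln (real k / (real k - 1)))
     (rate k \<eta> / 2 * (1 - 1 / real k - 2 * \<eta>) * real n) n"

text \<open>Balance gives \<open>Z * csize n \<sigma> i \<le> k / 2\<close>, so row \<open>i\<close>
  contributes at most its size times \<open>R\<close>, and the sizes add up to \<open>n\<close>. The
  class sizes of \<tau> enter only through \<open>Q\<close>, with a negative sign.\<close>

lemma exponent_le:
  fixes R Q \<eta> :: real
  assumes k: "k \<ge> 2" and \<eta>: "\<eta> > 0" and n: "n > 0" and bal: "balanced \<eta> n k \<sigma>" and \<tau>: "\<tau> \<in> vcolorings n k"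
    and row: "\<And>i. i \<in> {1..k} \<Longrightarrow> card (community n \<sigma> i) > 0 \<Longrightarrow>
      (\<Sum>c=1..k. - (overlap n \<sigma> \<tau> i c) * ln (overlap n \<sigma> \<tau> i c)
        + real k / 2 * (overlap n \<sigma> \<tau> i c) ^ 2) \<le> R"
    and Q: "Q * (real n)\<^sup>2 \<le> (\<Sum>c=1..k. (csize n \<tau> c)\<^sup>2)"
  shows "excess k \<eta> n \<sigma> \<tau>
    \<le> (R - (real k)\<^sup>2 / (2 * (1 + \<eta>)) * Q + offset k \<eta>) * real n"
proof -
  define b where "b = rate k \<eta>"
  define L where "L = ln (real k / (real k - 1))"
  define m where "m = b / 2 * (1 - 1 / real k - 2 * \<eta>) * real n"
  define Z where "Z = exp L * b / (2 * real n)"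
  let ?N = "\<lambda>i. csize n \<sigma> i" and ?n = "\<lambda>i c. real (cell n \<sigma> \<tau> i c)"
  have \<sigma>: "\<sigma> \<in> vcolorings n k" using bal by (simp add: balanced_def)
  have eL: "exp L = real k / (real k - 1)" using k by (simp add: L_def)
  have Z: "Z = (real k)\<^sup>2 / (2 * (1 + \<eta>) * real n)"
  proof -
    have "x / c * (x * c / d) / (2 * y) = x\<^sup>2 / (2 * d * y)" if "c \<noteq> 0" for x c d y :: real
      using that by (simp add: power2_eq_square)
    from this[of "real k - 1" "real k" "1 + \<eta>" "real n"] show ?thesis
      using k unfolding Z_def eL b_def rate_def by simp
  qed
  have Z0: "Z \<ge> 0" using \<eta> by (simp add: Z)
  have rows: "(\<Sum>c=1..k. - ?n i c * ln (?n i c / ?N i) + Z * (?n i c)\<^sup>2) \<le> ?N i * R" if i: "i \<in> {1..k}" for i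
  proof (cases "card (community n \<sigma> i) = 0")
    case True
    have "cell n \<sigma> \<tau> i c \<le> card (community n \<sigma> i)" for c
      unfolding cell_def by (intro card_mono) auto
    then have "cell n \<sigma> \<tau> i c = 0" for c using True by simp
    then show ?thesis using True by simp
  next
    case False
    then have N: "?N i > 0" and ne: "?N i \<noteq> 0" by linarith+
    have "?N i \<le> (1 + \<eta>) * real n / real k" using bal i unfolding balanced_def by blast
    then have "Z * ?N i \<le> Z * ((1 + \<eta>) * real n / real k)" using Z0 by (intro mult_left_mono)
    also have "\<dots> = real k / 2"
    proof -
      have "x\<^sup>2 / (2 * d * y) * (d * y / x) = x / 2" if "x \<noteq> 0" "d \<noteq> 0" "y \<noteq> 0" for x d y :: real
        using that by (simp add: power2_eq_square field_simps)
      from this[of "real k" "1 + \<eta>" "real n"] show ?thesis using \<eta> n k unfolding Z by simp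
    qed
    finally have ZN: "Z * ?N i \<le> real k / 2" .
    have "(\<Sum>c=1..k. - ?n i c * ln (?n i c / ?N i) + Z * (?n i c)\<^sup>2)
        \<le> (\<Sum>c=1..k. ?N i * (- (?n i c / ?N i) * ln (?n i c / ?N i) + real k / 2 * (?n i c / ?N i) ^ 2))"
    proof (intro sum_mono)
      fix c
      define p where "p = ?n i c / ?N i"
      have np: "?n i c = ?N i * p" by (simp only: p_def times_divide_eq_right nonzero_mult_div_cancel_left[OF ne])
      have "(Z * ?N i) * (?N i * p\<^sup>2) \<le> real k / 2 * (?N i * p\<^sup>2)"
        using ZN N by (intro mult_right_mono) auto
      then have "Z * (?N i * p)\<^sup>2 \<le> ?N i * (real k / 2 * p\<^sup>2)"
        by (simp add: power2_eq_square mult_ac)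
      then have "- (?N i * p) * ln p + Z * (?N i * p)\<^sup>2 \<le> ?N i * (- p * ln p + real k / 2 * p\<^sup>2)"
        by (simp add: algebra_simps)
      then show "- ?n i c * ln (?n i c / ?N i) + Z * (?n i c)\<^sup>2
          \<le> ?N i * (- (?n i c / ?N i) * ln (?n i c / ?N i) + real k / 2 * (?n i c / ?N i) ^ 2)"
        unfolding p_def[symmetric] unfolding np .
    qed
    also have "\<dots> \<le> ?N i * R"
    proof -
      have "card (community n \<sigma> i) > 0" using False by (simp only: neq0_conv)
      from row[OF i this] show ?thesis
        unfolding sum_distrib_left[symmetric] by (rule mult_left_mono) simp
    qed
    finally show ?thesis .
  qed
  have "(\<Sum>i=1..k. \<Sum>c=1..k. - ?n i c * ln (?n i c / ?N i)) + Z * (\<Sum>i=1..k. \<Sum>c=1..k. (?n i c)\<^sup>2)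
      = (\<Sum>i=1..k. \<Sum>c=1..k. - ?n i c * ln (?n i c / ?N i) + Z * (?n i c)\<^sup>2)"
    unfolding sum_distrib_left sum.distrib ..
  also have "\<dots> \<le> (\<Sum>i=1..k. ?N i * R)" by (intro sum_mono rows)
  also have "\<dots> = real n * R"
    using sum_community[OF \<sigma>] unfolding sum_distrib_right[symmetric] of_nat_sum[symmetric] by simp
  finally have A: "(\<Sum>i=1..k. \<Sum>c=1..k. - ?n i c * ln (?n i c / ?N i)) + Z * (\<Sum>i=1..k. \<Sum>c=1..k. (?n i c)\<^sup>2) \<le> real n * R" .
  have "Z * (Q * (real n)\<^sup>2) \<le> Z * (\<Sum>c=1..k. (csize n \<tau> c)\<^sup>2)"
    using Q Z0 by (rule mult_left_mono)
  moreover have "Z * (Q * (real n)\<^sup>2) = (real k)\<^sup>2 / (2 * (1 + \<eta>)) * Q * real n"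
    using n \<eta> by (simp add: Z power2_eq_square)
  ultimately have B: "(real k)\<^sup>2 / (2 * (1 + \<eta>)) * Q * real n \<le> Z * (\<Sum>c=1..k. (csize n \<tau> c)\<^sup>2)"
    by simp
  have C: "(exp L - 1) * b / (2 * real n) * ((real n)\<^sup>2 - (\<Sum>i=1..k. (?N i)\<^sup>2)) \<le> (real k - 1) / (2 * (1 + \<eta>)) * real n"
  proof -
    have co: "(exp L - 1) * b / (2 * real n) = real k / (2 * (1 + \<eta>) * real n)"
    proof -
      have "exp L - 1 = 1 / (real k - 1)" using k by (simp add: eL field_simps)
      then show ?thesis using k by (simp add: b_def rate_def)
    qed
    have "(real n)\<^sup>2 - (\<Sum>i=1..k. (?N i)\<^sup>2) \<le> (1 - 1 / real k) * (real n)\<^sup>2"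
      using card_cross_pairs_le'[OF \<sigma>] card_cross_pairs[OF \<sigma>] k by simp
    then have "(exp L - 1) * b / (2 * real n) * ((real n)\<^sup>2 - (\<Sum>i=1..k. (?N i)\<^sup>2))
        \<le> real k / (2 * (1 + \<eta>) * real n) * ((1 - 1 / real k) * (real n)\<^sup>2)"
      unfolding co using \<eta> by (intro mult_left_mono) auto
    also have "\<dots> = (real k * (1 - 1 / real k)) / (2 * (1 + \<eta>)) * real n"
      using n by (simp add: power2_eq_square)
    also have "real k * (1 - 1 / real k) = real k - 1" using k by (simp add: algebra_simps)
    finally show ?thesis .
  qed
  have "exponent k b L m n \<sigma> \<tau>
      = ((\<Sum>i=1..k. \<Sum>c=1..k. - ?n i c * ln (?n i c / ?N i)) + Z * (\<Sum>i=1..k. \<Sum>c=1..k. (?n i c)\<^sup>2))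
        - Z * (\<Sum>c=1..k. (csize n \<tau> c)\<^sup>2)
        + (exp L - 1) * b / (2 * real n) * ((real n)\<^sup>2 - (\<Sum>i=1..k. (?N i)\<^sup>2)) - m * L"
    unfolding exponent_def Z_def[symmetric] right_diff_distrib by linarith
  also have "\<dots> \<le> real n * R - (real k)\<^sup>2 / (2 * (1 + \<eta>)) * Q * real n + (real k - 1) / (2 * (1 + \<eta>)) * real n - m * L"
    using A B C by linarith
  also have "\<dots> = (R - (real k)\<^sup>2 / (2 * (1 + \<eta>)) * Q + offset k \<eta>) * real n"
    unfolding offset_def m_def b_def[symmetric] L_def[symmetric] by (simp only: algebra_simps)
  finally show ?thesis by (simp only: b_def m_def L_def)
qed

section \<open>Row constraints, the signal-to-noise ratio and the hidden colouring\<close>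

lemma sum_cell_low:
  assumes "\<tau> \<in> vcolorings n k"
  shows "(\<Sum>c=1..s. cell n \<sigma> \<tau> i c) = card (community n \<sigma> i \<inter> low s n \<tau>)"
proof -
  have "{v \<in> community n \<sigma> i. \<tau> v \<in> {1..s}} = community n \<sigma> i \<inter> low s n \<tau>"
    using vcoloringsD[OF assms] unfolding community_def low_def by (fastforce simp: image_subset_iff)
  then show ?thesis unfolding cell_def by (simp only: sum_card_Int_community[OF _ community_subset] finite_atLeastAtMost)
qed

lemma sum_card_low:
  assumes "\<tau> \<in> vcolorings n k"
  shows "(\<Sum>c=1..s. card (community n \<tau> c)) = card (low s n \<tau>)"
proof -
  have "{v \<in> {1..n}. \<tau> v \<in> {1..s}} = low s n \<tau>"
    using vcoloringsD[OF assms] unfolding low_def by (fastforce simp: image_subset_iff)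
  moreover have "{1..n} \<inter> community n \<tau> c = community n \<tau> c" for c using community_subset by blast
  ultimately show ?thesis using sum_card_Int_community[of "{1..s}" "{1..n}" n \<tau>] by simp
qed

lemma row_ratio:
  fixes i :: nat and \<sigma> \<tau> n
  defines "p \<equiv> \<lambda>c. overlap n \<sigma> \<tau> i c"
  assumes \<tau>: "\<tau> \<in> vcolorings n k" and N: "card (community n \<sigma> i) > 0"
  shows "(\<Sum>c=1..k. p c) = 1"
    and "(\<Sum>c=1..s. p c) = real (card (community n \<sigma> i \<inter> low s n \<tau>)) / csize n \<sigma> i"
proof -
  have ne: "csize n \<sigma> i \<noteq> 0" using N by linarith
  have eq: "(\<Sum>c\<in>S. p c) = real (\<Sum>c\<in>S. cell n \<sigma> \<tau> i c) / csize n \<sigma> i" for S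
    by (simp add: p_def sum_divide_distrib)
  show "(\<Sum>c=1..k. p c) = 1"
    by (simp only: eq sum_cell[OF \<tau>] divide_self[OF ne])
  show "(\<Sum>c=1..s. p c) = real (card (community n \<sigma> i \<inter> low s n \<tau>)) / csize n \<sigma> i"
    by (simp only: eq sum_cell_low[OF \<tau>])
qed

text \<open>The overall fraction of \<open>S\<close> is the average of its fractions in the
  communities, weighted by size. If no two of these differ by more than \<epsilon>, each is within
  \<epsilon> of the average; an empty community has weight zero.\<close>

lemma not_separates_ratio:
  assumes n: "n > 0" and \<sigma>: "\<sigma> \<in> vcolorings n k" and ns: "\<not> separates n k \<epsilon> \<sigma> S" and S: "S \<subseteq> {1..n}" and i: "i \<in> {1..k}"
  shows "\<bar>real (card (community n \<sigma> i \<inter> S)) / csize n \<sigma> i - real (card S) / real n\<bar> \<le> \<epsilon>"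
proof -
  let ?N = "\<lambda>j. csize n \<sigma> j"
  define r where "r j = real (card (community n \<sigma> j \<inter> S)) / ?N j" for j
  have le: "r j - r l \<le> \<epsilon>" if "j \<in> {1..k}" "l \<in> {1..k}" for j l
    using ns that unfolding separates_def r_def by (meson not_le)
  have Nr: "?N j * r j = real (card (community n \<sigma> j \<inter> S))" for j
  proof (cases "card (community n \<sigma> j) = 0")
    case True
    have "card (community n \<sigma> j \<inter> S) \<le> card (community n \<sigma> j)" by (intro card_mono) auto
    then show ?thesis using True by simp
  qed (simp add: r_def)
  have sumN: "(\<Sum>j=1..k. ?N j) = real n"
    using sum_community[OF \<sigma>] by (metis of_nat_sum)
  have "{v \<in> S. \<sigma> v \<in> {1..k}} = S" using vcoloringsD[OF \<sigma>] S by blast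
  then have "(\<Sum>j=1..k. card (community n \<sigma> j \<inter> S)) = card S"
    using sum_card_Int_community[OF _ S, of "{1..k}" \<sigma>] by (simp add: Int_commute)
  then have sumr: "(\<Sum>j=1..k. ?N j * r j) = real (card S)" unfolding Nr by (metis of_nat_sum)
  have "real n * r i - real (card S) = (\<Sum>j=1..k. ?N j * (r i - r j))"
    unfolding right_diff_distrib sum_subtractf sumr sum_distrib_right[symmetric] sumN ..
  moreover have "(\<Sum>j=1..k. ?N j * (r i - r j)) \<le> (\<Sum>j=1..k. ?N j * \<epsilon>)"
    using le i by (intro sum_mono mult_left_mono) auto
  moreover have "(\<Sum>j=1..k. ?N j * (- \<epsilon>)) \<le> (\<Sum>j=1..k. ?N j * (r i - r j))"
  proof (intro sum_mono mult_left_mono)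
    fix j assume "j \<in> {1..k}"
    then show "- \<epsilon> \<le> r i - r j" using le[of j i] i by linarith
  qed simp
  ultimately have "real n * r i - real (card S) \<le> real n * \<epsilon>" "real n * (- \<epsilon>) \<le> real n * r i - real (card S)"
    unfolding sum_distrib_right[symmetric] sumN by auto
  then have "r i - real (card S) / real n \<le> \<epsilon>" "- \<epsilon> \<le> r i - real (card S) / real n"
    using n by (simp_all add: field_simps)
  then show ?thesis by (simp add: r_def abs_le_iff)
qed

lemma SNR_rate:
  assumes "k \<ge> 2" "\<eta> > 0"
  shows "SNR k 0 (rate k \<eta>) < 1"
proof -
  have r: "rate k \<eta> > 0" using assms by (simp add: rate_def)
  have "SNR k 0 (rate k \<eta>) = rate k \<eta> / (real k * (real k - 1))"
    using r by (simp add: SNR_def power2_eq_square)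
  also have "\<dots> = 1 / (1 + \<eta>)" using assms by (simp add: rate_def)
  also have "\<dots> < 1" using assms by simp
  finally show ?thesis .
qed

text \<open>The upper bounds on the first \<open>s\<close> classes bound \<open>low\<close> from
  above, those on the other classes bound it from below.\<close>

lemma planted_typical:
  assumes \<eta>: "0 < \<eta>" and k: "k \<ge> 2" "s \<le> k" and bal: "balanced \<eta> n k \<sigma>" and E: "E \<subseteq> cross_pairs n \<sigma>"
  shows "\<sigma> \<in> typical k s \<eta> n E"
proof -
  let ?N = "\<lambda>j. csize n \<sigma> j"
  let ?u = "(1 + \<eta>) * real n / real k"
  have \<sigma>: "\<sigma> \<in> vcolorings n k" using bal by (simp add: balanced_def)
  have N: "?N i \<le> ?u" if "i \<in> {1..k}" for i using bal that unfolding balanced_def by blast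
  have low: "real (card (low s n \<sigma>)) = (\<Sum>c=1..s. ?N c)"
    using sum_card_low[OF \<sigma>] by (metis of_nat_sum)
  have "(\<Sum>c=1..s. ?N c) \<le> (\<Sum>c=1..s. ?u)" using N k by (intro sum_mono) auto
  then have up: "real (card (low s n \<sigma>)) \<le> real s * ?u" unfolding low by simp
  have "{1..k} = {1..s} \<union> {s<..k}" "{1..s} \<inter> {s<..k} = {}" using k by auto
  then have "(\<Sum>c=1..k. ?N c) = (\<Sum>c=1..s. ?N c) + (\<Sum>c\<in>{s<..k}. ?N c)"
    by (metis finite_atLeastAtMost finite_greaterThanAtMost sum.union_disjoint)
  moreover have "(\<Sum>c=1..k. ?N c) = real n" using sum_community[OF \<sigma>] by (metis of_nat_sum)
  moreover have "(\<Sum>c\<in>{s<..k}. ?N c) \<le> (\<Sum>c\<in>{s<..k}. ?u)" using N by (intro sum_mono) auto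
  ultimately have dn: "real n - real (k - s) * ?u \<le> real (card (low s n \<sigma>))" unfolding low by simp
  have 1: "real s * ?u = real s / real k * real n + (real s / real k) * (\<eta> * real n)"
    by (simp add: add_divide_distrib algebra_simps)
  have 2: "(real s / real k) * (\<eta> * real n) \<le> 1 * (\<eta> * real n)"
    using k \<eta> by (intro mult_right_mono) auto
  have 3: "real n - real (k - s) * ?u = real s / real k * real n - (real (k - s) / real k) * (\<eta> * real n)"
    using k by (simp add: of_nat_diff field_simps)
  have 4: "(real (k - s) / real k) * (\<eta> * real n) \<le> 1 * (\<eta> * real n)"
    using k \<eta> by (intro mult_right_mono) auto
  have "\<bar>x - c\<bar> \<le> e" if "x \<le> u" "u = c + t" "t \<le> 1 * e" "v \<le> x" "v = c - t'" "t' \<le> 1 * e"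
    for x c e u v t t' :: real using that by linarith
  from this[OF up 1 2 dn 3 4]
  have "\<bar>real (card (low s n \<sigma>)) - real s / real k * real n\<bar> \<le> \<eta> * real n" .
  moreover have "\<sigma> \<in> proper_colorings n k E"
    using \<sigma> E unfolding proper_colorings_def cross_pairs_def by blast
  ultimately show ?thesis by (simp add: typical_def)
qed

section \<open>Exponents of bad colourings\<close>

text \<open>Each row puts mass \<open>s / k\<close> on the first \<open>s\<close> colours, up to
  \<open>2 * \<eta>\<close>: one \<eta> for the size window and one for the missing separation.
  Hence \<open>y = k * p c\<close> is at most \<open>(k + 1) / 2 + 2 * \<eta> * k\<close>, which is
  at most \<open>k / 2 + 3/5\<close>. There the linear majorant applies, and since the row sums to
  one it adds up to a constant.\<close>

lemma exponent_bad_le_ge5: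
  fixes \<kappa> \<gamma> \<eta> :: real
  assumes k: "k \<ge> 5" and \<eta>: "\<eta> > 0" "\<eta> \<le> 1 / (20 * real k)" and n: "n > 0" and bal: "balanced \<eta> n k \<sigma>"
    and lin: "\<And>y. 0 \<le> y \<Longrightarrow> y \<le> real k / 2 + 3/5 \<Longrightarrow> y ^ 2 / 2 - y * ln y \<le> \<kappa> + \<gamma> * y"
    and \<tau>: "\<tau> \<in> bad_colorings k (k div 2) \<eta> \<eta> n \<sigma>"
  shows "excess k \<eta> n \<sigma> \<tau>
    \<le> (ln (real k) + \<kappa> + \<gamma> - real k / (2 * (1 + \<eta>)) + offset k \<eta>) * real n"
proof -
  define s where "s = k div 2"
  let ?N = "\<lambda>i. csize n \<sigma> i" and ?n = "\<lambda>i c. real (cell n \<sigma> \<tau> i c)"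
  have \<sigma>: "\<sigma> \<in> vcolorings n k" using bal by (simp add: balanced_def)
  have \<tau>V: "\<tau> \<in> vcolorings n k" and low: "\<bar>real (card (low s n \<tau>)) - real s / real k * real n\<bar> \<le> \<eta> * real n"
    and ns: "\<not> separates n k \<eta> \<sigma> (low s n \<tau>)"
    using \<tau> by (simp_all add: bad_colorings_def s_def)
  have sk: "s \<le> k" by (simp add: s_def)
  have \<rho>: "\<bar>real (card (low s n \<tau>)) / real n - real s / real k\<bar> \<le> \<eta>"
  proof -
    have "real (card (low s n \<tau>)) / real n - real s / real k = (real (card (low s n \<tau>)) - real s / real k * real n) / real n"
      using n by (simp add: diff_divide_distrib)
    then have "\<bar>real (card (low s n \<tau>)) / real n - real s / real k\<bar> = \<bar>real (card (low s n \<tau>)) - real s / real k * real n\<bar> / real n"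
      by (simp add: abs_divide)
    also have "\<dots> \<le> \<eta> * real n / real n" using low by (rule divide_right_mono) simp
    finally show ?thesis using n by simp
  qed
  have \<eta>k: "2 * \<eta> * real k \<le> 1/10" using \<eta> k by (simp add: field_simps)
  have row: "(\<Sum>c=1..k. - (?n i c / ?N i) * ln (?n i c / ?N i) + real k / 2 * (?n i c / ?N i) ^ 2) \<le> ln (real k) + \<kappa> + \<gamma>"
    if i: "i \<in> {1..k}" and N: "card (community n \<sigma> i) > 0" for i
  proof -
    define p where "p c = ?n i c / ?N i" for c
    have p0: "p c \<ge> 0" for c by (simp add: p_def)
    have p1: "(\<Sum>c=1..k. p c) = 1"
      and ps: "(\<Sum>c=1..s. p c) = real (card (community n \<sigma> i \<inter> low s n \<tau>)) / ?N i"
      using row_ratio[OF \<tau>V N] unfolding p_def by blast+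
    have "low s n \<tau> \<subseteq> {1..n}" by (auto simp: low_def)
    from not_separates_ratio[OF n \<sigma> ns this i]
    have r: "\<bar>(\<Sum>c=1..s. p c) - real s / real k\<bar> \<le> 2 * \<eta>"
      unfolding ps using \<rho> by linarith
    have y: "real k * p c \<le> real k / 2 + 3/5" if c: "c \<in> {1..k}" for c
    proof (cases "c \<le> s")
      case True
      then have "p c \<le> (\<Sum>c=1..s. p c)" using c p0 by (intro member_le_sum) auto
      then have "p c \<le> real s / real k + 2 * \<eta>" using r by linarith
      then have "real k * p c \<le> real k * (real s / real k + 2 * \<eta>)" by (intro mult_left_mono) auto
      also have "\<dots> = real s + 2 * \<eta> * real k" using k by (simp add: algebra_simps)
      also have "real s \<le> real k / 2" unfolding s_def by linarith
      finally show ?thesis using \<eta>k by linarith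
    next
      case False
      then have "p c \<le> (\<Sum>c\<in>{1..k} - {1..s}. p c)" using c p0 by (intro member_le_sum) auto
      also have "\<dots> = 1 - (\<Sum>c=1..s. p c)" using sk p1 by (subst sum_diff) auto
      finally have "p c \<le> 1 - real s / real k + 2 * \<eta>" using r by linarith
      then have "real k * p c \<le> real k * (1 - real s / real k + 2 * \<eta>)" by (intro mult_left_mono) auto
      also have "\<dots> = real k - real s + 2 * \<eta> * real k" using k by (simp add: algebra_simps)
      also have "real k - real s \<le> real k / 2 + 1/2"
      proof -
        have "k \<le> 2 * s + 1" unfolding s_def by linarith
        then have "real k \<le> 2 * real s + 1" by linarith
        then show ?thesis by linarith
      qed
      finally show ?thesis using \<eta>k by linarith
    qed
    have each: "- p c * ln (p c) + real k / 2 * p c ^ 2 \<le> p c * ln (real k) + (\<kappa> / real k + \<gamma> * p c)" if c: "c \<in> {1..k}" for c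
    proof -
      define y where "y = real k * p c"
      have pc: "p c = y / real k" using k by (simp add: y_def)
      have y0: "y \<ge> 0" using p0 by (simp add: y_def)
      have ln: "y * ln (y / real k) = y * ln y - y * ln (real k)"
      proof (cases "y = 0")
        case False
        then have "ln (y / real k) = ln y - ln (real k)" using y0 k by (intro ln_divide_pos) auto
        then show ?thesis by (simp only: right_diff_distrib)
      qed simp
      have "y ^ 2 / 2 - y * ln y \<le> \<kappa> + \<gamma> * y"
        using lin[OF y0] y[OF c] unfolding y_def by blast
      then have "(y ^ 2 / 2 - y * ln (y / real k)) / real k \<le> (y * ln (real k) + \<kappa> + \<gamma> * y) / real k"
        unfolding ln by (intro divide_right_mono) auto
      moreover have "- (y / real k) * ln (y / real k) + real k / 2 * (y / real k) ^ 2 = (y ^ 2 / 2 - y * ln (y / real k)) / real k"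
        using k by (simp add: power2_eq_square diff_divide_distrib)
      moreover have "(y * ln (real k) + \<kappa> + \<gamma> * y) / real k = y / real k * ln (real k) + (\<kappa> / real k + \<gamma> * (y / real k))"
        by (simp add: add_divide_distrib)
      ultimately show ?thesis unfolding pc by (simp only:)
    qed
    have "(\<Sum>c=1..k. - p c * ln (p c) + real k / 2 * p c ^ 2)
        \<le> (\<Sum>c=1..k. p c * ln (real k) + (\<kappa> / real k + \<gamma> * p c))" by (intro sum_mono each)
    also have "\<dots> = (\<Sum>c=1..k. p c) * ln (real k) + (real k * (\<kappa> / real k) + \<gamma> * (\<Sum>c=1..k. p c))"
      by (simp add: sum.distrib sum_distrib_left sum_distrib_right)
    also have "\<dots> = ln (real k) + \<kappa> + \<gamma>" unfolding p1 using k by simp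
    finally show ?thesis unfolding p_def .
  qed
  have Q: "1 / real k * (real n)\<^sup>2 \<le> (\<Sum>c=1..k. (csize n \<tau> c)\<^sup>2)"
    using card_cross_pairs_le'[OF \<tau>V] card_cross_pairs[OF \<tau>V] k by (simp add: algebra_simps)
  have "excess k \<eta> n \<sigma> \<tau>
    \<le> (ln (real k) + \<kappa> + \<gamma> - (real k)\<^sup>2 / (2 * (1 + \<eta>)) * (1 / real k) + offset k \<eta>) * real n"
    using k by (intro exponent_le[OF _ \<eta>(1) n bal \<tau>V row Q]) auto
  also have "(real k)\<^sup>2 / (2 * (1 + \<eta>)) * (1 / real k) = real k / (2 * (1 + \<eta>))"
    using k by (simp add: power2_eq_square)
  finally show ?thesis .
qed

text \<open>The size of \<open>low\<close> is free here. A deviation \<open>d\<close> from one half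
  gains at most \<open>3 * d^2\<close> in the rows, but it makes the classes of \<tau> uneven, which
  costs \<open>8 / (1 + \<eta>) * d^2\<close>, at least \<open>4 * d^2\<close>.\<close>

lemma exponent_bad_le_4:
  fixes \<eta> :: real
  assumes \<eta>: "0 < \<eta>" "\<eta> \<le> 1" and n: "n > 0" and bal: "balanced \<eta> n 4 \<sigma>"
    and \<tau>: "\<tau> \<in> bad_colorings 4 2 (1/2) \<eta> n \<sigma>"
  shows "excess 4 \<eta> n \<sigma> \<tau>
    \<le> (ln 4 + 1/2 + 3 * \<eta> - 2 / (1 + \<eta>) + offset 4 \<eta>) * real n"
proof -
  let ?N = "\<lambda>i. csize n \<sigma> i" and ?n = "\<lambda>i c. real (cell n \<sigma> \<tau> i c)"
  have \<sigma>: "\<sigma> \<in> vcolorings n 4" using bal by (simp add: balanced_def)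
  have \<tau>V: "\<tau> \<in> vcolorings n 4" and ns: "\<not> separates n 4 \<eta> \<sigma> (low 2 n \<tau>)"
    using \<tau> by (simp_all add: bad_colorings_def)
  define d where "d = real (card (low 2 n \<tau>)) / real n - 1/2"
  have lowsub: "low 2 n \<tau> \<subseteq> {1..n}" by (auto simp: low_def)
  then have "card (low 2 n \<tau>) \<le> card {1..n}" by (intro card_mono) auto
  then have d: "\<bar>d\<bar> \<le> 1/2" using n by (simp add: d_def abs_le_iff field_simps)
  have row: "(\<Sum>c=1..4. - (?n i c / ?N i) * ln (?n i c / ?N i) + real 4 / 2 * (?n i c / ?N i) ^ 2) \<le> ln 4 + 1/2 + 3 * d ^ 2 + 3 * \<eta>"
    if i: "i \<in> {1..4}" and N: "card (community n \<sigma> i) > 0" for i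
  proof -
    define p where "p c = ?n i c / ?N i" for c
    have p0: "p c \<ge> 0" for c by (simp add: p_def)
    have p1: "(\<Sum>c=1..4. p c) = 1"
      and ps': "(\<Sum>c=1..2. p c) = real (card (community n \<sigma> i \<inter> low 2 n \<tau>)) / ?N i"
      using row_ratio[OF \<tau>V N] unfolding p_def by blast+
    have "{1..2::nat} = {1, 2}" by auto
    then have ps: "p 1 + p 2 = real (card (community n \<sigma> i \<inter> low 2 n \<tau>)) / ?N i" using ps' by simp
    define e where "e = p 1 + p 2 - 1/2"
    have ed: "\<bar>e - d\<bar> \<le> \<eta>"
      using not_separates_ratio[OF n \<sigma> ns lowsub i] unfolding ps[symmetric] e_def d_def by linarith
    have "card (community n \<sigma> i \<inter> low 2 n \<tau>) \<le> card (community n \<sigma> i)" by (intro card_mono) auto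
    then have "p 1 + p 2 \<le> 1" using N unfolding ps by simp
    then have e: "\<bar>e\<bar> \<le> 1/2" using p0[of 1] p0[of 2] unfolding e_def by linarith
    \<comment> \<open>The row has its own deviation \<open>e\<close>, within \<eta> of the common
      \<open>d\<close>; as both are at most 1/2 in absolute value, the squares also differ by at
      most \<eta>.\<close>
    have "\<bar>(e - d) * (e + d)\<bar> \<le> \<eta> * 1"
      unfolding abs_mult using ed e d \<eta> by (intro mult_mono) auto
    then have "e ^ 2 \<le> d ^ 2 + \<eta>" by (simp add: power2_eq_square algebra_simps)
    moreover have "(\<Sum>c=1..4. - p c * ln (p c) + 2 * p c ^ 2) \<le> ln 4 + 1/2 + 3 * e ^ 2"
      by (rule four_color_row_bound[OF p0 p1 e_def])
    ultimately have "(\<Sum>c=1..4. - p c * ln (p c) + 2 * p c ^ 2) \<le> ln 4 + 1/2 + 3 * d ^ 2 + 3 * \<eta>"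
      by linarith
    moreover have "real 4 / 2 = 2" by simp
    ultimately show ?thesis unfolding p_def by (simp only:)
  qed
  define T where "T c = csize n \<tau> c" for c
  have Q: "(1/4 + d ^ 2) * (real n)\<^sup>2 \<le> (\<Sum>c=1..4. (csize n \<tau> c)\<^sup>2)"
  proof -
    have set4: "{1..4::nat} = {1, 2, 3, 4}" and set2: "{1..2::nat} = {1, 2}" by auto
    have "(\<Sum>c=1..4. T c) = real n" unfolding T_def using sum_community[OF \<tau>V] by (metis of_nat_sum)
    then have t4: "T 1 + T 2 + T 3 + T 4 = real n" unfolding set4 by simp
    have "(\<Sum>c=1..2. T c) = real (card (low 2 n \<tau>))"
      unfolding T_def using sum_card_low[OF \<tau>V] by (metis of_nat_sum)
    then have t2: "T 1 + T 2 = (1/2 + d) * real n" unfolding set2 using n by (simp add: d_def)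
    then have t3: "T 3 + T 4 = (1/2 - d) * real n" using t4 by (simp add: algebra_simps)
    have "(x + y) ^ 2 / 2 \<le> x ^ 2 + y ^ 2" for x y :: real
    proof -
      have "0 \<le> (x - y) ^ 2" by simp
      then show ?thesis by (simp add: power2_eq_square algebra_simps)
    qed
    from this[of "T 1" "T 2"] this[of "T 3" "T 4"]
    have "((1/2 + d) * real n) ^ 2 / 2 + ((1/2 - d) * real n) ^ 2 / 2 \<le> (T 1)\<^sup>2 + (T 2)\<^sup>2 + (T 3)\<^sup>2 + (T 4)\<^sup>2"
      unfolding t2 t3 by linarith
    moreover have "((1/2 + d) * real n) ^ 2 / 2 + ((1/2 - d) * real n) ^ 2 / 2 = (1/4 + d ^ 2) * (real n)\<^sup>2"
      by (simp add: power2_eq_square field_simps)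
    moreover have "(\<Sum>c=1..4. (T c)\<^sup>2) = (T 1)\<^sup>2 + (T 2)\<^sup>2 + (T 3)\<^sup>2 + (T 4)\<^sup>2" unfolding set4 by simp
    ultimately show ?thesis unfolding T_def by linarith
  qed
  have "excess 4 \<eta> n \<sigma> \<tau>
    \<le> (ln 4 + 1/2 + 3 * d ^ 2 + 3 * \<eta> - (real 4)\<^sup>2 / (2 * (1 + \<eta>)) * (1/4 + d ^ 2) + offset 4 \<eta>) * real n"
    by (rule exponent_le[OF _ \<eta>(1) n bal \<tau>V row Q]) auto
  also have "\<dots> \<le> (ln 4 + 1/2 + 3 * \<eta> - 2 / (1 + \<eta>) + offset 4 \<eta>) * real n"
  proof (intro mult_right_mono)
    have "3 \<le> 8 / (1 + \<eta>)" using \<eta> by (simp add: field_simps)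
    then have "3 * d ^ 2 \<le> 8 / (1 + \<eta>) * d ^ 2" by (intro mult_right_mono) auto
    moreover have "(real 4)\<^sup>2 / (2 * (1 + \<eta>)) * (1/4 + d ^ 2) = 2 / (1 + \<eta>) + 8 / (1 + \<eta>) * d ^ 2"
    proof -
      have "(real 4)\<^sup>2 / (2 * (1 + \<eta>)) = 8 / (1 + \<eta>)"
        using mult_divide_mult_cancel_left[of 2 8 "1 + \<eta>"] by simp
      moreover have "8 / x * (1/4) = 2 / x" for x :: real by simp
      ultimately show ?thesis by (simp only: distrib_left)
    qed
    ultimately show "ln 4 + 1/2 + 3 * d ^ 2 + 3 * \<eta> - (real 4)\<^sup>2 / (2 * (1 + \<eta>)) * (1/4 + d ^ 2) + offset 4 \<eta>
      \<le> ln 4 + 1/2 + 3 * \<eta> - 2 / (1 + \<eta>) + offset 4 \<eta>" by linarith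
  qed simp
  finally show ?thesis .
qed

section \<open>Choice of the slack\<close>

text \<open>In the limit of small \<eta> the bound is negative, so \<open>\<zeta> = 0\<close> is
  enough: a single typical colouring is needed, and the hidden one is always there. The event
  excluded in the lower bound on typical colourings is therefore empty.\<close>

lemma detection_ge5:
  assumes k: "k \<ge> 5"
  shows "\<exists>\<eta>>0. solves_detection (sampler k (k div 2) \<eta>) k 0 (rate k \<eta>)"
proof -
  let ?L = "ln (real k / (real k - 1))"
  obtain \<kappa> \<gamma> where lin: "\<And>y. 0 \<le> y \<Longrightarrow> y \<le> real k / 2 + 3/5 \<Longrightarrow> y ^ 2 / 2 - y * ln y \<le> \<kappa> + \<gamma> * y"
    and str: "ln (real k) + \<kappa> + \<gamma> - 1/2 < (real k - 1) ^ 2 / 2 * ?L"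
    using linear_bound_exists[OF k] by blast
  define B where "B \<eta> = ln (real k) + \<kappa> + \<gamma> - real k / (2 * (1 + \<eta>)) + offset k \<eta>" for \<eta>
  have "(B \<longlongrightarrow> ln (real k) + \<kappa> + \<gamma> - real k / (2 * (1 + 0)) + ((real k - 1) / 2 - (real k - 1) ^ 2 / 2 * ?L)) (at_right 0)"
    unfolding B_def using k by (intro tendsto_add tendsto_diff tendsto_divide tendsto_mult tendsto_const tendsto_ident_at offset_tendsto) auto
  moreover have "ln (real k) + \<kappa> + \<gamma> - real k / (2 * (1 + 0)) + ((real k - 1) / 2 - (real k - 1) ^ 2 / 2 * ?L) < 0"
    using str by (simp add: diff_divide_distrib)
  ultimately have "\<forall>\<^sub>F \<eta> in at_right 0. B \<eta> < 0" by (rule order_tendstoD)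
  moreover have "\<forall>\<^sub>F \<eta> in at_right (0::real). 0 < \<eta> \<and> \<eta> < 1 / (20 * real k)"
    using k by (intro eventually_conj eventually_at_right_less eventually_at_rightI[of 0 "1 / (20 * real k)"]) auto
  ultimately have "\<forall>\<^sub>F \<eta> in at_right (0::real). B \<eta> < 0 \<and> 0 < \<eta> \<and> \<eta> < 1 / (20 * real k)"
    by eventually_elim blast
  then obtain \<eta> where \<eta>: "B \<eta> < 0" "0 < \<eta>" "\<eta> \<le> 1 / (20 * real k)"
    using eventually_happens[of _ "at_right (0::real)"] by (metis (mono_tags, lifting) less_imp_le trivial_limit_at_right_real)
  have "solves_detection (sampler k (k div 2) \<eta>) k 0 (rate k \<eta>)"
  proof (rule detection_from_counting[where \<eta> = \<eta> and \<epsilon> = \<eta> and \<zeta> = 0 and B = "B \<eta>" and L = ?L and C = 0])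
    show "k \<ge> 2" using k by simp
    show "rate k \<eta> > 0" using k \<eta> by (simp add: rate_def)
    show "?L \<ge> 0" using k by (intro ln_ge_zero) simp
    show "\<forall>\<^sub>F n in sequentially. \<forall>\<sigma>. balanced \<eta> n k \<sigma> \<longrightarrow> (\<forall>\<tau>\<in>bad_colorings k (k div 2) \<eta> \<eta> n \<sigma>.
        excess k \<eta> n \<sigma> \<tau> \<le> B \<eta> * real n)"
      using eventually_gt_at_top[of 0]
    proof eventually_elim
      case (elim n)
      then show ?case using exponent_bad_le_ge5[OF k \<eta>(2,3) elim _ lin] unfolding B_def by blast
    qed
    show "\<forall>\<^sub>F n in sequentially. \<forall>\<sigma>. balanced \<eta> n k \<sigma> \<longrightarrow>
      pr (edges_pmf n 0 (rate k \<eta>) \<sigma>) {E. exp (0 * real n) \<le> real (card (typical k (k div 2) \<eta> n E))} \<ge> 1 - 0 / real n"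
    proof (intro always_eventually allI impI)
      fix n \<sigma> assume bal: "balanced \<eta> n k \<sigma>"
      let ?M = "edges_pmf n 0 (rate k \<eta>) \<sigma>"
      have "1 - pr ?M {} \<le> pr ?M {E. exp (0 * real n) \<le> real (card (typical k (k div 2) \<eta> n E))}"
      proof (rule prob_ge_complement)
        fix E assume E: "E \<in> set_pmf ?M" "E \<notin> {E. exp (0 * real n) \<le> real (card (typical k (k div 2) \<eta> n E))}"
        have "\<sigma> \<in> typical k (k div 2) \<eta> n E"
          by (rule planted_typical[OF \<eta>(2) _ _ bal set_edges_pmf_planted[OF E(1)]]) (use k in auto)
        then have "0 < card (typical k (k div 2) \<eta> n E)" by (metis card_gt_0_iff empty_iff finite_typical)
        then have "1 \<le> real (card (typical k (k div 2) \<eta> n E))" by linarith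
        then show "E \<in> {}" using E(2) by simp
      qed
      then show "1 - 0 / real n \<le> pr ?M {E. exp (0 * real n) \<le> real (card (typical k (k div 2) \<eta> n E))}" by simp
    qed
  qed (use \<eta> in auto)
  then show ?thesis using \<eta> by blast
qed

text \<open>Both the planted entropy and the bound on bad colourings are continuous as \<eta>
  decreases to 0, so the strict gap of the limits survives for some positive \<eta>.\<close>

lemma detection_4: "\<exists>\<eta>>0. solves_detection (sampler 4 2 (1/2)) 4 0 (rate 4 \<eta>)"
proof -
  define B where "B \<eta> = ln 4 + 1/2 + 3 * \<eta> - 2 / (1 + \<eta>) + offset 4 \<eta>" for \<eta> :: real
  have "(offset 4 \<longlongrightarrow> (real 4 - 1) / 2 - (real 4 - 1) ^ 2 / 2 * ln (real 4 / (real 4 - 1))) (at_right 0)"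
    by (rule offset_tendsto) simp
  then have off: "(offset 4 \<longlongrightarrow> 3 / 2 - 9 / 2 * ln (4 / 3)) (at_right 0)" by simp
  have "(B \<longlongrightarrow> ln 4 + 1/2 + 3 * 0 - 2 / (1 + 0) + (3 / 2 - 9 / 2 * ln (4 / 3))) (at_right 0)"
    unfolding B_def by (intro tendsto_add tendsto_diff tendsto_divide tendsto_mult tendsto_const tendsto_ident_at off) auto
  moreover have "(planted_entropy \<longlongrightarrow> ln 2 * (3 * exp (- 3) - 2 * 0)
     - ln (4 / 3) * (12 * exp (- 6 * (1 - 3 * 0) / (1 + 0)) + 2 * 0)) (at_right 0)"
    unfolding planted_entropy_def
    by (intro tendsto_add tendsto_diff tendsto_divide tendsto_mult tendsto_const tendsto_ident_at tendsto_exp) auto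
  ultimately have "((\<lambda>\<eta>. planted_entropy \<eta> - B \<eta>) \<longlongrightarrow> (ln 2 * (3 * exp (- 3) - 2 * 0)
     - ln (4 / 3) * (12 * exp (- 6 * (1 - 3 * 0) / (1 + 0)) + 2 * 0))
     - (ln 4 + 1/2 + 3 * 0 - 2 / (1 + 0) + (3 / 2 - 9 / 2 * ln (4 / 3)))) (at_right 0)"
    by (intro tendsto_diff)
  moreover have "(ln 2 * (3 * exp (- 3) - 2 * 0)
     - ln (4 / 3) * (12 * exp (- 6 * (1 - 3 * 0) / (1 + 0)) + 2 * 0))
     - (ln 4 + 1/2 + 3 * 0 - 2 / (1 + 0) + (3 / 2 - 9 / 2 * ln (4 / 3))) > (0::real)"
  proof -
    have "ln (4::real) = 2 * ln 2" using ln_realpow[of 2 2] by simp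
    then show ?thesis using planted_entropy_gap by simp
  qed
  ultimately have "\<forall>\<^sub>F \<eta> in at_right 0. planted_entropy \<eta> - B \<eta> > 0" by (rule order_tendstoD)
  moreover have "\<forall>\<^sub>F \<eta> in at_right (0::real). 0 < \<eta> \<and> \<eta> < 1/3"
    by (intro eventually_conj eventually_at_right_less eventually_at_rightI[of 0 "1/3"]) auto
  ultimately have "\<forall>\<^sub>F \<eta> in at_right (0::real). planted_entropy \<eta> - B \<eta> > 0 \<and> 0 < \<eta> \<and> \<eta> < 1/3"
    by eventually_elim blast
  then obtain \<eta> where \<eta>: "planted_entropy \<eta> - B \<eta> > 0" "0 < \<eta>" "\<eta> < 1/3"
    using eventually_happens[of _ "at_right (0::real)"] by (metis (mono_tags, lifting) trivial_limit_at_right_real)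
  have rate: "rate 4 \<eta> = 12 / (1 + \<eta>)" by (simp add: rate_def)
  obtain C where C: "\<forall>\<^sub>F n in sequentially. \<forall>\<sigma>. balanced \<eta> n 4 \<sigma> \<longrightarrow>
    pr (edges_pmf n 0 (rate 4 \<eta>) \<sigma>)
      {E. exp (planted_entropy \<eta> * real n) \<le> real (card (proper_colorings n 4 E))} \<ge> 1 - C / real n"
    using many_proper_colorings[OF \<eta>(2,3)] unfolding rate by blast
  \<comment> \<open>With \<open>\<delta> = 1/2\<close> the window is the whole range from 0 to
    \<open>n\<close>, so the lower bound for all proper colourings can be used.\<close>
  have all: "typical 4 2 (1/2) n E = proper_colorings n 4 E" for n E
  proof -
    have "\<bar>real (card (low 2 n \<tau>)) - real 2 / real 4 * real n\<bar> \<le> 1/2 * real n" for \<tau>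
    proof -
      have "low 2 n \<tau> \<subseteq> {1..n}" by (auto simp: low_def)
      then have "card (low 2 n \<tau>) \<le> card {1..n}" by (intro card_mono) auto
      then have "real (card (low 2 n \<tau>)) \<le> real n" by simp
      moreover have "real 2 / real 4 = 1/2" by simp
      ultimately show ?thesis by linarith
    qed
    then show ?thesis unfolding typical_def by blast
  qed
  have "solves_detection (sampler 4 2 (1/2)) 4 0 (rate 4 \<eta>)"
  proof (rule detection_from_counting[where \<eta> = \<eta> and \<epsilon> = \<eta> and \<zeta> = "planted_entropy \<eta>" and B = "B \<eta>" and L = "ln (real 4 / (real 4 - 1))" and C = C])
    show "rate 4 \<eta> > 0" using \<eta> by (simp add: rate)
    show "\<forall>\<^sub>F n in sequentially. \<forall>\<sigma>. balanced \<eta> n 4 \<sigma> \<longrightarrow> (\<forall>\<tau>\<in>bad_colorings 4 2 (1/2) \<eta> n \<sigma>.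
        excess 4 \<eta> n \<sigma> \<tau> \<le> B \<eta> * real n)"
      using eventually_gt_at_top[of 0]
    proof eventually_elim
      case (elim n)
      have "\<eta> \<le> 1" using \<eta> by simp
      from exponent_bad_le_4[OF \<eta>(2) this elim] show ?case unfolding B_def by blast
    qed
    show "\<forall>\<^sub>F n in sequentially. \<forall>\<sigma>. balanced \<eta> n 4 \<sigma> \<longrightarrow>
      pr (edges_pmf n 0 (rate 4 \<eta>) \<sigma>)
        {E. exp (planted_entropy \<eta> * real n) \<le> real (card (typical 4 2 (1/2) n E))} \<ge> 1 - C / real n"
      unfolding all by (rule C)
  qed (use \<eta> in auto)
  then show ?thesis using \<eta> by blast
qed

theorem corollary2:
  fixes k :: nat
  assumes "k \<ge> 4"
  shows "\<exists>a b :: real. a \<ge> 0 \<and> b \<ge> 0 \<and> SNR k a b < 1 \<and>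
           (\<exists>A. partition_algorithm A \<and> solves_detection A k a b)"
proof -
  have "\<exists>s \<delta> \<eta>. \<eta> > 0 \<and> solves_detection (sampler k s \<delta>) k 0 (rate k \<eta>)"
  proof (cases "k = 4")
    case True
    then show ?thesis using detection_4 by blast
  next
    case False
    then show ?thesis using assms detection_ge5[of k] by fastforce
  qed
  then obtain s \<delta> \<eta> where \<eta>: "\<eta> > 0" and det: "solves_detection (sampler k s \<delta>) k 0 (rate k \<eta>)" by blast
  have "rate k \<eta> \<ge> 0" using assms \<eta> by (simp add: rate_def)
  moreover have "SNR k 0 (rate k \<eta>) < 1" by (rule SNR_rate) (use assms \<eta> in auto)
  ultimately show ?thesis
    using det partition_algorithm_sampler by (intro exI[of _ 0] exI[of _ "rate k \<eta>"]) auto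
qed

end
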